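(* Let $\alpha,\beta>-1$. Let $r\ge 1$ be an integer and let $f:[-1,1]\to\mathbb{R}$ be a function whose derivative $f^{(r-1)}$ is absolutely continuous on $[-1,1]$ and satisfies $f^{(r-1)}(t)=f^{(r-1)}(-1)+\int_{-1}^t g(y)\,dy$ for all $t\in[-1,1]$, for some absolutely integrable $g$ of bounded variation on $[-1,1]$. For each $n$ let $E_n[f]=f-L[f]$, where $L[f]$ is the polynomial of degree at most $n$ interpolating $f$ at the $n+1$ roots of $(1+t)P_n^{(\alpha,\beta)}(t)$. Then for $n\ge r+1$, $$\|E_n[f]\|_\infty=n^{-r}\cdot\begin{cases} O\left(n^{-\min\{0,\beta+\frac12,\beta-\alpha\}}\right),&-1<\beta\le\frac12,\\ O\left(n^{-\min\{0,\frac12-\alpha,\frac52-\beta,\beta-\alpha\}}\right),&\beta>\frac12. \end{cases}$$ In particular, $\|E_n[f]\|_\infty=O(n^{-r})$ whenever $(\alpha,\beta)\in\widehat S$, where $$\widehat S=\left(\left(-1,\tfrac12\right]\times\left[-\tfrac12,\tfrac52\right]\right)\setminus\left\{(\alpha,\beta):-\tfrac12\le\beta\le\tfrac12,\ \beta<\alpha\le\tfrac12\right\}.$$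
   Context: $P_n^{(\alpha,\beta)}$ is the Jacobi polynomial of degree $n$ (orthogonal on $[-1,1]$ with respect to the weight $(1-t)^\alpha(1+t)^\beta$, normalized by $P_n^{(\alpha,\beta)}(1)=\binom{n+\alpha}{n}$); its $n$ roots are simple and lie in $(-1,1)$. $\|\cdot\|_\infty$ is the supremum norm on $[-1,1]$; $f^{(0)}=f$. The $O$-constants may depend on $f,r,\alpha,\beta$ but not on $n$. *)

theory Defs
  imports "HOL-Analysis.Analysis" "HOL-Computational_Algebra.Polynomial"
begin

section \<open>Jacobi polynomials\<close>

definition jacobi_weight :: "real \<Rightarrow> real \<Rightarrow> real \<Rightarrow> real" where
  "jacobi_weight \<alpha> \<beta> t = (1 - t) powr \<alpha> * (1 + t) powr \<beta>"

definition is_jacobi_poly :: "real \<Rightarrow> real \<Rightarrow> nat \<Rightarrow> real poly \<Rightarrow> bool" where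
  "is_jacobi_poly \<alpha> \<beta> n p \<longleftrightarrow>
     degree p = n \<and>
     (\<forall>q. degree q < n \<longrightarrow>
        integral {-1..1} (\<lambda>t. poly p t * poly q t * jacobi_weight \<alpha> \<beta> t) = 0) \<and>
     poly p 1 = (real n + \<alpha>) gchoose n"

text \<open>Existence and uniqueness for \<open>\<alpha>, \<beta> > -1\<close> is \<open>ex1_is_jacobi_poly\<close> below.\<close>

definition jacobi_poly :: "real \<Rightarrow> real \<Rightarrow> nat \<Rightarrow> real poly" where
  "jacobi_poly \<alpha> \<beta> n = (THE p. is_jacobi_poly \<alpha> \<beta> n p)"


section \<open>Interpolation and its error\<close>

definition jacobi_nodes :: "real \<Rightarrow> real \<Rightarrow> nat \<Rightarrow> real set" where
  "jacobi_nodes \<alpha> \<beta> n = {t. poly ([:1, 1:] * jacobi_poly \<alpha> \<beta> n) t = 0}"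

text \<open>
  For \<open>\<alpha>, \<beta> > -1\<close> there are exactly \<open>n + 1\<close> nodes, they lie in \<open>[-1, 1)\<close>, and the
  interpolant exists and is unique: see \<open>card_jacobi_nodes\<close>, \<open>jacobi_nodes_subset\<close> and
  \<open>ex1_jacobi_interpolant\<close> below.
\<close>

definition jacobi_interpolant :: "real \<Rightarrow> real \<Rightarrow> nat \<Rightarrow> (real \<Rightarrow> real) \<Rightarrow> real poly" where
  "jacobi_interpolant \<alpha> \<beta> n f =
     (THE p. degree p \<le> n \<and> (\<forall>t \<in> jacobi_nodes \<alpha> \<beta> n. poly p t = f t))"

definition jacobi_interp_error :: "real \<Rightarrow> real \<Rightarrow> nat \<Rightarrow> (real \<Rightarrow> real) \<Rightarrow> real \<Rightarrow> real" where
  "jacobi_interp_error \<alpha> \<beta> n f t = f t - poly (jacobi_interpolant \<alpha> \<beta> n f) t"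

text \<open>
  The supremum norm on \<open>[-1, 1]\<close>. As a real supremum it is meaningful only for functions
  that are bounded there, in particular for continuous ones.
\<close>

definition sup_norm :: "(real \<Rightarrow> real) \<Rightarrow> real" where
  "sup_norm h = (SUP t \<in> {-1..1}. \<bar>h t\<bar>)"


section \<open>Function classes\<close>

text \<open>
  Absolute continuity of a function (not of a measure, as in theory \<open>Radon_Nikodym\<close>); the
  finitely many non-overlapping intervals are \<open>[u i, v i]\<close> for \<open>i < m\<close>.
\<close>

definition abs_continuous_on :: "real set \<Rightarrow> (real \<Rightarrow> real) \<Rightarrow> bool" where
  "abs_continuous_on S h \<longleftrightarrow>
     (\<forall>\<epsilon>>0. \<exists>\<delta>>0. \<forall>(m::nat) u v.
        (\<forall>i<m. u i \<le> v i \<and> {u i..v i} \<subseteq> S) \<and>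
        disjoint_family_on (\<lambda>i. {u i<..<v i}) {..<m} \<and>
        (\<Sum>i<m. v i - u i) < \<delta> \<longrightarrow>
        (\<Sum>i<m. \<bar>h (v i) - h (u i)\<bar>) < \<epsilon>)"

definition bounded_variation_on :: "real set \<Rightarrow> (real \<Rightarrow> real) \<Rightarrow> bool" where
  "bounded_variation_on S h \<longleftrightarrow>
     (\<exists>V. \<forall>(m::nat) x. x ` {..m} \<subseteq> S \<and> mono_on {..m} x \<longrightarrow>
        (\<Sum>i<m. \<bar>h (x (Suc i)) - h (x i)\<bar>) \<le> V)"


section \<open>The exponent of the convergence rate\<close>

definition jacobi_exponent :: "real \<Rightarrow> real \<Rightarrow> real" where
  "jacobi_exponent \<alpha> \<beta> =
     (if \<beta> \<le> 1/2 then Min {0, \<beta> + 1/2, \<beta> - \<alpha>}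
      else Min {0, 1/2 - \<alpha>, 5/2 - \<beta>, \<beta> - \<alpha>})"

definition S_hat :: "(real \<times> real) set" where
  "S_hat = ({-1<..1/2} \<times> {-1/2..5/2}) -
     {(\<alpha>, \<beta>). -1/2 \<le> \<beta> \<and> \<beta> \<le> 1/2 \<and> \<beta> < \<alpha> \<and> \<alpha> \<le> 1/2}"


section \<open>Well-definedness of the Jacobi polynomials and of the interpolant\<close>

lemma jacobi_weight_nonneg: "jacobi_weight \<alpha> \<beta> t \<ge> 0"
  by (simp add: jacobi_weight_def)

lemma jacobi_weight_integrable:
  assumes "\<alpha> > -1" "\<beta> > -1"
  shows "jacobi_weight \<alpha> \<beta> integrable_on {-1..1}"
proof -
  define B where "B = (\<lambda>t::real. t powr \<beta> * (1 - t) powr \<alpha>)"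
  have "B integrable_on {0..1}"
    using integrable_Beta'[of "\<beta> + 1" "\<alpha> + 1"] assms by (simp add: B_def)
  then obtain I where "(B has_integral I) (cbox 0 1)"
    by (auto simp: integrable_on_def)
  from has_integral_affinity'[OF this, of "1/2" "1/2"]
  have "(\<lambda>t. B (t/2 + 1/2)) integrable_on {-1..1}"
    by (auto simp: integrable_on_def)
  then have "(\<lambda>t. 2 powr (\<alpha> + \<beta>) * B (t/2 + 1/2)) integrable_on {-1..1}"
    by (rule integrable_on_mult_right)
  then show ?thesis
  proof (rule integrable_eq)
    fix t :: real assume t: "t \<in> {-1..1}"
    have 1: "t/2 + 1/2 = (1 + t) / 2" "1 - (1 + t) / 2 = (1 - t) / 2"
      by (simp_all add: field_simps)
    show "2 powr (\<alpha> + \<beta>) * B (t/2 + 1/2) = jacobi_weight \<alpha> \<beta> t"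
      using t unfolding B_def 1 jacobi_weight_def by (simp add: powr_divide powr_add)
  qed
qed

lemma poly_jacobi_weight_integrable:
  assumes "\<alpha> > -1" "\<beta> > -1"
  shows "(\<lambda>t. poly p t * jacobi_weight \<alpha> \<beta> t) integrable_on {-1..1}"
proof -
  have "(\<lambda>t. poly p t * jacobi_weight \<alpha> \<beta> t) absolutely_integrable_on {-1..1}"
  proof (rule absolutely_integrable_bounded_measurable_product_real)
    show "poly p \<in> borel_measurable (lebesgue_on {-1..1})"
      by (intro continuous_imp_measurable_on_sets_lebesgue continuous_intros) auto
    show "bounded (poly p ` {-1..1})"
      by (intro compact_imp_bounded compact_continuous_image continuous_intros) auto
    show "jacobi_weight \<alpha> \<beta> absolutely_integrable_on {-1..1}"
      by (intro nonnegative_absolutely_integrable_1 jacobi_weight_integrable assms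
          jacobi_weight_nonneg)
  qed auto
  then show ?thesis
    using set_lebesgue_integral_eq_integral(1) by blast
qed

definition jacobi_functional :: "real \<Rightarrow> real \<Rightarrow> real poly \<Rightarrow> real" where
  "jacobi_functional \<alpha> \<beta> p = integral {-1..1} (\<lambda>t. poly p t * jacobi_weight \<alpha> \<beta> t)"

context
  fixes \<alpha> \<beta> :: real
  assumes ab: "\<alpha> > -1" "\<beta> > -1"
begin

private abbreviation J where "J \<equiv> jacobi_functional \<alpha> \<beta>"

private lemmas int = poly_jacobi_weight_integrable[OF ab]

private lemma J_add: "J (p + q) = J p + J q"
  unfolding jacobi_functional_def
  by (simp add: ring_distribs integral_add[OF int int])

private lemma J_smult: "J (smult c p) = c * J p"
  unfolding jacobi_functional_def by (simp add: mult.assoc)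

private lemma J_diff: "J (p - q) = J p - J q"
  using J_add[of p "smult (-1) q"] J_smult[of "-1" q] by simp

private lemma J_0: "J 0 = 0"
  by (simp add: jacobi_functional_def)

private lemma J_sum: "finite A \<Longrightarrow> J (sum h A) = (\<Sum>x\<in>A. J (h x))"
  by (induction A rule: finite_induct) (auto simp: J_0 J_add)

private lemma J_pos:
  assumes nonneg: "\<And>t. t \<in> {-1<..<1} \<Longrightarrow> poly p t \<ge> 0" and "p \<noteq> 0"
  shows "J p > 0"
proof (rule ccontr)
  assume "\<not> J p > 0"
  define F where "F = (\<lambda>t. poly p t * jacobi_weight \<alpha> \<beta> t)"
  have nonneg': "poly p t \<ge> 0" if "t \<in> {-1..1}" for t
  proof -
    have "closure {-1<..<1::real} \<subseteq> {t. poly p t \<ge> 0}"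
      by (rule closure_minimal)
         (use nonneg in \<open>auto intro!: closed_Collect_le continuous_intros\<close>)
    then show ?thesis using that by auto
  qed
  have Fpos: "F t \<ge> 0" if "t \<in> {-1..1}" for t
    using nonneg'[OF that] by (simp add: F_def jacobi_weight_nonneg)
  have Fint: "F integrable_on {-1..1}"
    unfolding F_def by (rule int)
  have Fint2: "F integrable_on {-1/2..1/2}"
    by (rule integrable_on_subinterval[OF Fint]) auto
  have "integral {-1/2..1/2} F \<le> integral {-1..1} F"
    by (rule integral_subset_le) (use Fint Fint2 Fpos in auto)
  moreover have "integral {-1/2..1/2} F \<ge> 0"
    by (rule integral_nonneg) (use Fint2 Fpos in auto)
  ultimately have "integral {-1/2..1/2} F = 0"
    using \<open>\<not> J p > 0\<close> by (simp add: jacobi_functional_def F_def)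
  then have *: "(F has_integral 0) (cbox (-1/2) (1/2))"
    using Fint2 by (simp add: has_integral_iff)
  have "F t = 0" if "t \<in> {-1/2..1/2}" for t
  proof (rule has_integral_0_cbox_imp_0[OF _ _ *])
    show "continuous_on (cbox (-1/2) (1/2)) F"
      unfolding F_def jacobi_weight_def
      by (intro continuous_intros) auto
  qed (use Fpos that in auto)
  then have "poly p t = 0" if "t \<in> {-1/2..1/2}" for t
    using that by (force simp: F_def jacobi_weight_def)
  then have "{-1/2..1/2} \<subseteq> {t. poly p t = 0}"
    by auto
  then have "finite {-1/2..1/2::real}"
    using poly_roots_finite[OF \<open>p \<noteq> 0\<close>] finite_subset by blast
  then show False
    by (simp add: infinite_Icc)
qed

private lemma orth_eq:
  "integral {-1..1} (\<lambda>t. poly p t * poly q t * jacobi_weight \<alpha> \<beta> t) = J (p * q)"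
  by (simp add: jacobi_functional_def)

private lemma orth_span:
  assumes P: "\<And>k. k < n \<Longrightarrow> degree (P k) = k \<and> P k \<noteq> 0 \<and> J (p * P k) = 0"
    and "m \<le> n" and "q = 0 \<or> degree q < m"
  shows "J (p * q) = 0"
  using assms(2,3)
proof (induction m arbitrary: q)
  case 0
  then show ?case by (auto simp: J_0)
next
  case (Suc m)
  show ?case
  proof (cases "degree q = m \<and> q \<noteq> 0")
    case True
    define c where "c = lead_coeff q / lead_coeff (P m)"
    define q' where "q' = q - smult c (P m)"
    have Pm: "degree (P m) = m" "P m \<noteq> 0" "J (p * P m) = 0"
      using P[of m] Suc.prems(1) by auto
    have le: "degree q' \<le> m"
      unfolding q'_def using Pm True by (intro degree_diff_le degree_smult_le[THEN order_trans]) auto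
    have "coeff q' m = 0"
      using True Pm leading_coeff_neq_0[of "P m"] by (simp add: q'_def c_def)
    then have "q' = 0 \<or> degree q' < m"
      using le by (metis le_neq_implies_less leading_coeff_0_iff)
    then have "J (p * q') = 0"
      using Suc by auto
    moreover have "p * q = p * q' + smult c (p * P m)"
      by (simp add: q'_def algebra_simps)
    ultimately show ?thesis
      using Pm by (simp add: J_add J_smult)
  next
    case False
    then show ?thesis
      using Suc by (metis Suc_leD less_Suc_eq J_0 mult_zero_right)
  qed
qed

private definition orth :: "nat \<Rightarrow> real poly \<Rightarrow> bool" where
  "orth n p \<longleftrightarrow> degree p = n \<and> p \<noteq> 0 \<and> (\<forall>q. degree q < n \<longrightarrow> J (p * q) = 0)"

private lemma ex_orth: "\<exists>p. orth n p"
proof (induction n rule: less_induct)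
  case (less n)
  then obtain P where P: "\<And>k. k < n \<Longrightarrow> orth k (P k)"
    by metis
  define p where "p = monom 1 n -
    (\<Sum>k<n. smult (J (monom 1 n * P k) / J (P k * P k)) (P k))"
  have pos: "J (P k * P k) > 0" if "k < n" for k
    by (rule J_pos) (use P[OF that] in \<open>auto simp: orth_def\<close>)
  have orthP: "J (P i * P k) = 0" if "i < n" "k < n" "i \<noteq> k" for i k
    using that P[of i] P[of k] unfolding orth_def
    by (metis linorder_neqE_nat mult.commute)
  have *: "J (p * P k) = 0" if k: "k < n" for k
  proof -
    have "J (p * P k) = J (monom 1 n * P k) -
        (\<Sum>i<n. J (monom 1 n * P i) / J (P i * P i) * J (P i * P k))"
      by (simp add: p_def left_diff_distrib J_diff sum_distrib_right J_sum J_smult)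
    also have "(\<Sum>i<n. J (monom 1 n * P i) / J (P i * P i) * J (P i * P k)) =
        (\<Sum>i<n. if i = k then J (monom 1 n * P k) else 0)"
      by (rule sum.cong) (use k orthP pos in \<open>auto simp: less_imp_neq[symmetric]\<close>)
    finally show ?thesis using k by simp
  qed
  have cn: "coeff p n = 1"
  proof -
    have "coeff (P k) n = 0" if "k < n" for k
      using P[OF that] that by (auto simp: orth_def intro: coeff_eq_0)
    then show ?thesis by (simp add: p_def coeff_sum)
  qed
  have "degree p \<le> n"
    unfolding p_def
  proof (rule degree_diff_le)
    show "degree (monom (1::real) n) \<le> n"
      by (rule degree_monom_le)
    show "degree (\<Sum>k<n. smult (J (monom 1 n * P k) / J (P k * P k)) (P k)) \<le> n"
    proof (rule degree_sum_le)
      fix k assume "k \<in> {..<n}"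
      then show "degree (smult (J (monom 1 n * P k) / J (P k * P k)) (P k)) \<le> n"
        using P[of k] degree_smult_le[of _ "P k"] by (fastforce simp: orth_def)
    qed auto
  qed
  then have "degree p = n"
    using cn le_degree[of p n] by (simp add: le_antisym)
  moreover have "J (p * q) = 0" if "degree q < n" for q
    by (rule orth_span[of n P p n q]) (use * P that in \<open>auto simp: orth_def\<close>)
  ultimately show ?case
    using cn by (auto simp: orth_def)
qed

private lemma orth_poly_1_neq_0:
  assumes "orth n p"
  shows "poly p 1 \<noteq> 0"
proof
  assume "poly p 1 = 0"
  then obtain q where q: "p = [:-1, 1:] * q"
    by (auto simp: poly_eq_0_iff_dvd)
  from assms have "p \<noteq> 0" "degree p = n" by (auto simp: orth_def)
  then have "q \<noteq> 0" using q by auto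
  then have "degree p = Suc (degree q)"
    unfolding q by (subst degree_mult_eq) auto
  then have "J (p * q) = 0"
    using assms by (auto simp: orth_def)
  moreover have "J ([:1, -1:] * (q * q)) > 0"
  proof (rule J_pos)
    fix t :: real assume "t \<in> {-1<..<1}"
    moreover have "poly ([:1, -1:] * (q * q)) t = (1 - t) * (poly q t)\<^sup>2"
      by (simp add: power2_eq_square algebra_simps)
    ultimately show "poly ([:1, -1:] * (q * q)) t \<ge> 0"
      by simp
  next
    show "[:1, -1:] * (q * q) \<noteq> 0"
      using \<open>q \<noteq> 0\<close> by (metis mult_eq_0_iff pCons_eq_0_iff zero_neq_one)
  qed
  moreover have "p * q = smult (-1) ([:1, -1:] * (q * q))"
    by (simp add: q algebra_simps)
  then have "J (p * q) = - 1 * J ([:1, -1:] * (q * q))"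
    by (simp only: J_smult)
  ultimately show False
    by linarith
qed

private lemma orth_unique:
  assumes p: "orth n p" and p': "orth n p'"
  shows "\<exists>c. p = smult c p'"
proof -
  define c where "c = lead_coeff p / lead_coeff p'"
  define e where "e = p - smult c p'"
  have le: "degree e \<le> n"
    unfolding e_def using p p'
    by (intro degree_diff_le degree_smult_le[THEN order_trans]) (auto simp: orth_def)
  have "coeff e n = 0"
    using p p' leading_coeff_neq_0[of p'] by (auto simp: e_def c_def orth_def)
  then have "e = 0 \<or> degree e < n"
    using le by (metis le_neq_implies_less leading_coeff_0_iff)
  moreover have False if e: "degree e < n" "e \<noteq> 0"
  proof -
    have "J (p * e) = 0" "J (p' * e) = 0"
      using e p p' by (auto simp: orth_def)
    moreover have "e * e = p * e - smult c (p' * e)"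
      unfolding e_def by (simp add: left_diff_distrib)
    ultimately have "J (e * e) = 0"
      by (simp add: J_diff J_smult)
    moreover have "J (e * e) > 0"
      by (rule J_pos) (use e in auto)
    ultimately show False by simp
  qed
  ultimately have "e = 0" by blast
  then show ?thesis by (auto simp: e_def)
qed

private lemma gbinomial_pos: "(real n + \<alpha>) gchoose n > 0"
  using ab(1) by (simp add: gbinomial_pochhammer' pochhammer_pos)

private lemma is_jacobi_poly_iff:
  "is_jacobi_poly \<alpha> \<beta> n p \<longleftrightarrow> orth n p \<and> poly p 1 = (real n + \<alpha>) gchoose n"
  using gbinomial_pos[of n] unfolding is_jacobi_poly_def orth_def orth_eq by auto

lemma ex1_is_jacobi_poly: "\<exists>!p. is_jacobi_poly \<alpha> \<beta> n p"
proof (rule ex_ex1I)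
  obtain p where p: "orth n p"
    using ex_orth by blast
  define c where "c = ((real n + \<alpha>) gchoose n) / poly p 1"
  have "c \<noteq> 0"
    using gbinomial_pos[of n] orth_poly_1_neq_0[OF p] by (simp add: c_def)
  then have "orth n (smult c p)"
    using p by (auto simp: orth_def J_smult)
  moreover have "poly (smult c p) 1 = (real n + \<alpha>) gchoose n"
    using orth_poly_1_neq_0[OF p] by (simp add: c_def)
  ultimately show "\<exists>p. is_jacobi_poly \<alpha> \<beta> n p"
    unfolding is_jacobi_poly_iff by blast
next
  fix p p' assume *: "is_jacobi_poly \<alpha> \<beta> n p" "is_jacobi_poly \<alpha> \<beta> n p'"
  then obtain c where c: "p = smult c p'"
    using orth_unique unfolding is_jacobi_poly_iff by blast
  have "poly p 1 = poly p' 1" "poly p' 1 \<noteq> 0"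
    using * gbinomial_pos[of n] unfolding is_jacobi_poly_iff by auto
  with c have "c = 1" by simp
  with c show "p = p'" by simp
qed

lemma jacobi_poly_correct: "is_jacobi_poly \<alpha> \<beta> n (jacobi_poly \<alpha> \<beta> n)"
  unfolding jacobi_poly_def by (rule theI'[OF ex1_is_jacobi_poly])

private lemma even_orders_const_sign:
  fixes h :: "real poly"
  assumes "h \<noteq> 0" and "\<And>t. t \<in> {-1<..<1} \<Longrightarrow> even (order t h)"
  shows "(\<forall>t\<in>{-1<..<1}. poly h t \<ge> 0) \<or> (\<forall>t\<in>{-1<..<1}. poly h t \<le> 0)"
  using assms
proof (induction "degree h" arbitrary: h rule: less_induct)
  case less
  show ?case
  proof (cases "\<exists>t\<in>{-1<..<1}. poly h t = 0")
    case True
    then obtain t where t: "t \<in> {-1<..<1}" "poly h t = 0" by blast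
    then have "order t h \<noteq> 0" "even (order t h)"
      using less.prems order_root by auto
    then have "2 \<le> order t h" by presburger
    then have "[:-t, 1:] ^ 2 dvd h"
      using order_1[of t h] le_imp_power_dvd dvd_trans by blast
    then obtain k where k: "h = [:-t, 1:] ^ 2 * k" ..
    have "k \<noteq> 0" using k less.prems by auto
    have "degree h = degree ([:-t, 1:] ^ 2) + degree k"
      unfolding k by (rule degree_mult_eq) (use \<open>k \<noteq> 0\<close> in auto)
    then have "degree k < degree h"
      by (simp add: degree_linear_power)
    moreover have "even (order s k)" if "s \<in> {-1<..<1}" for s
    proof -
      have "order s h = order s ([:-t, 1:] ^ 2) + order s k"
        unfolding k by (rule order_mult) (use k less.prems in auto)
      also have "order s ([:-t, 1:] ^ 2) = 2 * order s [:-t, 1:]"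
        unfolding power2_eq_square by (subst order_mult) auto
      finally show ?thesis
        using less.prems(2)[OF that] by simp
    qed
    ultimately have "(\<forall>s\<in>{-1<..<1}. poly k s \<ge> 0) \<or> (\<forall>s\<in>{-1<..<1}. poly k s \<le> 0)"
      using less.hyps \<open>k \<noteq> 0\<close> by blast
    moreover have "poly h s = (s - t)\<^sup>2 * poly k s" for s
      by (simp add: k power2_eq_square algebra_simps)
    ultimately show ?thesis
      by (auto simp: zero_le_mult_iff mult_le_0_iff)
  next
    case False
    show ?thesis
    proof (rule ccontr)
      assume "\<not> ?thesis"
      then obtain s t where st: "s \<in> {-1<..<1}" "t \<in> {-1<..<1}" "poly h s < 0" "poly h t > 0"
        by (auto simp: not_le)
      have "connected (poly h ` {-1<..<1})"
        by (intro connected_continuous_image continuous_intros) auto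
      then have "0 \<in> poly h ` {-1<..<1}"
        using st unfolding connected_iff_interval by (meson imageI less_imp_le)
      then show False using False by auto
    qed
  qed
qed

private lemma orth_roots:
  assumes "orth n p"
  shows "card {t \<in> {-1<..<1}. poly p t = 0} \<ge> n"
proof (rule ccontr)
  assume less: "\<not> ?thesis"
  from assms have p: "p \<noteq> 0" "degree p = n" by (auto simp: orth_def)
  define R where "R = {t \<in> {-1<..<1}. odd (order t p)}"
  define q where "q = (\<Prod>t\<in>R. [:-t, 1:])"
  have fin: "finite {t \<in> {-1<..<1}. poly p t = 0}"
    using poly_roots_finite[OF p(1)] by (rule rev_finite_subset) auto
  have sub: "R \<subseteq> {t \<in> {-1<..<1}. poly p t = 0}"
    using p by (auto simp: R_def order_root intro: odd_pos)
  have finR: "finite R" using sub fin finite_subset by blast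
  have "q \<noteq> 0" using finR by (simp add: q_def)
  have "degree q = card R"
    unfolding q_def by (subst degree_prod_eq_sum_degree) auto
  also have "\<dots> < n"
    using less card_mono[OF fin sub] by linarith
  finally have J0: "J (p * q) = 0"
    using assms by (auto simp: orth_def)
  have "even (order t (p * q))" if t: "t \<in> {-1<..<1}" for t
  proof -
    have lin: "order t [:-s, 1:] = (if s = t then 1 else 0)" for s
      using order_power_n_n[of t 1] by (auto intro!: order_0I)
    have "order t (\<Prod>s\<in>A. [:-s, 1:]) = (if t \<in> A then 1 else 0)" if "finite A" for A
      using that
    proof (induction A rule: finite_induct)
      case (insert x A)
      then show ?case
        by (subst prod.insert) (auto simp: order_mult lin simp del: mult_pCons_left)
    qed auto
    then have "order t q = (if t \<in> R then 1 else 0)"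
      unfolding q_def using finR by blast
    moreover have "order t (p * q) = order t p + order t q"
      by (rule order_mult) (use p \<open>q \<noteq> 0\<close> in auto)
    ultimately show ?thesis using t by (auto simp: R_def)
  qed
  then consider "\<forall>t\<in>{-1<..<1}. poly (p * q) t \<ge> 0" | "\<forall>t\<in>{-1<..<1}. poly (p * q) t \<le> 0"
    using even_orders_const_sign[of "p * q"] p \<open>q \<noteq> 0\<close> by auto
  then show False
  proof cases
    case 1
    then have "J (p * q) > 0"
      by (intro J_pos) (use p \<open>q \<noteq> 0\<close> in auto)
    with J0 show False by simp
  next
    case 2
    then have "J (smult (-1) (p * q)) > 0"
      by (intro J_pos) (use p \<open>q \<noteq> 0\<close> in auto)
    with J0 J_smult[of "-1" "p * q"] show False by simp
  qed
qed

lemma jacobi_poly_roots: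
  "card {t. poly (jacobi_poly \<alpha> \<beta> n) t = 0} = n"
  "{t. poly (jacobi_poly \<alpha> \<beta> n) t = 0} \<subseteq> {-1<..<1}"
proof -
  let ?p = "jacobi_poly \<alpha> \<beta> n"
  have p: "orth n ?p"
    using jacobi_poly_correct[of n] unfolding is_jacobi_poly_iff by blast
  then have p': "?p \<noteq> 0" "degree ?p = n" by (auto simp: orth_def)
  let ?A = "{t \<in> {-1<..<1}. poly ?p t = 0}" and ?B = "{t. poly ?p t = 0}"
  have fin: "finite ?B" using poly_roots_finite[OF p'(1)] .
  have "card ?B \<le> n" using card_poly_roots_bound[OF p'(1)] p' by simp
  moreover have "n \<le> card ?A" by (rule orth_roots[OF p])
  moreover have sub: "?A \<subseteq> ?B" by auto
  moreover have "card ?A \<le> card ?B" by (rule card_mono[OF fin sub])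
  ultimately have cards: "card ?A = card ?B" "card ?B = n"
    by linarith+
  show "card ?B = n" by fact
  show "?B \<subseteq> {-1<..<1}"
    using card_subset_eq[OF fin sub cards(1)] by blast
qed

lemma jacobi_nodes_eq:
  "jacobi_nodes \<alpha> \<beta> n = insert (-1) {t. poly (jacobi_poly \<alpha> \<beta> n) t = 0}"
proof -
  have "poly ([:1, 1:] * q) t = (1 + t) * poly q t" for q and t :: real
    by (simp add: algebra_simps)
  then show ?thesis
    by (auto simp: jacobi_nodes_def simp del: mult_pCons_left)
qed

lemma jacobi_nodes_subset: "jacobi_nodes \<alpha> \<beta> n \<subseteq> {-1..<1}"
  using jacobi_poly_roots(2)[of n] by (auto simp: jacobi_nodes_eq)

lemma finite_jacobi_nodes: "finite (jacobi_nodes \<alpha> \<beta> n)"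
proof -
  have "jacobi_poly \<alpha> \<beta> n \<noteq> 0"
    using jacobi_poly_correct[of n] unfolding is_jacobi_poly_iff orth_def by blast
  then show ?thesis
    by (simp add: jacobi_nodes_eq poly_roots_finite)
qed

lemma card_jacobi_nodes: "card (jacobi_nodes \<alpha> \<beta> n) = n + 1"
proof -
  have "-1 \<notin> {t. poly (jacobi_poly \<alpha> \<beta> n) t = 0}"
    using jacobi_poly_roots(2)[of n] by force
  then show ?thesis
    using jacobi_poly_roots(1)[of n] finite_jacobi_nodes[of n]
    unfolding jacobi_nodes_eq by (subst card_insert_disjoint) auto
qed

end

lemma ex1_interpolating_poly:
  fixes f :: "real \<Rightarrow> real"
  assumes "finite X" and "card X = n + 1"
  shows "\<exists>!p. degree p \<le> n \<and> (\<forall>t\<in>X. poly p t = f t)"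
proof (rule ex_ex1I)
  have "\<exists>p. (p = 0 \<or> degree p < card X) \<and> (\<forall>t\<in>X. poly p t = f t)"
    using assms(1)
  proof (induction X rule: finite_induct)
    case (insert x X)
    then obtain p where p: "p = 0 \<or> degree p < card X" "\<forall>t\<in>X. poly p t = f t"
      by blast
    define w where "w = (\<Prod>s\<in>X. [:-s, 1:])"
    have w: "poly w x \<noteq> 0" "\<forall>t\<in>X. poly w t = 0"
      using insert.hyps by (auto simp: w_def poly_prod)
    have dw: "degree w = card X"
      unfolding w_def by (subst degree_prod_eq_sum_degree) auto
    define q where "q = p + smult ((f x - poly p x) / poly w x) w"
    have "degree q \<le> card X"
      unfolding q_def using p dw
      by (intro degree_add_le degree_smult_le[THEN order_trans]) auto
    moreover have "\<forall>t\<in>insert x X. poly q t = f t"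
      using w p by (auto simp: q_def)
    ultimately show ?case
      using insert.hyps by (intro exI[of _ q]) auto
  qed auto
  then obtain p where "p = 0 \<or> degree p < card X" "\<forall>t\<in>X. poly p t = f t"
    by blast
  then show "\<exists>p. degree p \<le> n \<and> (\<forall>t\<in>X. poly p t = f t)"
    using assms(2) by (intro exI[of _ p]) auto
next
  fix p q assume *: "degree p \<le> n \<and> (\<forall>t\<in>X. poly p t = f t)" "degree q \<le> n \<and> (\<forall>t\<in>X. poly q t = f t)"
  show "p = q"
  proof (rule ccontr)
    assume "p \<noteq> q"
    then have "p - q \<noteq> 0" by simp
    have "card X \<le> card {t. poly (p - q) t = 0}"
      using * poly_roots_finite[OF \<open>p - q \<noteq> 0\<close>] by (intro card_mono) auto
    also have "\<dots> \<le> degree (p - q)"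
      by (rule card_poly_roots_bound) fact
    also have "\<dots> \<le> n"
      using * by (intro degree_diff_le) auto
    finally show False using assms by simp
  qed
qed

lemma ex1_jacobi_interpolant:
  assumes "\<alpha> > -1" "\<beta> > -1"
  shows "\<exists>!p. degree p \<le> n \<and> (\<forall>t \<in> jacobi_nodes \<alpha> \<beta> n. poly p t = f t)"
  by (rule ex1_interpolating_poly[OF finite_jacobi_nodes[OF assms] card_jacobi_nodes[OF assms]])

end

theory Submission
  imports Defs
begin

text \<open>
  Fix \<open>t\<close> and let \<open>Z\<close> consist of \<open>t\<close> and the \<open>n + 1\<close> nodes. The error at \<open>t\<close> is the node polynomial
  times the divided difference of \<open>f\<close> over \<open>Z\<close>, and since \<open>g\<close> has bounded variation, \<open>f\<close> is
  up to a polynomial a limit of combinations of truncated powers with bounded total weight, so only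
  the kernels \<open>y \<mapsto> divdiff Z (\<lambda>z. (z - y)\<^sub>+ ^ k)\<close> matter. The kernel for \<open>k = 0\<close> is a step
  function that changes sign at every interior node \<open>z\<close>, hence is bounded by
  \<open>1 / \<bar>node_weight Z z\<bar>\<close> next to \<open>z\<close>. Rolle's theorem, applied from the top kernel downwards
  and from each kernel to the step function, shows that the \<open>k\<close>-th kernel vanishes in every
  interval with more than \<open>k\<close> interior nodes; integrating \<open>r\<close> times gains a factor of the local
  node spacing each time. This avoids the logarithm of a Lebesgue constant.

  It remains to bound single Lagrange basis polynomials. In the variable \<open>\<theta> = arccos x\<close> the
  Jacobi equation has an energy whose weighted value is constant up to a bounded factor for \<open>\<theta>\<close>
  in \<open>[c / n, pi - c / n]\<close>, and near the end points the polynomial is comparable to its end point value.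
  The quotients in the Lagrange polynomials then reduce to an elementary trigonometric inequality.
\<close>

section \<open>Divided differences and their truncated power kernels\<close>

text \<open>The obstacle is that \<open>t\<close> may lie arbitrarily close to a node: distances in
  \<open>Z\<close> have no lower bound, so only arguments by order and by counting are available for
  the kernels. Multiplication by the node polynomial \<omega> repairs this, because \<omega> /
  \<open>node_weight Z z\<close> is 1 for \<open>z = t\<close> and otherwise, up to sign, the
  Lagrange basis polynomial of the node \<open>z\<close> evaluated at \<open>t\<close>. A basis
  polynomial at the node cos u is at most a constant times s^(-e) / sin u, where s^2 = n (n +
  \<alpha> + \<beta> + 1) and e is \<open>jacobi_exponent \<alpha> \<beta>\<close>. A window of
  angular length of order 1 / s around u has width at most of order sin u / s in x, so one of the r
  window widths cancels the factor 1 / sin u and leaves 1 / s; the other r - 1 widths are each at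
  most a constant times 1 / s. The exponent e arises where the weights at two angles are
  compared.\<close>

definition node_weight :: "real set \<Rightarrow> real \<Rightarrow> real" where
  "node_weight Z z = (\<Prod>u\<in>Z - {z}. z - u)"

definition divdiff :: "real set \<Rightarrow> (real \<Rightarrow> real) \<Rightarrow> real" where
  "divdiff Z h = (\<Sum>z\<in>Z. h z / node_weight Z z)"

lemma node_weight_nonzero: "finite Z \<Longrightarrow> node_weight Z z \<noteq> 0"
  by (auto simp: node_weight_def)

text \<open>By uniqueness of interpolation p equals its own Lagrange form, and each Lagrange factor
  is monic of degree \<open>card Z - 1\<close>; comparing coefficients in that degree gives the
  formula.\<close>

lemma divdiff_poly:
  assumes "finite Z" and "degree p < card Z"
  shows "divdiff Z (poly p) = coeff p (card Z - 1)"
proof -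
  define l where "l = (\<lambda>z. \<Prod>u\<in>Z - {z}. [:-u, 1:])"
  define L where "L = (\<Sum>z\<in>Z. smult (poly p z / node_weight Z z) (l z))"
  have dl: "degree (l z) = card Z - 1" if "z \<in> Z" for z
    unfolding l_def using that assms by (subst degree_prod_eq_sum_degree) auto
  have cl: "coeff (l z) (card Z - 1) = 1" if "z \<in> Z" for z
  proof -
    have "lead_coeff (l z) = 1"
      unfolding l_def by (simp add: lead_coeff_prod)
    then show ?thesis using dl[OF that] by simp
  qed
  have pl: "poly (l z) x = (if x = z then node_weight Z z else 0)" if "z \<in> Z" "x \<in> Z" for z x
    using that assms by (auto simp: l_def node_weight_def poly_prod)
  have "degree L \<le> card Z - 1"
    unfolding L_def using dl assms by (intro degree_sum_le order.trans[OF degree_smult_le]) auto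
  moreover have "poly L x = poly p x" if "x \<in> Z" for x
  proof -
    have "poly L x = (\<Sum>z\<in>Z. poly p z / node_weight Z z * (if x = z then node_weight Z z else 0))"
      unfolding L_def poly_sum poly_smult using pl that by (intro sum.cong) auto
    also have "\<dots> = (\<Sum>z\<in>Z. if x = z then poly p z else 0)"
      using node_weight_nonzero[OF assms(1)] by (intro sum.cong) auto
    also have "\<dots> = poly p x" using assms that by simp
    finally show ?thesis .
  qed
  moreover have "card Z = (card Z - 1) + 1" using assms by simp
  moreover have "degree p \<le> card Z - 1" using assms by simp
  ultimately have "L = p"
    using ex1_interpolating_poly[OF assms(1), of "card Z - 1" "poly p"] by blast
  then have "coeff p (card Z - 1) = coeff L (card Z - 1)" by simp
  also have "\<dots> = divdiff Z (poly p)"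
    unfolding L_def divdiff_def coeff_sum using cl by (intro sum.cong) auto
  finally show ?thesis by simp
qed

lemma divdiff_poly_eq_0:
  assumes "finite Z" and "degree p + 1 < card Z"
  shows "divdiff Z (poly p) = 0"
  using assms by (subst divdiff_poly) (auto intro: coeff_eq_0)

text \<open>The divided difference over n + 2 points is the coefficient of degree n + 1 of the
  interpolant, so its vanishing saves one degree. The critical point count in
  \<open>tker_0_sign_change\<close> depends on this one degree.\<close>

lemma divdiff_eq_0_interpolant:
  assumes "finite Z" and "divdiff Z h = 0" and "card Z = n + 2"
  obtains p where "degree p \<le> n" and "\<And>z. z \<in> Z \<Longrightarrow> poly p z = h z"
proof -
  from ex1_interpolating_poly[OF assms(1), of "n + 1" h] assms(3)
  obtain p where p: "degree p \<le> n + 1" "\<forall>z\<in>Z. poly p z = h z" by auto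
  have "divdiff Z (poly p) = divdiff Z h"
    unfolding divdiff_def using p by (intro sum.cong) auto
  then have "coeff p (n + 1) = 0"
    using divdiff_poly[OF assms(1), of p] p assms by simp
  then have "degree p \<noteq> n + 1"
    by (metis Suc_eq_plus1 degree_0 leading_coeff_0_iff nat.distinct(1))
  with p have "degree p \<le> n" by simp
  with p that show ?thesis by blast
qed

lemma divdiff_add: "divdiff Z (\<lambda>x. h x + k x) = divdiff Z h + divdiff Z k"
  by (simp add: divdiff_def add_divide_distrib sum.distrib)

lemma divdiff_diff: "divdiff Z (\<lambda>x. h x - k x) = divdiff Z h - divdiff Z k"
  by (simp add: divdiff_def diff_divide_distrib sum_subtractf)

lemma divdiff_cmult: "divdiff Z (\<lambda>x. c * h x) = c * divdiff Z h"
  by (simp add: divdiff_def sum_distrib_left)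

lemma divdiff_sum: "divdiff Z (\<lambda>x. \<Sum>i\<in>I. h i x) = (\<Sum>i\<in>I. divdiff Z (h i))"
  unfolding divdiff_def sum_divide_distrib by (rule sum.swap)

text \<open>Subtracting p does not change the divided difference over the enlarged set, whose order
  exceeds the degree of p, but it annihilates every term except the one at t.\<close>

lemma interpolation_error_divdiff:
  assumes "finite X" "t \<notin> X" "degree p + 1 \<le> card X" "\<And>x. x \<in> X \<Longrightarrow> poly p x = f x"
  shows "f t - poly p t = (\<Prod>x\<in>X. t - x) * divdiff (insert t X) f"
proof -
  let ?Z = "insert t X"
  have "divdiff ?Z f = divdiff ?Z (\<lambda>x. f x - poly p x)"
    using divdiff_poly_eq_0[of ?Z p] assms by (simp add: divdiff_diff)
  also have "\<dots> = (f t - poly p t) / node_weight ?Z t + (\<Sum>z\<in>X. (f z - poly p z) / node_weight ?Z z)"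
    unfolding divdiff_def using assms by simp
  also have "(\<Sum>z\<in>X. (f z - poly p z) / node_weight ?Z z) = 0"
    using assms by (intro sum.neutral) auto
  finally have "divdiff ?Z f = (f t - poly p t) / node_weight ?Z t" by simp
  moreover have "node_weight ?Z t = (\<Prod>x\<in>X. t - x)"
    using assms by (auto simp: node_weight_def intro!: prod.cong)
  moreover have "(\<Prod>x\<in>X. t - x) \<noteq> 0" using assms by auto
  ultimately show ?thesis by (simp add: field_simps)
qed

text \<open>The combinatorial half of Rolle's theorem, with N either a set of zeros or the node set.
  The strict location between the extreme points keeps later counts inside the same
  interval.\<close>

lemma separating_points:
  fixes V :: "real set"
  assumes "finite V" "V \<noteq> {}" "\<And>u v. u \<in> V \<Longrightarrow> v \<in> V \<Longrightarrow> u < v \<Longrightarrow> \<exists>x\<in>N. u < x \<and> x < v"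
  shows "\<exists>M\<subseteq>N. finite M \<and> card M = card V - 1 \<and> M \<subseteq> {Min V<..<Max V}"
  using assms
proof (induction V rule: finite_linorder_max_induct)
  case (insert b A)
  show ?case
  proof (cases "A = {}")
    case False
    from insert obtain M where M: "M \<subseteq> N" "finite M" "card M = card A - 1" "M \<subseteq> {Min A<..<Max A}"
      using False by blast
    have mA: "Max A \<in> A" "Max A < b" using insert False by auto
    then obtain x where x: "x \<in> N" "Max A < x" "x < b"
      using insert.prems(2)[of "Max A" b] by auto
    have "Min A \<le> Max A" using insert False by auto
    have e: "Max (insert b A) = b" "Min (insert b A) = Min A"
      using insert.hyps False mA \<open>Min A \<le> Max A\<close> by (auto simp: Max_insert Min_insert)
    have "x \<notin> M" using M x by fastforce
    have "card A > 0" "b \<notin> A" using insert.hyps False by (auto simp: card_gt_0_iff)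
    then have "card (insert x M) = card (insert b A) - 1"
      using M(2,3) \<open>x \<notin> M\<close> insert.hyps(1) by simp
    moreover have "insert x M \<subseteq> {Min (insert b A)<..<Max (insert b A)}"
      unfolding e using M x mA \<open>Min A \<le> Max A\<close> by fastforce
    ultimately show ?thesis using M x by (intro exI[of _ "insert x M"]) auto
  qed auto
qed simp

section \<open>Truncated power kernels and their zeros\<close>

definition tpow :: "nat \<Rightarrow> real \<Rightarrow> real" where
  "tpow k x = (if x > 0 then x ^ k else 0)"

text \<open>For \<open>k = card Z - 2\<close> this is a B-spline up to a factor, and lower k give
  its derivatives up to factors. Since \<open>tpow 0 0 = 0\<close>, the kernel for k = 0 is
  continuous from the right at the nodes: its value just to the left of a node z exceeds the one at
  z by \<open>1 / node_weight Z z\<close>.\<close>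

definition tker :: "real set \<Rightarrow> nat \<Rightarrow> real \<Rightarrow> real" where
  "tker Z k y = divdiff Z (\<lambda>z. tpow k (z - y))"

text \<open>At 0 the difference quotient is bounded by |h|^k, which tends to 0 only for k \<ge> 1.
  The passage from kernel 1 to the step function therefore needs arguments of its own.\<close>

lemma tpow_has_derivative:
  assumes "k \<ge> 1"
  shows "(tpow (Suc k) has_real_derivative (real (Suc k) * tpow k x)) (at x)"
proof (cases "x = 0")
  case True
  have "((\<lambda>h. tpow (Suc k) h / h) \<longlongrightarrow> 0) (at 0)"
  proof (rule Lim_null_comparison)
    show "\<forall>\<^sub>F h in at 0. norm (tpow (Suc k) h / h) \<le> \<bar>h\<bar> ^ k"
      unfolding eventually_at by (intro exI[of _ 1]) (auto simp: tpow_def)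
    have "((\<lambda>h::real. \<bar>h\<bar> ^ k) \<longlongrightarrow> \<bar>0\<bar> ^ k) (at 0)"
      by (intro tendsto_intros)
    then show "((\<lambda>h::real. \<bar>h\<bar> ^ k) \<longlongrightarrow> 0) (at 0)" using assms by (simp add: power_0_left)
  qed
  then show ?thesis using True by (simp add: DERIV_def tpow_def)
next
  case False
  show ?thesis
  proof (cases "x > 0")
    case True
    have "((\<lambda>x. x ^ Suc k) has_real_derivative real (Suc k) * x ^ k) (at x)"
      using DERIV_pow[of "Suc k" x] by simp
    then have "(tpow (Suc k) has_real_derivative real (Suc k) * x ^ k) (at x)"
      by (rule has_field_derivative_transform_within_open[where S = "{0<..}"])
         (use True in \<open>auto simp: tpow_def\<close>)
    then show ?thesis using True by (simp add: tpow_def)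
  next
    case False
    with \<open>x \<noteq> 0\<close> have "x < 0" by simp
    have "((\<lambda>x. 0) has_real_derivative 0) (at x)" by simp
    then have "(tpow (Suc k) has_real_derivative 0) (at x)"
      by (rule has_field_derivative_transform_within_open[where S = "{..<0}"])
         (use \<open>x < 0\<close> in \<open>auto simp: tpow_def\<close>)
    then show ?thesis using False by (simp add: tpow_def)
  qed
qed

lemma tker_has_derivative:
  assumes "k \<ge> 1"
  shows "(tker Z (Suc k) has_real_derivative - real (Suc k) * tker Z k y) (at y)"
proof -
  have 1: "((\<lambda>y. tpow (Suc k) (z - y) / node_weight Z z) has_real_derivative
        - real (Suc k) * (tpow k (z - y) / node_weight Z z)) (at y)" for z
  proof -
    have "((\<lambda>y. tpow (Suc k) (z - y)) has_real_derivative (real (Suc k) * tpow k (z - y)) * (-1)) (at y)"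
      by (rule DERIV_chain2[OF tpow_has_derivative[OF assms]]) (auto intro!: derivative_eq_intros)
    from DERIV_cdivide[OF this, of "node_weight Z z"] show ?thesis by (simp add: field_simps)
  qed
  have "((\<lambda>y. \<Sum>z\<in>Z. tpow (Suc k) (z - y) / node_weight Z z) has_real_derivative
        (\<Sum>z\<in>Z. - real (Suc k) * (tpow k (z - y) / node_weight Z z))) (at y)"
    by (rule DERIV_sum) (rule 1)
  then show ?thesis
    unfolding tker_def divdiff_def sum_distrib_left .
qed

lemma tker_continuous:
  assumes "finite Z" "k \<ge> 1"
  shows "continuous_on A (tker Z k)"
proof -
  have "tpow k = (\<lambda>x. (max 0 x) ^ k)"
    using assms by (auto simp: tpow_def fun_eq_iff max_def)
  then show ?thesis
    unfolding tker_def divdiff_def using node_weight_nonzero[OF assms(1)] by (auto intro!: continuous_intros)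
qed

lemma tker_Max:
  assumes "finite Z" "y \<ge> Max Z"
  shows "tker Z k y = 0"
proof -
  have "tpow k (z - y) = 0" if "z \<in> Z" for z
  proof -
    have "z \<le> y" using assms that by (meson Max_ge order_trans)
    then show ?thesis by (simp add: tpow_def)
  qed
  then show ?thesis unfolding tker_def divdiff_def by simp
qed

text \<open>No truncation takes place at the smallest node, so the kernel is there the divided
  difference of a polynomial of degree k, which is too low. For z = \<open>Min Z\<close> itself the
  agreement of \<open>tpow k 0\<close> with 0^k uses k \<ge> 1.\<close>

lemma tker_Min:
  assumes "finite Z" "1 \<le> k" "k + 2 \<le> card Z"
  shows "tker Z k (Min Z) = 0"
proof -
  have "tker Z k (Min Z) = divdiff Z (poly ([:- Min Z, 1:] ^ k))"
    unfolding tker_def divdiff_def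
  proof (intro sum.cong refl)
    fix z assume "z \<in> Z"
    then have "Min Z \<le> z" using assms by auto
    then show "tpow k (z - Min Z) / node_weight Z z = poly ([:- Min Z, 1:] ^ k) z / node_weight Z z"
      using assms by (auto simp: tpow_def)
  qed
  also have "\<dots> = 0"
    using assms by (intro divdiff_poly_eq_0) (auto simp: degree_linear_power)
  finally show ?thesis .
qed

lemma tker_Rolle:
  assumes "finite Z" "k \<ge> 1" "u < v" "tker Z (Suc k) u = 0" "tker Z (Suc k) v = 0"
  shows "\<exists>x\<in>{x. tker Z k x = 0}. u < x \<and> x < v"
proof -
  have "\<exists>z. u < z \<and> z < v \<and> DERIV (tker Z (Suc k)) z :> 0"
    by (rule Rolle) (use assms tker_has_derivative[OF assms(2)] in
      \<open>auto intro: tker_continuous simp: real_differentiable_def\<close>)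
  then obtain z where z: "u < z" "z < v" "DERIV (tker Z (Suc k)) z :> 0" by blast
  from DERIV_unique[OF z(3) tker_has_derivative[OF assms(2)]]
  have "real (Suc k) * tker Z k z = 0" by simp
  then have "tker Z k z = 0" by (simp only: mult_eq_0_iff of_nat_eq_0_iff nat.distinct) simp
  with z show ?thesis by auto
qed

text \<open>Downward induction from k = n, where nothing is claimed: in each step the two extreme
  nodes join as zeros and Rolle's theorem loses one, a net gain of one interior zero.\<close>

lemma tker_many_zeros:
  assumes "finite Z" "card Z = n + 2" "1 \<le> k" "k \<le> n"
  shows "\<exists>U\<subseteq>{x. tker Z k x = 0}. finite U \<and> card U = n - k \<and> U \<subseteq> {Min Z<..<Max Z}"
  using assms(4,3)
proof (induction k rule: inc_induct)
  case base
  show ?case by (intro exI[of _ "{}"]) auto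
next
  case (step k)
  then obtain U where U: "U \<subseteq> {x. tker Z (Suc k) x = 0}" "finite U" "card U = n - Suc k"
      "U \<subseteq> {Min Z<..<Max Z}" by auto
  define V where "V = insert (Min Z) (insert (Max Z) U)"
  have "Min Z < Max Z"
  proof (rule ccontr)
    assume "\<not> Min Z < Max Z"
    then have "Z \<subseteq> {Min Z}" using assms(1) by (auto simp: not_less intro: antisym Min_le order_trans[OF Max_ge])
    from card_mono[OF _ this] assms show False by simp
  qed
  have fV: "finite V" "V \<noteq> {}" using U by (auto simp: V_def)
  have cV: "card V = n - k + 1"
    unfolding V_def using U \<open>Min Z < Max Z\<close> step by (subst card_insert_disjoint) (auto simp: card_insert_if)
  have sV: "Min V = Min Z" "Max V = Max Z"
    using fV U \<open>Min Z < Max Z\<close> unfolding V_def by (auto intro!: Min_eqI Max_eqI simp del: Min_insert Max_insert)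
  have zV: "tker Z (Suc k) x = 0" if "x \<in> V" for x
    using that U tker_Max[OF assms(1), of "Max Z"] tker_Min[OF assms(1), of "Suc k"] assms step
    by (auto simp: V_def)
  have "\<exists>M\<subseteq>{x. tker Z k x = 0}. finite M \<and> card M = card V - 1 \<and> M \<subseteq> {Min V<..<Max V}"
    by (rule separating_points[OF fV]) (rule tker_Rolle[OF assms(1) step.prems], auto intro: zV)
  then show ?case using cV sV by auto
qed


section \<open>The step function kernel, and nodes between zeros of the kernels\<close>

lemma tker_0: "tker Z 0 y = (\<Sum>z\<in>{z\<in>Z. z > y}. 1 / node_weight Z z)" if "finite Z"
  unfolding tker_def divdiff_def tpow_def using that
  by (subst sum.inter_filter) (auto intro!: sum.cong)

text \<open>The two factors are the divided differences of the indicators of z > z0 and z \<ge> z0.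
  If they did not have strictly opposite signs, a nonnegative combination would produce data 0, -b,
  a - b (left of, at and right of z0) interpolated by a polynomial of degree at most n. Rolle's
  theorem on both sides and a local minimum around z0 give n critical points, one too many unless
  the polynomial is constant, which forces a = b = 0.\<close>

lemma tker_0_sign_change:
  assumes Z: "finite Z" "card Z = n + 2" "z0 \<in> Z" "Min Z < z0" "z0 < Max Z"
  shows "tker Z 0 z0 * (tker Z 0 z0 + 1 / node_weight Z z0) < 0"
proof (rule ccontr)
  let ?S = "tker Z 0 z0" and ?T = "tker Z 0 z0 + 1 / node_weight Z z0"
  assume "\<not> ?S * ?T < 0"
  then have nonneg: "?S * ?T \<ge> 0" by simp
  obtain a b where ab: "a \<ge> 0" "b \<ge> 0" "a \<noteq> 0 \<or> b \<noteq> 0" "a * ?S = b * ?T"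
  proof (cases "?S = 0 \<and> ?T = 0")
    case True
    then show ?thesis using that[of 1 0] by simp
  next
    case False
    have "\<bar>t\<bar> * s = \<bar>s\<bar> * t" if "s * t \<ge> 0" for s t :: real
      using that by (auto simp: abs_if zero_le_mult_iff)
    from this[OF nonneg] have "\<bar>?T\<bar> * ?S = \<bar>?S\<bar> * ?T" .
    moreover have "\<bar>?T\<bar> \<noteq> 0 \<or> \<bar>?S\<bar> \<noteq> 0" using False by linarith
    ultimately show ?thesis using that[of "\<bar>?T\<bar>" "\<bar>?S\<bar>"] by (metis abs_ge_zero)
  qed
  \<comment> \<open>The signs of a and b make the value -b at z0 at most both neighbouring values 0
    and a - b; the interior minimum below comes from this.\<close>
  define h where "h = (\<lambda>z. a * tpow 0 (z - z0) - b * (if z \<ge> z0 then 1 else 0))"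
  have "divdiff Z (\<lambda>z. if z \<ge> z0 then 1 else 0) =
        (\<Sum>z\<in>Z. tpow 0 (z - z0) / node_weight Z z + (if z = z0 then 1 / node_weight Z z else 0))"
    unfolding divdiff_def by (intro sum.cong) (auto simp: tpow_def)
  also have "\<dots> = ?T"
    using Z by (simp add: sum.distrib tker_def divdiff_def)
  finally have "divdiff Z h = a * ?S - b * ?T"
    unfolding h_def divdiff_diff divdiff_cmult by (simp add: tker_def)
  then have "divdiff Z h = 0" using ab by simp
  from divdiff_eq_0_interpolant[OF Z(1) this Z(2)] obtain p
    where p: "degree p \<le> n" "\<And>z. z \<in> Z \<Longrightarrow> poly p z = h z" by blast
  define A where "A = {z\<in>Z. z < z0}"
  define B where "B = {z\<in>Z. z > z0}"
  have "Min Z \<in> Z" "Max Z \<in> Z" using Z by (auto intro!: Min_in Max_in)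
  then have AB: "finite A" "finite B" "A \<noteq> {}" "B \<noteq> {}" using Z by (auto simp: A_def B_def)
  have hA: "poly p z = 0" if "z \<in> A" for z using that p(2)[of z] by (auto simp: A_def h_def tpow_def)
  have hB: "poly p z = a - b" if "z \<in> B" for z using that p(2)[of z] by (auto simp: B_def h_def tpow_def)
  have h0: "poly p z0 = - b" using p(2)[of z0] Z by (auto simp: h_def tpow_def)
  let ?R = "{x. poly (pderiv p) x = 0}"
  have Rolle': "\<exists>x\<in>?R. u < x \<and> x < v" if "u < v" "poly p u = poly p v" for u v
  proof -
    have "\<exists>z. u < z \<and> z < v \<and> DERIV (poly p) z :> 0"
      by (rule Rolle) (use that in \<open>auto intro!: continuous_intros simp: real_differentiable_def intro: poly_DERIV\<close>)
    then obtain z where "u < z" "z < v" "DERIV (poly p) z :> 0" by blast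
    with DERIV_unique[OF this(3) poly_DERIV] show ?thesis by auto
  qed
  obtain M1 where M1: "M1 \<subseteq> ?R" "finite M1" "card M1 = card A - 1" "M1 \<subseteq> {Min A<..<Max A}"
    using separating_points[of A ?R] AB Rolle' hA by (metis (no_types, lifting))
  obtain M2 where M2: "M2 \<subseteq> ?R" "finite M2" "card M2 = card B - 1" "M2 \<subseteq> {Min B<..<Max B}"
    using separating_points[of B ?R] AB Rolle' hB by (metis (no_types, lifting))
  define l where "l = Max A"
  define r where "r = Min B"
  have lr: "l \<in> A" "r \<in> B" using AB by (auto simp: l_def r_def)
  then have lr': "l < z0" "z0 < r" by (auto simp: A_def B_def)
  have "\<exists>x\<in>{l..r}. \<forall>y\<in>{l..r}. poly p x \<le> poly p y"
    by (intro continuous_attains_inf) (use lr' in \<open>auto intro!: continuous_intros\<close>)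
  then obtain x0 where x0: "x0 \<in> {l..r}" "\<And>y. y \<in> {l..r} \<Longrightarrow> poly p x0 \<le> poly p y" by blast
  \<comment> \<open>If the minimum over [l, r] is attained at an end, z0 attains it as well, so an
    interior minimizer exists in any case.\<close>
  obtain x where x: "l < x" "x < r" "\<And>y. y \<in> {l..r} \<Longrightarrow> poly p x \<le> poly p y"
  proof (cases "x0 = l \<or> x0 = r")
    case True
    have "poly p z0 \<le> poly p x0" using True hA[OF lr(1)] hB[OF lr(2)] h0 ab by auto
    then show ?thesis using that[of z0] lr' x0 by force
  next
    case False
    then show ?thesis using that[of x0] x0 by auto
  qed
  have "poly (pderiv p) x = 0"
    by (rule DERIV_local_min[OF poly_DERIV, of "min (x - l) (r - x)"]) (use x in \<open>auto simp: abs_if split: if_splits\<close>)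
  then have xR: "x \<in> ?R" by simp
  have xM: "x \<notin> M1 \<union> M2" "M1 \<inter> M2 = {}"
    using M1(4) M2(4) x lr' by (fastforce simp: l_def r_def)+
  have "card A > 0" "card B > 0" using AB by (simp_all add: card_gt_0_iff)
  then have "card (insert x (M1 \<union> M2)) = card A + card B - 1"
    using xM M1(2,3) M2(2,3) by (simp add: card_Un_disjoint)
  moreover have "card A + card B = n + 1"
  proof -
    have "Z = insert z0 (A \<union> B)" "z0 \<notin> A \<union> B" "A \<inter> B = {}" using Z by (auto simp: A_def B_def)
    then have "card Z = Suc (card A + card B)" using AB by (simp add: card_Un_disjoint)
    then show ?thesis using Z by simp
  qed
  ultimately have cn: "card (insert x (M1 \<union> M2)) = n" by simp
  have "pderiv p = 0"
  proof (rule ccontr)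
    assume nz: "pderiv p \<noteq> 0"
    then have "degree p \<noteq> 0" by (simp add: pderiv_eq_0_iff)
    have "n \<le> card ?R"
      unfolding cn[symmetric] by (intro card_mono poly_roots_finite nz) (use xR M1 M2 in auto)
    also have "\<dots> \<le> degree (pderiv p)" by (rule card_poly_roots_bound[OF nz])
    also have "\<dots> < n" using p \<open>degree p \<noteq> 0\<close> by (simp add: degree_pderiv)
    finally show False by simp
  qed
  then have "poly p u = poly p v" for u v
    by (metis degree_eq_zeroE pderiv_eq_0_iff poly_pCons poly_0 mult_zero_right)
  then have "poly p l = poly p z0" "poly p z0 = poly p r" by blast+
  then show False using hA[OF lr(1)] hB[OF lr(2)] h0 ab by auto
qed

text \<open>The values on the two sides of z0 have opposite signs and differ by the jump
  \<open>1 / node_weight Z z0\<close>, so neither can exceed the jump in absolute value.\<close>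

lemma abs_tker_0_le:
  assumes Z: "finite Z" "card Z = n + 2" "z0 \<in> Z" "Min Z < z0" "z0 < Max Z"
  shows "tker Z 0 z0 \<noteq> 0" "tker Z 0 z0 + 1 / node_weight Z z0 \<noteq> 0"
    "\<bar>tker Z 0 z0\<bar> \<le> 1 / \<bar>node_weight Z z0\<bar>" "\<bar>tker Z 0 z0 + 1 / node_weight Z z0\<bar> \<le> 1 / \<bar>node_weight Z z0\<bar>"
proof -
  let ?S = "tker Z 0 z0" and ?w = "1 / node_weight Z z0"
  have neg: "?S * (?S + ?w) < 0" by (rule tker_0_sign_change[OF Z])
  then show "?S \<noteq> 0" "?S + ?w \<noteq> 0" by auto
  have "\<bar>s\<bar> \<le> \<bar>w\<bar> \<and> \<bar>s + w\<bar> \<le> \<bar>w\<bar>" if "s * (s + w) < 0" for s w :: real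
    using that by (auto simp: mult_less_0_iff)
  from this[OF neg] have "\<bar>?S\<bar> \<le> \<bar>?w\<bar> \<and> \<bar>?S + ?w\<bar> \<le> \<bar>?w\<bar>" .
  then show "\<bar>?S\<bar> \<le> 1 / \<bar>node_weight Z z0\<bar>" "\<bar>?S + ?w\<bar> \<le> 1 / \<bar>node_weight Z z0\<bar>"
    by simp_all
qed

lemma tker_0_eq_right:
  assumes "finite Z" "{z\<in>Z. z > y} \<noteq> {}"
  shows "tker Z 0 y = tker Z 0 (Min {z\<in>Z. z > y}) + 1 / node_weight Z (Min {z\<in>Z. z > y})"
proof -
  let ?B = "{z\<in>Z. z > y}"
  define z1 where "z1 = Min ?B"
  have z1: "z1 \<in> ?B" unfolding z1_def using assms by (intro Min_in) auto
  have "z1 \<le> z" if "z \<in> ?B" for z unfolding z1_def using assms that by (intro Min_le) auto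
  with z1 have "?B = insert z1 {z\<in>Z. z > z1}" by force
  then have "tker Z 0 y = (\<Sum>z\<in>insert z1 {z\<in>Z. z > z1}. 1 / node_weight Z z)"
    using tker_0[OF assms(1)] by simp
  also have "\<dots> = tker Z 0 z1 + 1 / node_weight Z z1"
    using assms(1) by (simp add: tker_0)
  finally show ?thesis by (simp add: z1_def)
qed

lemma tker_0_eq_left:
  assumes "finite Z" "{z\<in>Z. z \<le> y} \<noteq> {}"
  shows "tker Z 0 y = tker Z 0 (Max {z\<in>Z. z \<le> y})"
proof -
  let ?B = "{z\<in>Z. z \<le> y}"
  define z1 where "z1 = Max ?B"
  have z1: "z1 \<in> ?B" unfolding z1_def using assms by (intro Max_in) auto
  have "z \<le> z1" if "z \<in> ?B" for z unfolding z1_def using assms that by (intro Max_ge) auto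
  with z1 have "{z\<in>Z. z > y} = {z\<in>Z. z > z1}" by force
  then show ?thesis using assms by (simp add: tker_0 z1_def)
qed

text \<open>Each constant piece ends at a node on its right. If that node is interior, the sign
  change excludes 0; if it is the largest, the value is a single reciprocal weight.\<close>

lemma tker_0_nonzero:
  assumes Z: "finite Z" "card Z = n + 2" and y: "Min Z \<le> y" "y < Max Z"
  shows "tker Z 0 y \<noteq> 0"
proof -
  have mM: "Min Z \<in> Z" "Max Z \<in> Z" using Z by (auto intro!: Min_in Max_in)
  define z1 where "z1 = Min {z\<in>Z. z > y}"
  have ne: "{z\<in>Z. z > y} \<noteq> {}" using y mM by auto
  have "z1 \<in> {z\<in>Z. z > y}" unfolding z1_def using Z ne by (intro Min_in) auto
  then have z1: "z1 \<in> Z" "Min Z < z1" using y by auto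
  have eq: "tker Z 0 y = tker Z 0 z1 + 1 / node_weight Z z1"
    unfolding z1_def by (rule tker_0_eq_right[OF Z(1) ne])
  show ?thesis
  proof (cases "z1 = Max Z")
    case True
    then show ?thesis using eq tker_Max[OF Z(1), of z1] node_weight_nonzero[OF Z(1)] by simp
  next
    case False
    then have "z1 < Max Z" using z1 Z by (simp add: order_less_le)
    then show ?thesis unfolding eq using abs_tker_0_le(2)[OF Z z1] by simp
  qed
qed

text \<open>On an interval without interior nodes the kernel is affine with slope
  \<open>- tker Z 0 u\<close>, which is not 0. This replaces Rolle's theorem at the lowest
  level.\<close>

lemma node_between_tker_1_zeros:
  assumes Z: "finite Z" "card Z = n + 2" and uv: "Min Z \<le> u" "u < v" "v \<le> Max Z"
    and z: "tker Z 1 u = 0" "tker Z 1 v = 0"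
  shows "\<exists>x\<in>Z. u < x \<and> x < v"
proof (rule ccontr)
  assume no: "\<not> ?thesis"
  have "tker Z 1 u - tker Z 1 v = (v - u) * tker Z 0 u"
    unfolding tker_def divdiff_def sum_subtractf[symmetric] sum_distrib_left
    by (intro sum.cong) (use no uv in \<open>auto simp: tpow_def diff_divide_distrib[symmetric]\<close>)
  moreover have "tker Z 0 u \<noteq> 0" by (rule tker_0_nonzero[OF Z]) (use uv in auto)
  ultimately show False using z uv by simp
qed

text \<open>Each use of Rolle's theorem loses one zero, but the extreme node c is a zero of every
  kernel and lies outside the open range of the Rolle points. Adding it again keeps the cardinality
  constant down to k = 1, so only the last step loses one.\<close>

lemma nodes_between_tker_zeros:
  assumes Z: "finite Z" "card Z = n + 2" and c: "c = Min Z \<or> c = Max Z"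
    and k: "1 \<le> k" "k \<le> n"
    and V: "finite V" "c \<in> V" "V \<subseteq> {Min Z..Max Z}" "\<And>x. x \<in> V \<Longrightarrow> tker Z k x = 0"
  shows "card V \<le> card {z\<in>Z. Min V < z \<and> z < Max V} + 1"
  using k V
proof (induction k arbitrary: V rule: nat_induct_at_least)
  case base
  have "\<exists>M\<subseteq>Z. finite M \<and> card M = card V - 1 \<and> M \<subseteq> {Min V<..<Max V}"
  proof (rule separating_points)
    fix u v assume "u \<in> V" "v \<in> V" "u < v"
    then show "\<exists>x\<in>Z. u < x \<and> x < v"
      using base by (intro node_between_tker_1_zeros[OF Z]) auto
  qed (use base in auto)
  then obtain M where M: "M \<subseteq> Z" "card M = card V - 1" "M \<subseteq> {Min V<..<Max V}" by blast
  have "card M \<le> card {z\<in>Z. Min V < z \<and> z < Max V}"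
    by (rule card_mono) (use Z M in auto)
  then show ?case using M by linarith
next
  case (Suc k)
  have "\<exists>M\<subseteq>{x. tker Z k x = 0}. finite M \<and> card M = card V - 1 \<and> M \<subseteq> {Min V<..<Max V}"
    by (rule separating_points) (use Suc.prems Suc.hyps tker_Rolle[OF Z(1)] in auto)
  then obtain M where M: "M \<subseteq> {x. tker Z k x = 0}" "finite M" "card M = card V - 1" "M \<subseteq> {Min V<..<Max V}" by blast
  have mV: "Min V \<in> V" "Max V \<in> V" using Suc.prems by (auto intro!: Min_in Max_in)
  have cV: "c = Min V \<or> c = Max V"
    using c Suc.prems mV by (metis Max_ge Min_le antisym atLeastAtMost_iff subset_iff)
  have "c \<notin> M" using cV M by auto
  have cz: "tker Z k c = 0"
    using c tker_Max[OF Z(1), of c] tker_Min[OF Z(1), of k] Suc.hyps Suc.prems Z by auto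
  have mem: "Min (insert c M) \<in> insert c M" "Max (insert c M) \<in> insert c M"
    using M(2) by (intro Min_in Max_in; simp)+
  have le: "Min V \<le> x" "x \<le> Max V" if "x \<in> insert c M" for x
    using that M mV Suc.prems by fastforce+
  \<comment> \<open>Here \<open>insert c M\<close> has as many elements as V and spans no more than
    V, so its node count bounds the one wanted.\<close>
  have "card (insert c M) \<le> card {z\<in>Z. Min (insert c M) < z \<and> z < Max (insert c M)} + 1"
    by (rule Suc.IH) (use Suc.prems M cz le mV in fastforce)+
  also have "\<dots> \<le> card {z\<in>Z. Min V < z \<and> z < Max V} + 1"
    unfolding add_le_cancel_right
    by (rule card_mono) (use Z le[OF mem(1)] le[OF mem(2)] in \<open>auto simp del: Min_insert Max_insert\<close>)
  finally show ?case using M \<open>c \<notin> M\<close> by simp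
qed

definition inner_nodes :: "real set \<Rightarrow> real \<Rightarrow> real \<Rightarrow> real set" where
  "inner_nodes Z u v = {z\<in>Z. Min Z < z \<and> z < Max Z \<and> u \<le> z \<and> z \<le> v}"

text \<open>If the n - k known interior zeros avoided (u, v), those on each side, anchored at the
  extreme node there, would be at most as many as the interior nodes on that side. Then n - k \<le>
  n - \<open>card (inner_nodes Z u v)\<close> < n - k, a contradiction.\<close>

lemma tker_zero_in_interval:
  assumes Z: "finite Z" "card Z = n + 2" and k: "1 \<le> k" "k \<le> n"
    and J: "u < v" "card (inner_nodes Z u v) > k"
  shows "\<exists>x. u < x \<and> x < v \<and> tker Z k x = 0"
proof (rule ccontr)
  assume no: "\<not> ?thesis"
  obtain U where U: "U \<subseteq> {x. tker Z k x = 0}" "finite U" "card U = n - k" "U \<subseteq> {Min Z<..<Max Z}"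
    using tker_many_zeros[OF Z k] by blast
  have mM: "Min Z \<in> Z" "Max Z \<in> Z" "Min Z \<le> Max Z" using Z by (auto intro!: Min_in Max_in Min_le)
  define U1 where "U1 = insert (Min Z) {x\<in>U. x \<le> u}"
  define U2 where "U2 = insert (Max Z) {x\<in>U. x \<ge> v}"
  define N1 where "N1 = {z\<in>Z. Min Z < z \<and> z < Max Z \<and> z < u}"
  define N2 where "N2 = inner_nodes Z u v"
  define N3 where "N3 = {z\<in>Z. Min Z < z \<and> z < Max Z \<and> v < z}"
  have c: "card U1 = card {x\<in>U. x \<le> u} + 1" "card U2 = card {x\<in>U. x \<ge> v} + 1"
    unfolding U1_def U2_def using U by (subst card_insert_disjoint; auto)+
  have "{x\<in>U. x \<le> u} \<union> {x\<in>U. x \<ge> v} = U" using no U by force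
  moreover have "{x\<in>U. x \<le> u} \<inter> {x\<in>U. x \<ge> v} = {}" using J by auto
  ultimately have cU: "card {x\<in>U. x \<le> u} + card {x\<in>U. x \<ge> v} = n - k"
    using U card_Un_disjoint[of "{x\<in>U. x \<le> u}" "{x\<in>U. x \<ge> v}"] by simp
  have fin: "finite U1" "finite U2" using U by (auto simp: U1_def U2_def)
  have ne: "U1 \<noteq> {}" "U2 \<noteq> {}" by (auto simp: U1_def U2_def)
  have sub: "U1 \<subseteq> {Min Z..Max Z}" "U2 \<subseteq> {Min Z..Max Z}" using U mM by (auto simp: U1_def U2_def)
  have "card U1 \<le> card {z\<in>Z. Min U1 < z \<and> z < Max U1} + 1"
    by (rule nodes_between_tker_zeros[OF Z _ k, of "Min Z"])
      (use U fin sub tker_Min[OF Z(1) k(1)] k Z in \<open>auto simp: U1_def\<close>)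
  also have "{z\<in>Z. Min U1 < z \<and> z < Max U1} \<subseteq> N1"
  proof
    fix z assume z: "z \<in> {z\<in>Z. Min U1 < z \<and> z < Max U1}"
    have "Max U1 \<in> U1" "Min Z \<le> Min U1" using fin ne sub Min_in[OF fin(1) ne(1)] by auto
    moreover have "Max U1 \<le> u"
    proof -
      have "Max U1 \<noteq> Min Z" using z \<open>Min Z \<le> Min U1\<close> by auto
      then show ?thesis using \<open>Max U1 \<in> U1\<close> by (auto simp: U1_def simp del: Max_insert)
    qed
    moreover have "Max U1 \<le> Max Z" using sub Max_in[OF fin(1) ne(1)] by auto
    ultimately show "z \<in> N1" using z by (auto simp: N1_def)
  qed
  then have "card {z\<in>Z. Min U1 < z \<and> z < Max U1} \<le> card N1"
    by (rule card_mono[rotated]) (use Z in \<open>auto simp: N1_def\<close>)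
  finally have 1: "card {x\<in>U. x \<le> u} \<le> card N1" using c by simp
  have "card U2 \<le> card {z\<in>Z. Min U2 < z \<and> z < Max U2} + 1"
    by (rule nodes_between_tker_zeros[OF Z _ k, of "Max Z"])
      (use U fin sub tker_Max[OF Z(1)] in \<open>auto simp: U2_def\<close>)
  also have "{z\<in>Z. Min U2 < z \<and> z < Max U2} \<subseteq> N3"
  proof
    fix z assume z: "z \<in> {z\<in>Z. Min U2 < z \<and> z < Max U2}"
    have "Min U2 \<in> U2" "Max U2 \<le> Max Z" using fin ne sub Max_in[OF fin(2) ne(2)] by auto
    moreover have "v \<le> Min U2"
    proof -
      have "Min U2 \<noteq> Max Z" using z \<open>Max U2 \<le> Max Z\<close> by auto
      then show ?thesis using \<open>Min U2 \<in> U2\<close> by (auto simp: U2_def simp del: Min_insert)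
    qed
    moreover have "Min Z \<le> Min U2" using sub Min_in[OF fin(2) ne(2)] by auto
    ultimately show "z \<in> N3" using z by (auto simp: N3_def)
  qed
  then have "card {z\<in>Z. Min U2 < z \<and> z < Max U2} \<le> card N3"
    by (rule card_mono[rotated]) (use Z in \<open>auto simp: N3_def\<close>)
  finally have 3: "card {x\<in>U. x \<ge> v} \<le> card N3" using c by simp
  have "card (N1 \<union> N2 \<union> N3) = card N1 + card N2 + card N3"
    using Z J(1) by (subst card_Un_disjoint, simp_all add: N1_def N2_def N3_def inner_nodes_def, force)
      (subst card_Un_disjoint, auto)
  moreover have "card (N1 \<union> N2 \<union> N3) \<le> card (Z - {Min Z, Max Z})"
    by (rule card_mono) (use Z in \<open>auto simp: N1_def N2_def N3_def inner_nodes_def\<close>)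
  moreover have "card (Z - {Min Z, Max Z}) = n"
  proof -
    have "Min Z \<noteq> Max Z"
    proof
      assume "Min Z = Max Z"
      then have "Z \<subseteq> {Min Z}" using Min_le[OF Z(1)] Max_ge[OF Z(1)] by fastforce
      from card_mono[OF _ this] Z show False by simp
    qed
    then show ?thesis using Z mM by (subst card_Diff_subset) auto
  qed
  ultimately show False using J(2) 1 3 cU k unfolding N2_def[symmetric] by linarith
qed

text \<open>The step function is at most B on [u, v], and each of the kernels 1 to r has a zero
  there. Integrating from that zero multiplies the bound by the length v - u and by the factor k
  from differentiating the power.\<close>

lemma abs_tker_le:
  assumes Z: "finite Z" "card Z = n + 2" and "r \<le> n"
    and J: "Min Z \<le> u" "u < v"
    and cJ: "card (inner_nodes Z u v) > r"
    and B: "\<And>z. z \<in> inner_nodes Z u v \<Longrightarrow> 1 / \<bar>node_weight Z z\<bar> \<le> B"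
    and k: "1 \<le> k" "k \<le> r" and y: "u \<le> y" "y \<le> v"
  shows "\<bar>tker Z k y\<bar> \<le> fact k * (v - u) ^ k * B"
proof -
  have "card (inner_nodes Z u v) \<noteq> 0" using cJ by linarith
  then have "inner_nodes Z u v \<noteq> {}" by (metis card.empty)
  then obtain z' where z'_in: "z' \<in> inner_nodes Z u v" by blast
  then have z': "z' \<in> Z" "Min Z < z'" "z' < Max Z" "u \<le> z'" "z' \<le> v" by (auto simp: inner_nodes_def)
  have B0: "0 \<le> B" by (rule order_trans[OF _ B[OF z'_in]]) simp
  \<comment> \<open>The neighbouring node of y on the side facing z' lies between y and z', hence in
    [u, v], so the bound B applies to its weight.\<close>
  have step0: "\<bar>tker Z 0 y\<bar> \<le> B" if y: "u \<le> y" "y \<le> v" for y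
  proof -
    consider "y \<ge> Max Z" | "y < Max Z" "y \<ge> z'" | "y < z'" by linarith
    then show ?thesis
    proof cases
      case 1
      then show ?thesis using tker_Max[OF Z(1)] B0 by simp
    next
      case 2
      define z where "z = Max {z\<in>Z. z \<le> y}"
      have ne: "{z\<in>Z. z \<le> y} \<noteq> {}" using 2 z' by auto
      have "z \<in> {z\<in>Z. z \<le> y}" unfolding z_def using Z ne by (intro Max_in) auto
      moreover have "z' \<le> z" unfolding z_def using Z z' 2 by (intro Max_ge) auto
      ultimately have z: "z \<in> Z" "Min Z < z" "z < Max Z" "u \<le> z" "z \<le> v" using 2 z' y by auto
      have "tker Z 0 y = tker Z 0 z" unfolding z_def by (rule tker_0_eq_left[OF Z(1) ne])
      then show ?thesis using abs_tker_0_le(3)[OF Z z(1-3)] B[of z] z by (simp add: inner_nodes_def)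
    next
      case 3
      define z where "z = Min {z\<in>Z. z > y}"
      have ne: "{z\<in>Z. z > y} \<noteq> {}" using 3 z' by auto
      have "z \<in> {z\<in>Z. z > y}" unfolding z_def using Z ne by (intro Min_in) auto
      moreover have "z \<le> z'" unfolding z_def using Z z' 3 by (intro Min_le) auto
      ultimately have z: "z \<in> Z" "Min Z < z" "z < Max Z" "u \<le> z" "z \<le> v" using 3 z' y J by auto
      have "tker Z 0 y = tker Z 0 z + 1 / node_weight Z z"
        unfolding z_def by (rule tker_0_eq_right[OF Z(1) ne])
      then show ?thesis using abs_tker_0_le(4)[OF Z z(1-3)] B[of z] z by (simp add: inner_nodes_def)
    qed
  qed
  have lip: "\<bar>tker Z 1 b - tker Z 1 a\<bar> \<le> B * (b - a)" if "u \<le> a" "a \<le> b" "b \<le> v" for a b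
  proof -
    have "((\<lambda>y. - tker Z 0 y) has_integral (tker Z 1 b - tker Z 1 a)) {a..b}"
    \<comment> \<open>Kernel 1 has corners, but only at the finitely many points of Z, which form
      the exceptional set.\<close>
    proof (rule fundamental_theorem_of_calculus_strong[OF Z(1) that(2)])
      show "continuous_on {a..b} (tker Z 1)" by (rule tker_continuous[OF Z(1)]) simp
      fix x assume x: "x \<in> {a..b} - Z"
      have "((\<lambda>y. tpow 1 (z - y) / node_weight Z z) has_real_derivative
              - (tpow 0 (z - x) / node_weight Z z)) (at x)" if "z \<in> Z" for z
      proof (cases "z > x")
        case True
        have "((\<lambda>y. (z - y) / node_weight Z z) has_real_derivative - (1 / node_weight Z z)) (at x)"
          by (auto intro!: derivative_eq_intros simp: node_weight_nonzero[OF Z(1)])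
        then have "((\<lambda>y. tpow 1 (z - y) / node_weight Z z) has_real_derivative - (1 / node_weight Z z)) (at x)"
          by (rule has_field_derivative_transform_within_open[where S = "{..<z}"])
             (use True in \<open>auto simp: tpow_def\<close>)
        then show ?thesis using True by (simp add: tpow_def)
      next
        case False
        moreover have "z \<noteq> x" using x that by auto
        ultimately have "z < x" by simp
        have "((\<lambda>y. 0) has_real_derivative 0) (at x)" by simp
        then have "((\<lambda>y. tpow 1 (z - y) / node_weight Z z) has_real_derivative 0) (at x)"
          by (rule has_field_derivative_transform_within_open[where S = "{z<..}"])
             (use \<open>z < x\<close> in \<open>auto simp: tpow_def\<close>)
        then show ?thesis using False by (simp add: tpow_def)
      qed
      then have "(tker Z 1 has_real_derivative (\<Sum>z\<in>Z. - (tpow 0 (z - x) / node_weight Z z))) (at x)"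
        unfolding tker_def divdiff_def by (rule DERIV_sum)
      then show "(tker Z 1 has_vector_derivative - tker Z 0 x) (at x)"
        by (simp add: has_real_derivative_iff_has_vector_derivative tker_def divdiff_def sum_negf)
    qed
    then have "((\<lambda>y. - tker Z 0 y) has_integral (tker Z 1 b - tker Z 1 a)) (cbox a b)" by simp
    from has_integral_bound[OF B0 this] step0 that show ?thesis by (simp add: mult.commute)
  qed
  have zero: "\<exists>x. u < x \<and> x < v \<and> tker Z k x = 0" if "1 \<le> k" "k \<le> r" for k
    by (rule tker_zero_in_interval[OF Z that(1) _ J(2)]) (use that cJ assms(3) in linarith)+
  show ?thesis
    using k y
  proof (induction k arbitrary: y rule: nat_induct_at_least)
    case base
    obtain x where x: "u < x" "x < v" "tker Z 1 x = 0" using zero[of 1] base by auto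
    have "\<bar>tker Z 1 y\<bar> \<le> B * \<bar>y - x\<bar>"
      using lip[of x y] lip[of y x] x base by (cases "x \<le> y") auto
    also have "\<dots> \<le> B * (v - u)" using x base B0 by (intro mult_left_mono) auto
    finally show ?case by (simp add: mult.commute)
  next
    case (Suc k)
    obtain x where x: "u < x" "x < v" "tker Z (Suc k) x = 0" using zero[of "Suc k"] Suc by auto
    define C where "C = fact (Suc k) * (v - u) ^ k * B"
    have "C \<ge> 0" unfolding C_def using B0 J by simp
    have "\<bar>tker Z (Suc k) y\<bar> \<le> C * \<bar>y - x\<bar>"
    proof -
      have "norm (tker Z (Suc k) y - tker Z (Suc k) x) \<le> C * norm (y - x)"
      proof (rule field_differentiable_bound[of "{u..v}"])
        fix t assume t: "t \<in> {u..v}"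
        show "(tker Z (Suc k) has_field_derivative - real (Suc k) * tker Z k t) (at t within {u..v})"
          by (rule has_field_derivative_at_within[OF tker_has_derivative]) (use Suc.hyps in simp)
        have "\<bar>tker Z k t\<bar> \<le> fact k * (v - u) ^ k * B" using Suc.IH[of t] t Suc.prems by simp
        then have "real (Suc k) * \<bar>tker Z k t\<bar> \<le> real (Suc k) * (fact k * (v - u) ^ k * B)"
          by (rule mult_left_mono) simp
        moreover have "norm (- real (Suc k) * tker Z k t) = real (Suc k) * \<bar>tker Z k t\<bar>"
          by (simp only: real_norm_def abs_mult abs_minus_cancel abs_of_nat)
        moreover have "real (Suc k) * (fact k * (v - u) ^ k * B) = C"
          unfolding C_def fact_Suc by (simp only: mult.assoc of_nat_mult)
        ultimately show "norm (- real (Suc k) * tker Z k t) \<le> C" by (simp only:)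
      qed (use x Suc.prems in auto)
      then show ?thesis using x by simp
    qed
    also have "\<dots> \<le> C * (v - u)" using x Suc.prems \<open>C \<ge> 0\<close> by (intro mult_left_mono) auto
    finally show ?case by (simp add: C_def algebra_simps)
  qed
qed

section \<open>Functions whose last derivative has bounded variation\<close>

lemma poly_antiderivative:
  fixes p :: "real poly"
  obtains q where "pderiv q = p" "degree q \<le> degree p + 1"
proof -
  define q where "q = (\<Sum>i\<le>degree p. monom (coeff p i / real (Suc i)) (Suc i))"
  have "pderiv (sum u A) = (\<Sum>i\<in>A. pderiv (u i))" for u :: "nat \<Rightarrow> real poly" and A
    by (induction A rule: infinite_finite_induct) (auto simp: pderiv_add)
  then have "pderiv q = (\<Sum>i\<le>degree p. monom (coeff p i) i)"
    unfolding q_def by (auto simp: pderiv_monom intro!: sum.cong)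
  also have "\<dots> = p" by (rule poly_as_sum_of_monoms)
  finally have 1: "pderiv q = p" .
  have 2: "degree q \<le> degree p + 1"
    unfolding q_def by (intro degree_sum_le order.trans[OF degree_monom_le]) auto
  show ?thesis by (rule that[OF 1 2])
qed

lemma exists_mesh_cell:
  fixes t h :: real
  assumes "h > 0" "real m * h = 2" "t \<in> {-1..1}"
  obtains j where "j < m" "-1 + real j * h \<le> t" "t \<le> -1 + real (Suc j) * h"
proof (cases "t = 1")
  case True
  have "m > 0" using assms by (cases m) auto
  then have "real m = real (m - 1) + 1" by simp
  then have "real (m - 1) * h + h = 2" using assms by (metis distrib_right mult_1)
  then show ?thesis using True assms \<open>m > 0\<close> by (intro that[of "m - 1"]) (auto simp: algebra_simps)
next
  case False
  define j where "j = nat \<lfloor>(t + 1) / h\<rfloor>"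
  have nn: "(t + 1) / h \<ge> 0" using assms by auto
  have j: "real j \<le> (t + 1) / h" "(t + 1) / h < real j + 1"
    using nn by (simp_all add: j_def of_nat_floor) linarith?
  have "real j * h \<le> t + 1" using j(1) assms(1) by (simp add: field_simps)
  moreover have "t + 1 < (real j + 1) * h" using j(2) assms(1) by (simp add: field_simps)
  moreover have "j < m"
  proof -
    have "real j * h < real m * h" using calculation assms False by auto
    then show ?thesis using assms(1) by simp
  qed
  ultimately show ?thesis by (intro that[of j]) (auto simp: algebra_simps)
qed

text \<open>G is replaced by its linear interpolant on a uniform mesh, written with truncated powers
  whose coefficients are the jumps of the slopes. Slopes are means of g over mesh cells, so
  averaging the variation of g along translates of the mesh bounds the total jump by V without any
  Stieltjes measure.\<close>

lemma piecewise_linear_approx: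
  fixes G g :: "real \<Rightarrow> real"
  assumes cont: "continuous_on {-1..1} G" and gint: "g integrable_on {-1..1}"
    and G: "\<And>t. t \<in> {-1..1} \<Longrightarrow> G t = G (-1) + integral {-1..t} g"
    and V: "\<And>(m::nat) x. x ` {..m} \<subseteq> {-1..1} \<Longrightarrow> mono_on {..m} x \<Longrightarrow>
        (\<Sum>i<m. \<bar>g (x (Suc i)) - g (x i)\<bar>) \<le> V"
    and "\<epsilon> > 0"
  shows "\<exists>(N::nat) c y a. (\<Sum>i<N. \<bar>c i\<bar>) \<le> V \<and> (\<forall>i<N. y i \<in> {-1..1}) \<and>
      (\<forall>t\<in>{-1..1}. \<bar>G t - (G (-1) + a * (t + 1) + (\<Sum>i<N. c i * tpow 1 (t - y i)))\<bar> \<le> \<epsilon>)"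
proof -
  have "uniformly_continuous_on {-1..1} G"
    by (rule compact_uniformly_continuous[OF cont]) simp
  then obtain \<delta> where \<delta>: "\<delta> > 0"
      "\<And>s t. s \<in> {-1..1} \<Longrightarrow> t \<in> {-1..1} \<Longrightarrow> \<bar>s - t\<bar> < \<delta> \<Longrightarrow> \<bar>G s - G t\<bar> < \<epsilon>"
    using \<open>\<epsilon> > 0\<close> unfolding uniformly_continuous_on_def dist_real_def by metis
  obtain m0 :: nat where m0: "2 / \<delta> < real m0" using reals_Archimedean2 by blast
  define m where "m = Suc m0"
  define h where "h = 2 / real m"
  have "real m > 0" by (simp add: m_def)
  then have h: "h > 0" "real m * h = 2" by (simp_all add: h_def)
  have "2 / \<delta> < real m" using m0 by (simp add: m_def)
  then have "h < \<delta>" using \<delta>(1) by (simp add: h_def m_def field_simps)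
  define y where "y = (\<lambda>j::nat. -1 + real j * h)"
  have yS: "y (Suc j) = y j + h" for j by (simp add: y_def algebra_simps)
  have ymono: "y i \<le> y j" if "i \<le> j" for i j using that h by (simp add: y_def)
  have y_in: "y j \<in> {-1..1}" if "j \<le> m" for j
  proof -
    have "real j * h \<le> real m * h" using that h by (intro mult_right_mono) auto
    then show ?thesis using h by (simp add: y_def)
  qed
  define \<mu> where "\<mu> = (\<lambda>j. (G (y (Suc j)) - G (y j)) / h)"
  define c where "c = (\<lambda>j. \<mu> (Suc j) - \<mu> j)"
  \<comment> \<open>All cells are shifted to the same interval [0, h], so that the differences of
    slopes can be summed under one integral.\<close>
  have \<mu>_int: "((\<lambda>s. g (y j + s)) has_integral h * \<mu> j) {0..h}" if "j < m" for j
  proof -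
    have yy: "y j \<in> {-1..1}" "y (Suc j) \<in> {-1..1}" "y j \<le> y (Suc j)"
      using y_in[of j] y_in[of "Suc j"] ymono[of j "Suc j"] that by auto
    have sub: "g integrable_on {y j..y (Suc j)}"
      by (rule integrable_on_subinterval[OF gint]) (use yy in auto)
    have sub2: "g integrable_on {-1..y (Suc j)}"
      by (rule integrable_on_subinterval[OF gint]) (use yy in auto)
    have "integral {-1..y j} g + integral {y j..y (Suc j)} g = integral {-1..y (Suc j)} g"
      using yy sub2 by (intro Henstock_Kurzweil_Integration.integral_combine) auto
    then have "integral {y j..y (Suc j)} g = h * \<mu> j"
      using G[OF yy(1)] G[OF yy(2)] h by (simp add: \<mu>_def)
    then have "(g has_integral h * \<mu> j) {0 + y j..h + y j}"
      using sub by (simp add: has_integral_iff yS add.commute)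
    then show ?thesis
      unfolding has_integral_shift_Icc_real[symmetric] by (simp add: o_def)
  qed
  have "(\<Sum>i<m0. \<bar>c i\<bar>) \<le> V"
  proof -
    \<comment> \<open>The signs of the jumps are inserted before integrating: for each s the
      integrand is at most the variation of g along the mesh shifted by s. No integrability of |g(y
      + h) - g(y)| is needed.\<close>
    have 1: "((\<lambda>s. \<Sum>i<m0. sgn (c i) * (g (y (Suc i) + s) - g (y i + s))) has_integral
        (\<Sum>i<m0. sgn (c i) * (h * \<mu> (Suc i) - h * \<mu> i))) {0..h}"
      by (intro has_integral_sum has_integral_mult_right has_integral_diff \<mu>_int) (auto simp: m_def)
    have 2: "((\<lambda>s::real. V) has_integral V * h) {0..h}"
      using has_integral_const_real[of V 0 h] h by (simp add: mult.commute)
    have "(\<Sum>i<m0. sgn (c i) * (h * \<mu> (Suc i) - h * \<mu> i)) \<le> V * h"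
    proof (rule has_integral_le[OF 1 2])
      fix s assume s: "s \<in> {0..h}"
      have "(\<Sum>i<m0. sgn (c i) * (g (y (Suc i) + s) - g (y i + s))) \<le>
          (\<Sum>i<m0. \<bar>g (y (Suc i) + s) - g (y i + s)\<bar>)"
        by (intro sum_mono) (auto simp: sgn_if)
      also have "\<dots> \<le> V"
      proof (rule V[of "\<lambda>i. y i + s" m0])
        show "(\<lambda>i. y i + s) ` {..m0} \<subseteq> {-1..1}"
        proof
          fix x assume "x \<in> (\<lambda>i. y i + s) ` {..m0}"
          then obtain i where i: "i \<le> m0" "x = y i + s" by auto
          have "y i \<in> {-1..1}" "y (Suc i) \<in> {-1..1}" using y_in[of i] y_in[of "Suc i"] i by (auto simp: m_def)
          then show "x \<in> {-1..1}" using s i by (auto simp: yS)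
        qed
        show "mono_on {..m0} (\<lambda>i. y i + s)" using ymono by (auto simp: mono_on_def)
      qed
      finally show "(\<Sum>i<m0. sgn (c i) * (g (y (Suc i) + s) - g (y i + s))) \<le> V" .
    qed
    moreover have "(\<Sum>i<m0. sgn (c i) * (h * \<mu> (Suc i) - h * \<mu> i)) = h * (\<Sum>i<m0. \<bar>c i\<bar>)"
      unfolding sum_distrib_left
    proof (intro sum.cong refl)
      fix i
      have "sgn (c i) * (h * \<mu> (Suc i) - h * \<mu> i) = h * (sgn (c i) * c i)"
        by (simp add: c_def algebra_simps)
      also have "sgn (c i) * c i = \<bar>c i\<bar>" by (simp add: sgn_if)
      finally show "sgn (c i) * (h * \<mu> (Suc i) - h * \<mu> i) = h * \<bar>c i\<bar>" .
    qed
    ultimately show ?thesis using h by (simp add: mult.commute)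
  qed
  moreover have "\<bar>G t - (G (-1) + \<mu> 0 * (t + 1) + (\<Sum>i<m0. c i * tpow 1 (t - y (Suc i))))\<bar> \<le> \<epsilon>"
    if t: "t \<in> {-1..1}" for t
  proof -
    obtain j where j: "j < m" "y j \<le> t" "t \<le> y (Suc j)"
      using exists_mesh_cell[OF h t] unfolding y_def by blast
    \<comment> \<open>On the cell number k exactly the knots with i < k are active, and there the
      truncated power form collapses to the chord of G.\<close>
    have tele: "G (-1) + \<mu> 0 * (t + 1) + (\<Sum>i<k. c i * (t - y (Suc i))) = G (y k) + \<mu> k * (t - y k)" for k
    proof (induction k)
      case (Suc k)
      have "G (-1) + \<mu> 0 * (t + 1) + (\<Sum>i<Suc k. c i * (t - y (Suc i))) =
          G (y k) + \<mu> k * (t - y k) + c k * (t - y (Suc k))" using Suc by simp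
      also have "\<dots> = G (y k) + \<mu> k * h + \<mu> (Suc k) * (t - y (Suc k))"
        by (simp add: c_def yS algebra_simps)
      also have "G (y k) + \<mu> k * h = G (y (Suc k))" using h by (simp add: \<mu>_def)
      finally show ?case .
    qed (simp add: y_def)
    have "(\<Sum>i<m0. c i * tpow 1 (t - y (Suc i))) = (\<Sum>i<j. c i * tpow 1 (t - y (Suc i)))"
    proof (rule sum.mono_neutral_right)
      show "\<forall>i\<in>{..<m0} - {..<j}. c i * tpow 1 (t - y (Suc i)) = 0"
      proof
        fix i assume "i \<in> {..<m0} - {..<j}"
        then have "y (Suc j) \<le> y (Suc i)" by (intro ymono) auto
        then show "c i * tpow 1 (t - y (Suc i)) = 0" using j by (simp add: tpow_def)
      qed
    qed (use j in \<open>auto simp: m_def\<close>)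
    also have "\<dots> = (\<Sum>i<j. c i * (t - y (Suc i)))"
    proof (intro sum.cong refl)
      fix i assume "i \<in> {..<j}"
      then have "y (Suc i) \<le> y j" by (intro ymono) auto
      then show "c i * tpow 1 (t - y (Suc i)) = c i * (t - y (Suc i))" using j by (simp add: tpow_def)
    qed
    finally have "G (-1) + \<mu> 0 * (t + 1) + (\<Sum>i<m0. c i * tpow 1 (t - y (Suc i))) =
        G (y j) + \<mu> j * (t - y j)" using tele[of j] by simp
    moreover have "\<bar>G t - (G (y j) + \<mu> j * (t - y j))\<bar> \<le> \<epsilon>"
    proof -
      define l where "l = (t - y j) / h"
      have l: "0 \<le> l" "l \<le> 1" using j h by (auto simp: l_def yS)
      have eq: "G t - (G (y j) + \<mu> j * (t - y j)) = (1 - l) * (G t - G (y j)) + l * (G t - G (y (Suc j)))"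
        using h by (simp add: \<mu>_def l_def field_simps)
      have "y j \<in> {-1..1}" "y (Suc j) \<in> {-1..1}" using y_in[of j] y_in[of "Suc j"] j by auto
      then have b: "\<bar>G t - G (y j)\<bar> \<le> \<epsilon>" "\<bar>G t - G (y (Suc j))\<bar> \<le> \<epsilon>"
        using \<delta>(2)[of t "y j"] \<delta>(2)[of t "y (Suc j)"] t j \<open>h < \<delta>\<close> yS[of j] by auto
      have "\<bar>(1 - l) * (G t - G (y j)) + l * (G t - G (y (Suc j)))\<bar> \<le>
          (1 - l) * \<bar>G t - G (y j)\<bar> + l * \<bar>G t - G (y (Suc j))\<bar>"
        using l by (intro order.trans[OF abs_triangle_ineq]) (simp add: abs_mult)
      also have "\<dots> \<le> (1 - l) * \<epsilon> + l * \<epsilon>" using b l by (intro add_mono mult_left_mono) auto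
      finally show ?thesis unfolding eq by (simp add: algebra_simps)
    qed
    ultimately show ?thesis by simp
  qed
  moreover have "y (Suc i) \<in> {-1..1}" if "i < m0" for i using y_in[of "Suc i"] that by (simp add: m_def)
  ultimately show ?thesis
    by (intro exI[of _ m0] exI[of _ c] exI[of _ "\<lambda>i. y (Suc i)"] exI[of _ "\<mu> 0"]) auto
qed

text \<open>Integrating the approximation of D (r - 1) another r - 1 times approximates D 0 by a
  polynomial of degree at most r, which the divided difference kills, and truncated powers of total
  weight at most V / r!, whose divided differences are values of \<open>tker Z r\<close>.\<close>

lemma abs_divdiff_le:
  fixes D :: "nat \<Rightarrow> real \<Rightarrow> real" and g :: "real \<Rightarrow> real"
  assumes Z: "finite Z" "Z \<subseteq> {-1..1}" "r + 2 \<le> card Z" and r: "r \<ge> 1"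
    and D: "\<And>k t. k < r - 1 \<Longrightarrow> t \<in> {-1..1} \<Longrightarrow> (D k has_real_derivative D (Suc k) t) (at t within {-1..1})"
    and cont: "continuous_on {-1..1} (D (r - 1))" and gint: "g integrable_on {-1..1}"
    and G: "\<And>t. t \<in> {-1..1} \<Longrightarrow> D (r - 1) t = D (r - 1) (-1) + integral {-1..t} g"
    and V: "\<And>(m::nat) x. x ` {..m} \<subseteq> {-1..1} \<Longrightarrow> mono_on {..m} x \<Longrightarrow>
        (\<Sum>i<m. \<bar>g (x (Suc i)) - g (x i)\<bar>) \<le> V"
    and B: "\<And>y. y \<in> {-1..1} \<Longrightarrow> \<bar>tker Z r y\<bar> \<le> B"
  shows "\<bar>divdiff Z (D 0)\<bar> \<le> V * B / fact r"
proof -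
  \<comment> \<open>W depends on Z and may be huge. This is harmless because Z stays fixed while
    \<epsilon> tends to 0, so W does not enter the conclusion.\<close>
  define W where "W = (\<Sum>z\<in>Z. 1 / \<bar>node_weight Z z\<bar>)"
  have W: "W \<ge> 0" unfolding W_def by (intro sum_nonneg) auto
  have B0: "B \<ge> 0" using B[of 0] by auto
  have *: "\<bar>divdiff Z (D 0)\<bar> \<le> V * B / fact r + \<epsilon> * (2 ^ (r - 1) * W)" if eps: "\<epsilon> > 0" for \<epsilon>
  proof -
    obtain N :: nat and c y a where cy: "(\<Sum>i<N. \<bar>c i\<bar>) \<le> V" "\<forall>i<N. y i \<in> {-1..1}"
      "\<forall>t\<in>{-1..1}. \<bar>D (r - 1) t - (D (r - 1) (-1) + a * (t + 1) + (\<Sum>i<N. c i * tpow 1 (t - y i)))\<bar> \<le> \<epsilon>"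
      using piecewise_linear_approx[OF cont gint G V eps] by blast
    define S where "S = (\<lambda>j t. \<Sum>i<N. c i / fact j * tpow j (t - y i))"
    have "\<exists>p. degree p \<le> j + 1 \<and> (\<forall>t\<in>{-1..1}. \<bar>D (r - 1 - j) t - (poly p t + S (Suc j) t)\<bar> \<le> \<epsilon> * 2 ^ j)"
      if "j \<le> r - 1" for j
      using that
    proof (induction j)
      case 0
      show ?case
        by (intro exI[of _ "[:D (r - 1) (-1) + a, a:]"]) (use cy(3) in \<open>simp add: S_def algebra_simps\<close>)
    next
      case (Suc j)
      then obtain p where p: "degree p \<le> j + 1"
        "\<And>t. t \<in> {-1..1} \<Longrightarrow> \<bar>D (r - 1 - j) t - (poly p t + S (Suc j) t)\<bar> \<le> \<epsilon> * 2 ^ j" by auto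
      define k where "k = r - 1 - Suc j"
      have k: "Suc k = r - 1 - j" "k < r - 1" using Suc by (auto simp: k_def)
      obtain q where q: "pderiv q = p" "degree q \<le> degree p + 1" by (rule poly_antiderivative)
      \<comment> \<open>The constant makes the new error vanish at -1; integrating the old error
        over an interval of length at most 2 then at most doubles the bound.\<close>
      define q' where "q' = q + [:D k (-1) - poly q (-1) - S (Suc (Suc j)) (-1):]"
      have dq': "degree q' \<le> Suc j + 1" unfolding q'_def using q p by (intro degree_add_le) auto
      define E where "E = (\<lambda>t. D k t - (poly q' t + S (Suc (Suc j)) t))"
      have E1: "E (-1) = 0" by (simp add: E_def q'_def)
      have dS: "(S (Suc (Suc j)) has_real_derivative S (Suc j) t) (at t within {-1..1})" for t
      proof -
        have "((\<lambda>t. c i / fact (Suc (Suc j)) * tpow (Suc (Suc j)) (t - y i)) has_real_derivative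
            c i / fact (Suc j) * tpow (Suc j) (t - y i)) (at t within {-1..1})" for i
        proof -
          have "((\<lambda>t. tpow (Suc (Suc j)) (t - y i)) has_real_derivative
             (real (Suc (Suc j)) * tpow (Suc j) (t - y i)) * 1) (at t within {-1..1})"
            by (rule has_field_derivative_at_within, rule DERIV_chain2[OF tpow_has_derivative])
              (auto intro!: derivative_eq_intros)
          from DERIV_cmult[OF this, of "c i / fact (Suc (Suc j))"]
          show ?thesis by (simp add: fact_Suc[of "Suc j"] del: fact_Suc of_nat_Suc)
        qed
        then show ?thesis unfolding S_def by (rule DERIV_sum)
      qed
      have dE: "(E has_real_derivative D (Suc k) t - (poly p t + S (Suc j) t)) (at t within {-1..1})"
        if "t \<in> {-1..1}" for t
      proof -
        have "pderiv q' = p" by (simp add: q'_def pderiv_add q pderiv_pCons)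
        then have "(poly q' has_real_derivative poly p t) (at t within {-1..1})"
          using has_field_derivative_at_within[OF poly_DERIV[of q' t]] by simp
        then show ?thesis unfolding E_def
          by (intro DERIV_diff DERIV_add dS D[OF k(2) that]) 
      qed
      have "\<bar>E t\<bar> \<le> \<epsilon> * 2 ^ Suc j" if t: "t \<in> {-1..1}" for t
      proof -
        have "norm (E t - E (-1)) \<le> (\<epsilon> * 2 ^ j) * norm (t - (-1))"
        proof (rule field_differentiable_bound[of "{-1..1}" E, OF _ dE])
          fix z :: real assume "z \<in> {-1..1}"
          then show "norm (D (Suc k) z - (poly p z + S (Suc j) z)) \<le> \<epsilon> * 2 ^ j"
            using p(2) k by simp
        qed (use t in auto)
        also have "\<dots> \<le> (\<epsilon> * 2 ^ j) * 2" using t \<open>\<epsilon> > 0\<close> by (intro mult_left_mono) auto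
        finally show ?thesis using E1 by simp
      qed
      then show ?case using dq' unfolding E_def k_def by blast
    qed
    from this[of "r - 1"] obtain p where p: "degree p \<le> r"
      "\<And>t. t \<in> {-1..1} \<Longrightarrow> \<bar>D 0 t - (poly p t + S r t)\<bar> \<le> \<epsilon> * 2 ^ (r - 1)" using r by auto
    have "divdiff Z (D 0) = divdiff Z (\<lambda>t. D 0 t - (poly p t + S r t)) + divdiff Z (poly p) + divdiff Z (S r)"
      unfolding divdiff_add[symmetric] by (simp add: divdiff_def)
    also have "divdiff Z (poly p) = 0" using p Z by (intro divdiff_poly_eq_0) auto
    finally have eq: "divdiff Z (D 0) = divdiff Z (\<lambda>t. D 0 t - (poly p t + S r t)) + divdiff Z (S r)" by simp
    have "\<bar>divdiff Z (\<lambda>t. D 0 t - (poly p t + S r t))\<bar> \<le>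
        (\<Sum>z\<in>Z. \<epsilon> * 2 ^ (r - 1) * (1 / \<bar>node_weight Z z\<bar>))"
      unfolding divdiff_def
    proof (intro order.trans[OF sum_abs] sum_mono)
      fix z assume "z \<in> Z"
      then have "\<bar>D 0 z - (poly p z + S r z)\<bar> \<le> \<epsilon> * 2 ^ (r - 1)" using p(2) Z(2) by blast
      then show "\<bar>(D 0 z - (poly p z + S r z)) / node_weight Z z\<bar> \<le> \<epsilon> * 2 ^ (r - 1) * (1 / \<bar>node_weight Z z\<bar>)"
        by (simp add: abs_divide divide_right_mono)
    qed
    also have "\<dots> = \<epsilon> * (2 ^ (r - 1) * W)" by (simp add: W_def sum_distrib_left mult.assoc)
    finally have 1: "\<bar>divdiff Z (\<lambda>t. D 0 t - (poly p t + S r t))\<bar> \<le> \<epsilon> * (2 ^ (r - 1) * W)" .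
    have "divdiff Z (S r) = (\<Sum>i<N. c i / fact r * tker Z r (y i))"
      unfolding S_def divdiff_sum divdiff_cmult tker_def ..
    also have "\<bar>\<dots>\<bar> \<le> (\<Sum>i<N. \<bar>c i\<bar> * (B / fact r))"
    proof (intro order.trans[OF sum_abs] sum_mono)
      fix i assume "i \<in> {..<N}"
      then have "\<bar>tker Z r (y i)\<bar> \<le> B" using B cy by auto
      then have "\<bar>c i\<bar> / fact r * \<bar>tker Z r (y i)\<bar> \<le> \<bar>c i\<bar> / fact r * B" by (intro mult_left_mono) auto
      then show "\<bar>c i / fact r * tker Z r (y i)\<bar> \<le> \<bar>c i\<bar> * (B / fact r)" by (simp add: abs_mult)
    qed
    also have "\<dots> = (\<Sum>i<N. \<bar>c i\<bar>) * (B / fact r)" by (simp only: sum_distrib_right)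
    also have "\<dots> \<le> V * (B / fact r)" using cy B0 by (intro mult_right_mono) auto
    finally have 2: "\<bar>divdiff Z (S r)\<bar> \<le> V * B / fact r" by simp
    show ?thesis unfolding eq using abs_triangle_ineq 1 2 by (smt (verit))
  qed
  define K where "K = 2 ^ (r - 1) * W + 1"
  have K: "K > 0" using W by (simp add: K_def add_nonneg_pos)
  show ?thesis
  proof (rule field_le_epsilon)
    fix e :: real assume e: "e > 0"
    have "e / K * (2 ^ (r - 1) * W) \<le> e / K * K" using e K by (intro mult_left_mono) (auto simp: K_def)
    then show "\<bar>divdiff Z (D 0)\<bar> \<le> V * B / fact r + e" using *[of "e / K"] e K by simp
  qed
qed

section \<open>The Jacobi differential equation\<close>

definition jacobi_op :: "real \<Rightarrow> real \<Rightarrow> real poly \<Rightarrow> real poly" where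
  "jacobi_op \<alpha> \<beta> p = [:1, 0, -1:] * pderiv (pderiv p) + [:\<beta> - \<alpha>, - (\<alpha> + \<beta> + 2):] * pderiv p"

lemma poly_jacobi_op:
  "poly (jacobi_op \<alpha> \<beta> p) x =
    (1 - x\<^sup>2) * poly (pderiv (pderiv p)) x + (\<beta> - \<alpha> - (\<alpha> + \<beta> + 2) * x) * poly (pderiv p) x"
  by (simp add: jacobi_op_def power2_eq_square algebra_simps)

lemma coeff_jacobi_op:
  assumes "degree p \<le> n"
  shows "coeff (jacobi_op \<alpha> \<beta> p) n = - real n * (real n + \<alpha> + \<beta> + 1) * coeff p n"
proof -
  have "coeff p (n + 1) = 0" "coeff p (n + 2) = 0" using assms by (auto intro!: coeff_eq_0)
  then show ?thesis
    by (cases n; cases "n - 1")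
      (auto simp: jacobi_op_def coeff_pCons coeff_pderiv algebra_simps split: nat.split)
qed

lemma degree_jacobi_op_le: "degree (jacobi_op \<alpha> \<beta> p) \<le> degree p"
proof (rule degree_le, intro allI impI)
  fix n assume "degree p < n"
  then show "coeff (jacobi_op \<alpha> \<beta> p) n = 0"
    by (subst coeff_jacobi_op) (auto intro: coeff_eq_0)
qed

text \<open>Self-adjoint form of the Jacobi operator: v = p' yields the weight times the operator
  applied to p, and v = p' q - p q' yields Green's formula.\<close>

lemma has_derivative_weighted:
  assumes v: "(v has_real_derivative v') (at y)" and y: "-1 < y" "y < 1"
  shows "((\<lambda>y. (1 - y) powr (\<alpha> + 1) * (1 + y) powr (\<beta> + 1) * v y) has_real_derivative
    (1 - y) powr \<alpha> * (1 + y) powr \<beta> * ((1 - y\<^sup>2) * v' + (\<beta> - \<alpha> - (\<alpha> + \<beta> + 2) * y) * v y)) (at y)"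
proof -
  have "((\<lambda>y. (1 - y) powr (\<alpha> + 1) * (1 + y) powr (\<beta> + 1) * v y) has_real_derivative
      ((\<alpha> + 1) * (1 - y) powr \<alpha> * (-1) * (1 + y) powr (\<beta> + 1) +
       (1 - y) powr (\<alpha> + 1) * ((\<beta> + 1) * (1 + y) powr \<beta>)) * v y +
      (1 - y) powr (\<alpha> + 1) * (1 + y) powr (\<beta> + 1) * v') (at y)"
    using y by (auto intro!: derivative_eq_intros v simp: algebra_simps)
  note der = this
  have pw: "(1 - y) powr (\<alpha> + 1) = (1 - y) * (1 - y) powr \<alpha>"
    "(1 + y) powr (\<beta> + 1) = (1 + y) * (1 + y) powr \<beta>"
    using y by (simp_all add: powr_add)
  show ?thesis
    by (rule DERIV_cong[OF der], unfold pw) (simp add: power2_eq_square algebra_simps)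
qed

text \<open>The difference of the integrands is the derivative of the weighted Wronskian, which
  vanishes at both ends because \<alpha> + 1 and \<beta> + 1 are positive.\<close>

lemma jacobi_op_symmetric:
  assumes ab: "\<alpha> > -1" "\<beta> > -1"
  shows "integral {-1..1} (\<lambda>t. poly (jacobi_op \<alpha> \<beta> p) t * poly q t * jacobi_weight \<alpha> \<beta> t) =
    integral {-1..1} (\<lambda>t. poly p t * poly (jacobi_op \<alpha> \<beta> q) t * jacobi_weight \<alpha> \<beta> t)"
proof -
  let ?A = "jacobi_op \<alpha> \<beta>" and ?w = "jacobi_weight \<alpha> \<beta>"
  define v where "v = pderiv p * q - p * pderiv q"
  define V where "V = (\<lambda>t. (1 - t) powr (\<alpha> + 1) * (1 + t) powr (\<beta> + 1) * poly v t)"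
  define F where "F = (\<lambda>t. poly (?A p * q - p * ?A q) t * ?w t)"
  have "(F has_integral (V 1 - V (-1))) {-1..1}"
  proof (rule fundamental_theorem_of_calculus_interior)
    show "continuous_on {-1..1} V"
      unfolding V_def using ab by (intro continuous_intros continuous_on_powr') auto
    fix t :: real assume t: "t \<in> {-1<..<1}"
    have 2: "pderiv v = pderiv (pderiv p) * q - p * pderiv (pderiv q)"
      by (simp add: v_def pderiv_mult pderiv_diff algebra_simps)
    have "(V has_real_derivative (1 - t) powr \<alpha> * (1 + t) powr \<beta> *
        ((1 - t\<^sup>2) * poly (pderiv v) t + (\<beta> - \<alpha> - (\<alpha> + \<beta> + 2) * t) * poly v t)) (at t)"
      unfolding V_def by (rule has_derivative_weighted[OF poly_DERIV]) (use t in auto)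
    also have "(1 - t) powr \<alpha> * (1 + t) powr \<beta> *
        ((1 - t\<^sup>2) * poly (pderiv v) t + (\<beta> - \<alpha> - (\<alpha> + \<beta> + 2) * t) * poly v t) = F t"
      unfolding 2 by (simp add: F_def v_def poly_jacobi_op jacobi_weight_def algebra_simps)
    finally show "(V has_vector_derivative F t) (at t)"
      by (simp add: has_real_derivative_iff_has_vector_derivative)
  qed simp
  moreover have "V 1 = 0" "V (-1) = 0" using ab by (simp_all add: V_def)
  ultimately have "integral {-1..1} F = 0" by (simp add: has_integral_iff)
  moreover have "integral {-1..1} F = integral {-1..1} (\<lambda>t. poly (?A p * q) t * ?w t) -
      integral {-1..1} (\<lambda>t. poly (p * ?A q) t * ?w t)"
    unfolding F_def poly_diff left_diff_distrib
    by (intro integral_diff poly_jacobi_weight_integrable ab)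
  ultimately show ?thesis by simp
qed

text \<open>The left side Q has degree below n, as the leading coefficients cancel, and by symmetry
  it is orthogonal to all polynomials of degree below n. Thus every P + c Q has the orthogonality of
  P, and a nonzero Q would contradict the uniqueness of the normalized Jacobi polynomial.\<close>

lemma jacobi_poly_ode:
  assumes ab: "\<alpha> > -1" "\<beta> > -1"
  shows "jacobi_op \<alpha> \<beta> (jacobi_poly \<alpha> \<beta> n) +
    smult (real n * (real n + \<alpha> + \<beta> + 1)) (jacobi_poly \<alpha> \<beta> n) = 0"
proof (rule ccontr)
  define P where "P = jacobi_poly \<alpha> \<beta> n"
  define lam where "lam = real n * (real n + \<alpha> + \<beta> + 1)"
  define Q where "Q = jacobi_op \<alpha> \<beta> P + smult lam P"
  let ?I = "\<lambda>p. integral {-1..1} (\<lambda>t. poly p t * jacobi_weight \<alpha> \<beta> t)"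
  assume "\<not> ?thesis"
  then have Q0: "Q \<noteq> 0" by (simp add: Q_def P_def lam_def)
  have P: "is_jacobi_poly \<alpha> \<beta> n P" unfolding P_def by (rule jacobi_poly_correct[OF ab])
  then have dP: "degree P = n" and P1: "poly P 1 = (real n + \<alpha>) gchoose n"
    and orthP: "\<And>q. degree q < n \<Longrightarrow> ?I (P * q) = 0"
    by (auto simp: is_jacobi_poly_def)
  have P1': "poly P 1 \<noteq> 0"
    unfolding P1 using ab by (simp add: gbinomial_pochhammer' pochhammer_pos less_imp_neq[symmetric])
  have "degree Q \<le> n" unfolding Q_def
    using degree_jacobi_op_le[of \<alpha> \<beta> P] dP by (intro degree_add_le order.trans[OF degree_smult_le]) auto
  moreover have "coeff Q n = 0"
    unfolding Q_def using coeff_jacobi_op[of P n \<alpha> \<beta>] dP by (simp add: lam_def)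
  ultimately have dQ: "degree Q < n"
    using Q0 by (metis le_neq_implies_less leading_coeff_0_iff)
  have Iadd: "?I (p + q) = ?I p + ?I q" for p q
    unfolding poly_add distrib_right by (intro integral_add poly_jacobi_weight_integrable ab)
  have Ismult: "?I (smult c p) = c * ?I p" for c p
    by (simp add: mult.assoc)
  have orthQ: "?I (Q * q) = 0" if "degree q < n" for q
  proof -
    have "?I (Q * q) = ?I (jacobi_op \<alpha> \<beta> P * q) + lam * ?I (P * q)"
      unfolding Q_def distrib_right Iadd mult_smult_left Ismult ..
    also have "?I (jacobi_op \<alpha> \<beta> P * q) = ?I (P * jacobi_op \<alpha> \<beta> q)"
      using jacobi_op_symmetric[OF ab, of P q] by simp
    also have "\<dots> = 0"
      by (rule orthP) (use that degree_jacobi_op_le[of \<alpha> \<beta> q] in simp)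
    also have "?I (P * q) = 0" by (rule orthP[OF that])
    finally show ?thesis by simp
  qed
  have *: "smult s (P + smult c Q) = P" if "s \<noteq> 0" "s * (poly P 1 + c * poly Q 1) = poly P 1" for s c
  proof -
    have "degree (P + smult c Q) = n"
      using dP dQ degree_smult_le[of c Q] by (subst degree_add_eq_left) auto
    then have "degree (smult s (P + smult c Q)) = n" using that by simp
    moreover have "?I (smult s (P + smult c Q) * q) = 0" if "degree q < n" for q
      unfolding mult_smult_left Ismult distrib_right Iadd
      using orthP[OF that] orthQ[OF that] by simp
    ultimately have "is_jacobi_poly \<alpha> \<beta> n (smult s (P + smult c Q))"
      using that P1 unfolding is_jacobi_poly_def poly_mult[symmetric] by simp
    then show ?thesis using P ex1_is_jacobi_poly[OF ab, of n] by blast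
  qed
  show False
  proof (cases "poly Q 1 = 0")
    case True
    then have "smult 1 (P + smult 1 Q) = P" by (intro *) auto
    then show False using Q0 by simp
  next
    case False
    \<comment> \<open>With this c the value at 1 doubles, so halving P + c Q restores the
      normalization but halves the leading coefficient of P.\<close>
    define c where "c = poly P 1 / poly Q 1"
    have c: "c \<noteq> 0" "c * poly Q 1 = poly P 1" using False P1' by (auto simp: c_def)
    have "smult (1 / 2) (P + smult c Q) = P" by (rule *) (use c in auto)
    then have "coeff (smult (1 / 2) (P + smult c Q)) n = coeff P n" by simp
    moreover have "coeff Q n = 0" using dQ by (rule coeff_eq_0)
    ultimately have "coeff P n = 0" by simp
    then show False using dP dQ by (metis leading_coeff_0_iff degree_0 not_less0)
  qed
qed

section \<open>Energy estimates\<close>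

text \<open>Two-sided Gronwall inequality: h exp(-k) is nonincreasing and h exp(k) is
  nondecreasing.\<close>

lemma abs_derivative_le_imp_exp_bounds:
  fixes h h' k k' :: "real \<Rightarrow> real"
  assumes "a \<le> b"
    and h: "\<And>x. x \<in> {a..b} \<Longrightarrow> (h has_real_derivative h' x) (at x)"
    and k: "\<And>x. x \<in> {a..b} \<Longrightarrow> (k has_real_derivative k' x) (at x)"
    and le: "\<And>x. x \<in> {a..b} \<Longrightarrow> \<bar>h' x\<bar> \<le> k' x * h x"
  shows "h b \<le> h a * exp (k b - k a)" and "h a \<le> h b * exp (k b - k a)"
proof -
  have "h b * exp (- k b) \<le> h a * exp (- k a)"
  proof (rule DERIV_nonpos_imp_nonincreasing[OF \<open>a \<le> b\<close>])
    fix x assume "a \<le> x" "x \<le> b"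
    then have x: "x \<in> {a..b}" by simp
    have "((\<lambda>x. h x * exp (- k x)) has_real_derivative (h' x - k' x * h x) * exp (- k x)) (at x)"
      by (auto intro!: derivative_eq_intros h[OF x] k[OF x] simp: algebra_simps)
    moreover have "(h' x - k' x * h x) * exp (- k x) \<le> 0"
      using le[OF x] by (intro mult_nonpos_nonneg) auto
    ultimately show "\<exists>y. ((\<lambda>x. h x * exp (- k x)) has_real_derivative y) (at x) \<and> y \<le> 0" by blast
  qed
  then have "h b * exp (- k b) * exp (k b) \<le> h a * exp (- k a) * exp (k b)"
    by (rule mult_right_mono) simp
  then show "h b \<le> h a * exp (k b - k a)"
    by (simp add: exp_minus exp_diff field_simps)
  have "h a * exp (k a) \<le> h b * exp (k b)"
  proof (rule DERIV_nonneg_imp_nondecreasing[OF \<open>a \<le> b\<close>])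
    fix x assume "a \<le> x" "x \<le> b"
    then have x: "x \<in> {a..b}" by simp
    have "((\<lambda>x. h x * exp (k x)) has_real_derivative (h' x + k' x * h x) * exp (k x)) (at x)"
      by (auto intro!: derivative_eq_intros h[OF x] k[OF x] simp: algebra_simps)
    moreover have "(h' x + k' x * h x) * exp (k x) \<ge> 0"
      using le[OF x] by (intro mult_nonneg_nonneg) auto
    ultimately show "\<exists>y. ((\<lambda>x. h x * exp (k x)) has_real_derivative y) (at x) \<and> 0 \<le> y" by blast
  qed
  then have "h a * exp (k a) * exp (- k a) \<le> h b * exp (k b) * exp (- k a)"
    by (rule mult_right_mono) simp
  then show "h a \<le> h b * exp (k b - k a)"
    by (simp add: exp_minus exp_diff field_simps)
qed

lemma sin_ge_half:
  assumes "0 \<le> x" "x \<le> pi / 2"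
  shows "sin x \<ge> x / (2::real)"
proof (cases "x \<le> pi / 3")
  case True
  have "sin 0 - 0 / 2 \<le> sin x - x / 2"
  proof (rule DERIV_nonneg_imp_nondecreasing[OF assms(1)])
    fix y assume "0 \<le> y" "y \<le> x"
    then have "cos (pi / 3) \<le> cos y" using True pi_gt_zero by (intro cos_monotone_0_pi_le) auto
    then have "cos y - 1 / 2 \<ge> 0" by (simp add: cos_60)
    moreover have "((\<lambda>x. sin x - x / 2) has_real_derivative (cos y - 1 / 2)) (at y)"
      by (auto intro!: derivative_eq_intros)
    ultimately show "\<exists>z. ((\<lambda>x. sin x - x / 2) has_real_derivative z) (at y) \<and> 0 \<le> z" by blast
  qed
  then show ?thesis by simp
next
  case False
  have "sin (pi / 3) \<le> sin x"
    using False assms by (intro sin_monotone_2pi_le) auto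
  moreover have "sin (pi / 3) = sqrt 3 / 2" by (rule sin_60)
  moreover have "x / 2 \<le> 4 / 5" using assms pi_less_4 pi_approx by auto
  moreover have "4 / 5 \<le> sqrt 3 / 2"
  proof -
    have "8 / 5 \<le> sqrt 3" by (rule real_le_rsqrt) (simp add: power2_eq_square)
    then show ?thesis by simp
  qed
  ultimately show ?thesis by linarith
qed

section \<open>The Jacobi equation in the angle variable\<close>

definition jacobi_sol :: "real \<Rightarrow> real \<Rightarrow> real \<Rightarrow> real poly \<Rightarrow> bool" where
  "jacobi_sol \<alpha> \<beta> s p \<longleftrightarrow> (\<forall>x. (1 - x\<^sup>2) * poly (pderiv (pderiv p)) x +
     (\<beta> - \<alpha> - (\<alpha> + \<beta> + 2) * x) * poly (pderiv p) x + s\<^sup>2 * poly p x = 0)"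

definition trig_deriv :: "real poly \<Rightarrow> real \<Rightarrow> real" where
  "trig_deriv p t = - sin t * poly (pderiv p) (cos t)"

definition energy :: "real \<Rightarrow> real poly \<Rightarrow> real \<Rightarrow> real" where
  "energy s p t = (s * poly p (cos t))\<^sup>2 + (trig_deriv p t)\<^sup>2"

definition trig_weight :: "real \<Rightarrow> real \<Rightarrow> real \<Rightarrow> real" where
  "trig_weight \<alpha> \<beta> t = (1 - cos t) powr (\<alpha> + 1/2) * (1 + cos t) powr (\<beta> + 1/2)"

text \<open>For u(t) = p(cos t) the equation reads u'' + drift u' + s^2 u = 0, and the same function
  is the logarithmic derivative of \<open>trig_weight\<close>; this is why the energy is weighted in
  that way.\<close>

definition drift :: "real \<Rightarrow> real \<Rightarrow> real \<Rightarrow> real" where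
  "drift \<alpha> \<beta> t = (\<alpha> - \<beta> + (\<alpha> + \<beta> + 1) * cos t) / sin t"

text \<open>One constant that bounds both |drift| sin t and |drift'| (sin t)^2; the summand 1 keeps
  it away from 0, so that one may divide by it and compare s with it.\<close>

definition drift_bound :: "real \<Rightarrow> real \<Rightarrow> real" where
  "drift_bound \<alpha> \<beta> = \<bar>\<alpha> - \<beta>\<bar> + \<bar>\<alpha> + \<beta> + 1\<bar> + 1"

lemma drift_bound_ge_1: "drift_bound \<alpha> \<beta> \<ge> 1"
  by (simp add: drift_bound_def)

lemma abs_cos_combination_le: "\<bar>a + b * cos t\<bar> \<le> \<bar>a\<bar> + \<bar>b\<bar>" for a b t :: real
proof -
  have "\<bar>b * cos t\<bar> \<le> \<bar>b\<bar> * 1" unfolding abs_mult by (intro mult_left_mono) auto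
  then show ?thesis by linarith
qed

lemma abs_drift_le:
  assumes "0 < t" "t < pi"
  shows "\<bar>drift \<alpha> \<beta> t\<bar> \<le> drift_bound \<alpha> \<beta> / sin t"
  using sin_gt_zero[OF assms] abs_cos_combination_le[of "\<alpha> - \<beta>" "\<alpha> + \<beta> + 1" t]
  by (simp add: drift_def drift_bound_def abs_divide divide_right_mono)

lemma cos_in_open:
  assumes "0 < t" "t < pi"
  shows "1 - cos t > 0" "1 + cos t > 0"
  using cos_monotone_0_pi[of 0 t] cos_monotone_0_pi[of t pi] assms by auto

lemma trig_weight_pos: "0 < t \<Longrightarrow> t < pi \<Longrightarrow> trig_weight \<alpha> \<beta> t > 0"
  using cos_in_open[of t] by (simp add: trig_weight_def)

lemma energy_nonneg: "energy s p t \<ge> 0"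
  by (simp add: energy_def)

lemma has_derivative_poly_cos:
  "((\<lambda>t. poly p (cos t)) has_real_derivative trig_deriv p t) (at t)"
proof -
  have "((\<lambda>t. poly p (cos t)) has_real_derivative (poly (pderiv p) (cos t) * (- sin t))) (at t)"
    by (rule DERIV_chain2[OF poly_DERIV DERIV_cos])
  then show ?thesis by (simp add: trig_deriv_def mult.commute)
qed

lemma has_derivative_trig_deriv:
  assumes "jacobi_sol \<alpha> \<beta> s p" "0 < t" "t < pi"
  shows "(trig_deriv p has_real_derivative
    (- drift \<alpha> \<beta> t * trig_deriv p t - s\<^sup>2 * poly p (cos t))) (at t)"
proof -
  have sin: "sin t \<noteq> 0" using sin_gt_zero[OF assms(2,3)] by simp
  have "((\<lambda>t. poly (pderiv p) (cos t)) has_real_derivative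
      (poly (pderiv (pderiv p)) (cos t) * (- sin t))) (at t)"
    by (rule DERIV_chain2[OF poly_DERIV DERIV_cos])
  then have 1: "(trig_deriv p has_real_derivative
      - cos t * poly (pderiv p) (cos t) + (sin t)\<^sup>2 * poly (pderiv (pderiv p)) (cos t)) (at t)"
    unfolding trig_deriv_def
    by (auto intro!: derivative_eq_intros simp: power2_eq_square algebra_simps)
  have "(sin t)\<^sup>2 * poly (pderiv (pderiv p)) (cos t) =
      - (\<beta> - \<alpha> - (\<alpha> + \<beta> + 2) * cos t) * poly (pderiv p) (cos t) - s\<^sup>2 * poly p (cos t)"
    using assms(1)[unfolded jacobi_sol_def, rule_format, of "cos t"]
    by (simp add: sin_squared_eq algebra_simps)
  moreover have "- drift \<alpha> \<beta> t * trig_deriv p t =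
      (\<alpha> - \<beta> + (\<alpha> + \<beta> + 1) * cos t) * poly (pderiv p) (cos t)"
    using sin by (simp add: drift_def trig_deriv_def)
  ultimately have "- drift \<alpha> \<beta> t * trig_deriv p t - s\<^sup>2 * poly p (cos t) =
      - cos t * poly (pderiv p) (cos t) + (sin t)\<^sup>2 * poly (pderiv (pderiv p)) (cos t)"
    by (simp only:) (simp add: algebra_simps)
  with 1 show ?thesis by (simp only:)
qed

lemma has_derivative_trig_weight:
  assumes "0 < t" "t < pi"
  shows "(trig_weight \<alpha> \<beta> has_real_derivative drift \<alpha> \<beta> t * trig_weight \<alpha> \<beta> t) (at t)"
proof -
  note pos = cos_in_open[OF assms]
  have s: "sin t > 0" by (rule sin_gt_zero[OF assms])
  have sq: "(1 - cos t) * (1 + cos t) = sin t * sin t"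
    using sin_cos_squared_add2[of t] by (simp add: power2_eq_square algebra_simps)
  let ?u = "1 - cos t" and ?v = "1 + cos t"
  have "(trig_weight \<alpha> \<beta> has_real_derivative
      (\<alpha> + 1/2) * sin t * ?u powr (\<alpha> + 1/2 - 1) * ?v powr (\<beta> + 1/2) +
      ?u powr (\<alpha> + 1/2) * ((\<beta> + 1/2) * (- sin t) * ?v powr (\<beta> + 1/2 - 1))) (at t)"
    unfolding trig_weight_def using pos
    by (auto intro!: derivative_eq_intros simp: algebra_simps)
  also have "(\<alpha> + 1/2) * sin t * ?u powr (\<alpha> + 1/2 - 1) * ?v powr (\<beta> + 1/2) +
      ?u powr (\<alpha> + 1/2) * ((\<beta> + 1/2) * (- sin t) * ?v powr (\<beta> + 1/2 - 1)) =
      ((\<alpha> + 1/2) * sin t / ?u - (\<beta> + 1/2) * sin t / ?v) * trig_weight \<alpha> \<beta> t"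
  proof -
    have "?u powr (\<alpha> + 1/2 - 1) = ?u powr (\<alpha> + 1/2) / ?u" "?v powr (\<beta> + 1/2 - 1) = ?v powr (\<beta> + 1/2) / ?v"
      using pos by (simp_all only: powr_diff powr_one)
    moreover have "k * s * (X / u) * Y + X * (l * (- s) * (Y / v)) = (k * s / u - l * s / v) * (X * Y)"
      for k s X u Y l v :: real by (simp add: divide_inverse algebra_simps)
    ultimately show ?thesis unfolding trig_weight_def by simp
  qed
  also have "(\<alpha> + 1/2) * sin t / ?u - (\<beta> + 1/2) * sin t / ?v = drift \<alpha> \<beta> t"
  proof -
    have "sin t / ?u = ?v / sin t" "sin t / ?v = ?u / sin t"
      using pos s sq by (simp_all add: field_simps)
    moreover have "((\<alpha> + 1/2) * ?v - (\<beta> + 1/2) * ?u) / sin t = drift \<alpha> \<beta> t"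
      unfolding drift_def by (rule arg_cong[where f = "\<lambda>x. x / sin t"]) (simp add: field_simps)
    ultimately show ?thesis
      by (simp only: diff_divide_distrib times_divide_eq_right[symmetric])
  qed
  finally show ?thesis .
qed

lemma has_derivative_drift:
  assumes "0 < t" "t < pi"
  shows "(drift \<alpha> \<beta> has_real_derivative - ((\<alpha> + \<beta> + 1) + (\<alpha> - \<beta>) * cos t) / (sin t)\<^sup>2) (at t)"
proof -
  have s: "sin t \<noteq> 0" using sin_gt_zero[OF assms] by simp
  have "(drift \<alpha> \<beta> has_real_derivative
      ((\<alpha> + \<beta> + 1) * (- sin t) * sin t - (\<alpha> - \<beta> + (\<alpha> + \<beta> + 1) * cos t) * cos t) / (sin t * sin t)) (at t)"
    unfolding drift_def using s by (auto intro!: derivative_eq_intros)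
  also have "(\<alpha> + \<beta> + 1) * (- sin t) * sin t - (\<alpha> - \<beta> + (\<alpha> + \<beta> + 1) * cos t) * cos t =
     - (\<alpha> + \<beta> + 1) * ((sin t)\<^sup>2 + (cos t)\<^sup>2) - (\<alpha> - \<beta>) * cos t"
  proof -
    have "k * (- s) * s - (l + k * t) * t = - k * (s\<^sup>2 + t\<^sup>2) - l * t" for k l s t :: real
      by (simp add: power2_eq_square algebra_simps)
    then show ?thesis .
  qed
  also have "\<dots> = - ((\<alpha> + \<beta> + 1) + (\<alpha> - \<beta>) * cos t)"
    by (simp only: sin_cos_squared_add mult_1_right)
  finally show ?thesis by (simp only: power2_eq_square)
qed

lemma mult_le_half_energy:
  assumes "s > 0"
  shows "\<bar>poly p (cos t) * trig_deriv p t\<bar> \<le> energy s p t / (2 * s)"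
proof -
  let ?u = "poly p (cos t)" and ?q = "trig_deriv p t"
  have "0 \<le> (s * \<bar>?u\<bar> - \<bar>?q\<bar>)\<^sup>2" by simp
  also have "\<dots> = energy s p t - 2 * s * \<bar>?u * ?q\<bar>"
    using assms by (simp add: energy_def power2_diff power_mult_distrib abs_mult)
  finally show ?thesis using assms by (simp add: field_simps)
qed

text \<open>On the range where \<open>drift_bound \<alpha> \<beta> \<le> s * sin t\<close>, adding the cross term to the
  energy cancels the drift to first order: the logarithmic derivative of the weighted quantity
  is integrable there, uniformly in \<open>s\<close>.\<close>

lemma weighted_energy_middle:
  assumes sol: "jacobi_sol \<alpha> \<beta> s p" and s: "s > 0"
    and ab: "0 < a" "a \<le> b" "b \<le> pi / 2" and sin: "drift_bound \<alpha> \<beta> \<le> s * sin a"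
  defines "h \<equiv> \<lambda>t. trig_weight \<alpha> \<beta> t * energy s p t"
  shows "h b \<le> 3 * exp 2 * h a" "h a \<le> 3 * exp 2 * h b"
proof -
  define B where "B = drift_bound \<alpha> \<beta>"
  have B: "B \<ge> 1" unfolding B_def by (rule drift_bound_ge_1)
  define u where "u = (\<lambda>t. poly p (cos t))"
  define q where "q = trig_deriv p"
  define w where "w = trig_weight \<alpha> \<beta>"
  define d where "d = drift \<alpha> \<beta>"
  define d' where "d' = (\<lambda>t. - ((\<alpha> + \<beta> + 1) + (\<alpha> - \<beta>) * cos t) / (sin t)\<^sup>2)"
  define G where "G = (\<lambda>t. (s * u t)\<^sup>2 + (q t)\<^sup>2 + d t * u t * q t)"
  have x01: "0 < x" "x < pi" if "x \<in> {a..b}" for x using that ab pi_gt_zero by auto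
  have Bx: "B \<le> s * sin x" if "x \<in> {a..b}" for x
  proof -
    have "sin a \<le> sin x" using that ab by (intro sin_monotone_2pi_le) auto
    then have "s * sin a \<le> s * sin x" using s by simp
    then show ?thesis using sin by (simp add: B_def)
  qed
  have Gb: "energy s p t / 2 \<le> G t" "G t \<le> 3 / 2 * energy s p t"
    if t: "t \<in> {a..b}" for t
  proof -
    have sp: "sin t > 0" by (rule sin_gt_zero[OF x01[OF t]])
    have "\<bar>d t\<bar> \<le> B / sin t" unfolding d_def B_def by (rule abs_drift_le[OF x01[OF t]])
    also have "\<dots> \<le> s" using Bx[OF t] sp by (simp add: field_simps)
    finally have "\<bar>d t\<bar> * \<bar>u t * q t\<bar> \<le> s * (energy s p t / (2 * s))"
      using mult_le_half_energy[OF s, of p t] s by (intro mult_mono) (auto simp: u_def q_def)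
    then have "\<bar>d t * u t * q t\<bar> \<le> energy s p t / 2"
      using s by (simp add: abs_mult mult.assoc)
    moreover have "G t = energy s p t + d t * u t * q t"
      by (simp add: G_def energy_def u_def q_def)
    ultimately show "energy s p t / 2 \<le> G t" "G t \<le> 3 / 2 * energy s p t" by linarith+
  qed
  \<comment> \<open>All terms in d and d^2 cancel exactly between the weight, the energy and the
    cross term; only the derivative of the drift survives.\<close>
  have dh: "((\<lambda>x. w x * G x) has_real_derivative w x * d' x * u x * q x) (at x)" if "x \<in> {a..b}" for x
  proof -
    note x = x01[OF that]
    have dw: "(w has_real_derivative d x * w x) (at x)"
      unfolding w_def d_def by (rule has_derivative_trig_weight[OF x])
    have du: "(u has_real_derivative q x) (at x)"
      unfolding u_def q_def by (rule has_derivative_poly_cos)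
    have dq: "(q has_real_derivative (- d x * q x - s\<^sup>2 * u x)) (at x)"
      unfolding q_def d_def u_def by (rule has_derivative_trig_deriv[OF sol x])
    have dd: "(d has_real_derivative d' x) (at x)"
      unfolding d_def d'_def by (rule has_derivative_drift[OF x])
    show ?thesis unfolding G_def
      by (rule derivative_eq_intros dw du dq dd refl)+
        (simp add: power2_eq_square algebra_simps)
  qed
  \<comment> \<open>The antiderivative of the majorant. Where B \<le> s sin x it has absolute value
    at most 1, which gives the factor exp 2.\<close>
  have dk: "((\<lambda>x. - (B / s) * cot x) has_real_derivative (B / s) / (sin x)\<^sup>2) (at x)" if "x \<in> {a..b}" for x
  proof -
    have "sin x \<noteq> 0" using sin_gt_zero[OF x01[OF that]] by simp
    from DERIV_cmult[OF DERIV_cot[OF this], of "- (B / s)"]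
    show ?thesis by (simp add: divide_inverse)
  qed
  have le: "\<bar>w x * d' x * u x * q x\<bar> \<le> (B / s) / (sin x)\<^sup>2 * (w x * G x)" if "x \<in> {a..b}" for x
  proof -
    note x = x01[OF that]
    have wp: "w x > 0" unfolding w_def by (rule trig_weight_pos[OF x])
    have "\<bar>d' x\<bar> \<le> B / (sin x)\<^sup>2"
      unfolding d'_def B_def drift_bound_def abs_divide abs_minus_cancel
      using abs_cos_combination_le[of "\<alpha> + \<beta> + 1" "\<alpha> - \<beta>" x] by (simp add: divide_right_mono)
    moreover have "\<bar>u x * q x\<bar> \<le> G x / s"
    proof -
      have "\<bar>u x * q x\<bar> \<le> energy s p x / 2 / s"
        using mult_le_half_energy[OF s, of p x] by (simp add: u_def q_def)
      also have "\<dots> \<le> G x / s" using Gb(1)[OF that] s by (intro divide_right_mono) auto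
      finally show ?thesis .
    qed
    ultimately have "\<bar>d' x\<bar> * \<bar>u x * q x\<bar> \<le> B / (sin x)\<^sup>2 * (G x / s)"
      using B by (intro mult_mono) auto
    then have "w x * (\<bar>d' x\<bar> * \<bar>u x * q x\<bar>) \<le> w x * (B / (sin x)\<^sup>2 * (G x / s))"
      using wp by (intro mult_left_mono) auto
    then show ?thesis using wp by (simp add: abs_mult mult_ac)
  qed
  have cotb: "\<bar>B / s * cot x\<bar> \<le> 1" if "x \<in> {a..b}" for x
  proof -
    have sp: "sin x > 0" by (rule sin_gt_zero[OF x01[OF that]])
    have "\<bar>B / s * cot x\<bar> = B * \<bar>cos x\<bar> / (s * sin x)"
      using B s sp by (simp add: cot_def abs_mult)
    also have "\<dots> \<le> B * 1 / (s * sin x)" using B s sp by (intro divide_right_mono mult_left_mono) auto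
    also have "\<dots> \<le> 1" using Bx[OF that] s sp by simp
    finally show ?thesis .
  qed
  have e: "exp (- (B / s) * cot b - - (B / s) * cot a) \<le> exp 2"
  proof -
    have "\<bar>B / s * cot a\<bar> \<le> 1" "\<bar>B / s * cot b\<bar> \<le> 1" using cotb[of a] cotb[of b] ab by auto
    then have "- (B / s) * cot b - - (B / s) * cot a \<le> 2" unfolding minus_mult_left[symmetric] by linarith
    then show ?thesis by simp
  qed
  have hb: "h x / 2 \<le> w x * G x" "w x * G x \<le> 3 / 2 * h x" "0 \<le> w x * G x" if "x \<in> {a..b}" for x
  proof -
    have w: "w x > 0" unfolding w_def by (rule trig_weight_pos[OF x01[OF that]])
    show "h x / 2 \<le> w x * G x" "w x * G x \<le> 3 / 2 * h x"
      using mult_left_mono[OF Gb(1)[OF that], of "w x"] mult_left_mono[OF Gb(2)[OF that], of "w x"] w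
      by (simp_all add: h_def w_def)
    show "0 \<le> w x * G x" using w Gb(1)[OF that] energy_nonneg[of s p x] by simp
  qed
  note bounds = abs_derivative_le_imp_exp_bounds[OF ab(2) dh dk le]
  have "h y / 2 \<le> exp 2 * (3 / 2 * h x)"
    if "w y * G y \<le> w x * G x * exp (- (B / s) * cot b - - (B / s) * cot a)" "x \<in> {a..b}" "y \<in> {a..b}" for x y
  proof -
    have "h y / 2 \<le> w x * G x * exp 2"
      using hb(1)[OF that(3)] that(1) mult_left_mono[OF e hb(3)[OF that(2)]] by linarith
    also have "\<dots> \<le> (3 / 2 * h x) * exp 2" using hb(2)[OF that(2)] by (intro mult_right_mono) auto
    finally show ?thesis by (simp add: mult.commute)
  qed
  from this[of b a] this[of a b] bounds ab show "h b \<le> 3 * exp 2 * h a" "h a \<le> 3 * exp 2 * h b" by simp_all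
qed

text \<open>The logarithmic derivative of the weighted energy is at most a constant over sin t,
  hence a power of sin b / sin a bounds its change. This suffices close to the end point, where both
  sines are comparable to 1 / s.\<close>

lemma weighted_energy_crude:
  assumes sol: "jacobi_sol \<alpha> \<beta> s p"
    and ab: "0 < a" "a \<le> b" "b \<le> pi / 2"
  defines "h \<equiv> \<lambda>t. trig_weight \<alpha> \<beta> t * energy s p t"
    and "K \<equiv> (2 * sin b / sin a) powr (3 * drift_bound \<alpha> \<beta>)"
  shows "h b \<le> K * h a" "h a \<le> K * h b"
proof -
  define B where "B = drift_bound \<alpha> \<beta>"
  have B: "B \<ge> 1" unfolding B_def by (rule drift_bound_ge_1)
  \<comment> \<open>This is ln (tan (t / 2)), the antiderivative of 1 / sin t.\<close>
  define T where "T = (\<lambda>t::real. ln (sin t / (1 + cos t)))"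
  have x01: "0 < x" "x < pi" if "x \<in> {a..b}" for x using that ab pi_gt_zero by auto
  have dT: "((\<lambda>x. 3 * B * T x) has_real_derivative 3 * B / sin x) (at x)" if "x \<in> {a..b}" for x
  proof -
    note sp = sin_gt_zero[OF x01[OF that]] and cp = cos_in_open(2)[OF x01[OF that]]
    have "(T has_real_derivative
       ((cos x * (1 + cos x) - sin x * (- sin x)) / ((1 + cos x) * (1 + cos x))) / (sin x / (1 + cos x))) (at x)"
      unfolding T_def using sp cp by (auto intro!: derivative_eq_intros)
    also have "cos x * (1 + cos x) - sin x * (- sin x) = 1 + cos x"
      using sin_cos_squared_add[of x] by (simp add: power2_eq_square algebra_simps)
    also have "(1 + cos x) / ((1 + cos x) * (1 + cos x)) / (sin x / (1 + cos x)) = 1 / sin x"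
    proof -
      have "v / (v * v) / (s / v) = 1 / s" if "v > 0" "s > 0" for v s :: real using that by (simp add: field_simps)
      from this[OF cp sp] show ?thesis .
    qed
    finally show ?thesis using DERIV_cmult[of T "1 / sin x" x UNIV "3 * B"] by simp
  qed
  have dh: "(h has_real_derivative trig_weight \<alpha> \<beta> x *
      (drift \<alpha> \<beta> x * energy s p x - 2 * drift \<alpha> \<beta> x * (trig_deriv p x)\<^sup>2)) (at x)"
    if "x \<in> {a..b}" for x
    unfolding h_def energy_def
    by (rule derivative_eq_intros has_derivative_trig_weight has_derivative_poly_cos
        has_derivative_trig_deriv[OF sol] x01[OF that] refl)+
      (simp add: power2_eq_square algebra_simps)
  have le: "\<bar>trig_weight \<alpha> \<beta> x * (drift \<alpha> \<beta> x * energy s p x - 2 * drift \<alpha> \<beta> x * (trig_deriv p x)\<^sup>2)\<bar>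
      \<le> 3 * B / sin x * h x" if "x \<in> {a..b}" for x
  proof -
    note x = x01[OF that]
    have sp: "sin x > 0" by (rule sin_gt_zero[OF x])
    have w: "trig_weight \<alpha> \<beta> x > 0" by (rule trig_weight_pos[OF x])
    have en: "0 \<le> (trig_deriv p x)\<^sup>2" "(trig_deriv p x)\<^sup>2 \<le> energy s p x" by (auto simp: energy_def)
    have "\<bar>drift \<alpha> \<beta> x * energy s p x - 2 * drift \<alpha> \<beta> x * (trig_deriv p x)\<^sup>2\<bar> =
        \<bar>drift \<alpha> \<beta> x\<bar> * \<bar>energy s p x - 2 * (trig_deriv p x)\<^sup>2\<bar>"
      by (simp add: abs_mult[symmetric] algebra_simps)
    also have "\<dots> \<le> (B / sin x) * (3 * energy s p x)"
    proof (rule mult_mono)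
      show "\<bar>energy s p x - 2 * (trig_deriv p x)\<^sup>2\<bar> \<le> 3 * energy s p x" using en by linarith
    qed (use abs_drift_le[OF x, of \<alpha> \<beta>] B sp in \<open>simp_all add: B_def\<close>)
    finally have "trig_weight \<alpha> \<beta> x * \<bar>drift \<alpha> \<beta> x * energy s p x - 2 * drift \<alpha> \<beta> x * (trig_deriv p x)\<^sup>2\<bar>
        \<le> trig_weight \<alpha> \<beta> x * ((B / sin x) * (3 * energy s p x))"
      using w by (intro mult_left_mono) auto
    then show ?thesis using w by (simp add: h_def abs_mult mult_ac)
  qed
  note bounds = abs_derivative_le_imp_exp_bounds[OF ab(2) dh dT le]
  have "exp (3 * B * T b - 3 * B * T a) \<le> K"
  proof -
    have sa: "sin a > 0" and sb: "sin b > 0" using sin_gt_zero x01 ab by auto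
    have ca: "0 \<le> cos a" "cos a \<le> 1" "0 \<le> cos b" using ab by (auto intro!: cos_ge_zero)
    have "T b \<le> ln (sin b)" unfolding T_def using sb ca by (subst ln_le_cancel_iff) (auto simp: field_simps)
    moreover have "ln (sin a / 2) \<le> T a"
    proof -
      have "sin a / 2 \<le> sin a / (1 + cos a)" using sa ca by (intro divide_left_mono) auto
      then show ?thesis unfolding T_def using sa ca by (subst ln_le_cancel_iff) auto
    qed
    ultimately have "T b - T a \<le> ln (2 * sin b / sin a)"
      using sa sb by (simp add: ln_div ln_mult)
    then have "3 * B * (T b - T a) \<le> 3 * B * ln (2 * sin b / sin a)" using B by (intro mult_left_mono) auto
    then show ?thesis using sa sb by (simp add: K_def B_def powr_def algebra_simps)
  qed
  moreover have "h x \<ge> 0" if "x \<in> {a..b}" for x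
    using trig_weight_pos[OF x01[OF that], of \<alpha> \<beta>] energy_nonneg[of s p x] by (simp add: h_def)
  then have "h a \<ge> 0" "h b \<ge> 0" using ab by auto
  ultimately show "h b \<le> K * h a" "h a \<le> K * h b"
    using bounds mult_left_mono[of _ K "h a"] mult_left_mono[of _ K "h b"]
    by (metis mult.commute order.trans)+
qed

section \<open>Behaviour near the end point 1\<close>

definition endpoint_const :: "real \<Rightarrow> real \<Rightarrow> real" where
  "endpoint_const \<alpha> \<beta> = 2 powr \<bar>\<beta>\<bar> / (\<alpha> + 1)"

text \<open>For x < 1, Cauchy's mean value theorem is applied to the weighted derivative and to (1 -
  y)^(\<alpha> + 1), both 0 at y = 1. The singular factor (1 - z)^\<alpha> cancels from the quotient
  of derivatives, leaving s^2 (1 + z)^\<beta> p(z) / (\<alpha> + 1); \<open>endpoint_const\<close>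
  bounds the factors besides s^2 and p(z). At x = 1 the equation itself gives p'(1).\<close>

lemma jacobi_sol_deriv_near_1:
  assumes sol: "jacobi_sol \<alpha> \<beta> s p" and ab: "\<alpha> > -1" "\<beta> > -1" and s: "s > 0"
    and x: "0 \<le> x" "x \<le> 1" and M: "\<And>y. y \<in> {x..1} \<Longrightarrow> \<bar>poly p y\<bar> \<le> M"
  shows "\<bar>poly (pderiv p) x\<bar> \<le> s\<^sup>2 * endpoint_const \<alpha> \<beta> * M"
proof -
  define c where "c = s\<^sup>2"
  have c: "c > 0" using s by (simp add: c_def)
  note sol' = sol[unfolded jacobi_sol_def, folded c_def, rule_format]
  show ?thesis
  proof (cases "x = 1")
    case True
    have "2 * (\<alpha> + 1) * poly (pderiv p) 1 = c * poly p 1"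
      using sol'[of 1] by (simp add: algebra_simps)
    then have "poly (pderiv p) 1 = c * poly p 1 / (2 * (\<alpha> + 1))" using ab by (simp add: field_simps)
    then have "\<bar>poly (pderiv p) 1\<bar> = c * \<bar>poly p 1\<bar> / (2 * (\<alpha> + 1))" using ab c by (simp add: abs_mult)
    also have "\<dots> \<le> c * M / (2 * (\<alpha> + 1))"
      using M[of 1] x c ab by (intro divide_right_mono mult_left_mono) auto
    also have "\<dots> \<le> c * M * (2 powr \<bar>\<beta>\<bar> / (\<alpha> + 1))"
    proof -
      have "M \<ge> 0" using M[of 1] x by auto
      moreover have "1 / (2 * (\<alpha> + 1)) \<le> 2 powr \<bar>\<beta>\<bar> / (\<alpha> + 1)"
        using ab ge_one_powr_ge_zero[of 2 "\<bar>\<beta>\<bar>"] by (intro frac_le) auto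
      ultimately have "c * M * (1 / (2 * (\<alpha> + 1))) \<le> c * M * (2 powr \<bar>\<beta>\<bar> / (\<alpha> + 1))"
        using c by (intro mult_left_mono) auto
      then show ?thesis by simp
    qed
    finally show ?thesis using True by (simp add: endpoint_const_def c_def mult_ac)
  next
    case False
    then have x1: "x < 1" using x by simp
    let ?h = "\<lambda>y. (1 - y) powr (\<alpha> + 1)"
    let ?g = "\<lambda>y. (1 - y) powr (\<alpha> + 1) * (1 + y) powr (\<beta> + 1) * poly (pderiv p) y"
    \<comment> \<open>The auxiliary function of Cauchy's mean value theorem, in the form where both
      functions vanish at 1.\<close>
    define H where "H = (\<lambda>y. ?g y * ?h x - ?g x * ?h y)"
    have dh: "(?h has_real_derivative - ((\<alpha> + 1) * (1 - y) powr \<alpha>)) (at y)" if "x < y" "y < 1" for y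
      using that by (auto intro!: derivative_eq_intros)
    have dg: "(?g has_real_derivative - c * (1 - y) powr \<alpha> * (1 + y) powr \<beta> * poly p y) (at y)"
      if y: "x < y" "y < 1" for y
    proof -
      have "(?g has_real_derivative (1 - y) powr \<alpha> * (1 + y) powr \<beta> *
          ((1 - y\<^sup>2) * poly (pderiv (pderiv p)) y + (\<beta> - \<alpha> - (\<alpha> + \<beta> + 2) * y) * poly (pderiv p) y)) (at y)"
        by (rule has_derivative_weighted[OF poly_DERIV]) (use y x in auto)
      also have "(1 - y\<^sup>2) * poly (pderiv (pderiv p)) y +
          (\<beta> - \<alpha> - (\<alpha> + \<beta> + 2) * y) * poly (pderiv p) y = - c * poly p y"
        using sol'[of y] by linarith
      finally show ?thesis by (simp add: mult_ac)
    qed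
    have dH: "(H has_real_derivative (- c * (1 - y) powr \<alpha> * (1 + y) powr \<beta> * poly p y) * ?h x -
         ?g x * - ((\<alpha> + 1) * (1 - y) powr \<alpha>)) (at y)" if "x < y" "y < 1" for y
      unfolding H_def using DERIV_diff[OF DERIV_cmult_right[OF dg[OF that], of "?h x"] DERIV_cmult[OF dh[OF that], of "?g x"]] .
    have "\<exists>z. x < z \<and> z < 1 \<and> DERIV H z :> 0"
    proof (rule Rolle[OF x1])
      show "H x = H 1" using ab by (simp add: H_def)
      have c1: "continuous_on {x..1} ?h"
        by (rule continuous_on_powr') (use ab in \<open>auto intro!: continuous_intros\<close>)
      have c2: "continuous_on {x..1} (\<lambda>y. (1 + y) powr (\<beta> + 1))"
        by (rule continuous_on_powr') (use x in \<open>auto intro!: continuous_intros\<close>)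
      have c3: "continuous_on {x..1} (poly (pderiv p))" by (intro continuous_intros)
      show "continuous_on {x..1} H"
        unfolding H_def
        by (rule continuous_on_diff[OF continuous_on_mult_right[OF continuous_on_mult[OF continuous_on_mult[OF c1 c2] c3]]
              continuous_on_mult_left[OF c1]])
      show "H differentiable (at y)" if "x < y" "y < 1" for y
        unfolding real_differentiable_def by (rule exI, rule dH[OF that])
    qed
    then obtain z where z: "x < z" "z < 1" "DERIV H z :> 0" by blast
    define A where "A = (1 - z) powr \<alpha>"
    define X where "X = (1 - x) powr (\<alpha> + 1)"
    have pos: "A > 0" "X > 0" using z x1 by (auto simp: A_def X_def)
    have "(- c * A * (1 + z) powr \<beta> * poly p z) * X - X * (1 + x) powr (\<beta> + 1) * poly (pderiv p) x * - ((\<alpha> + 1) * A) = 0"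
      using DERIV_unique[OF z(3) dH[OF z(1,2)]] unfolding A_def X_def by (simp only:)
    then have "(A * X) * ((\<alpha> + 1) * ((1 + x) powr (\<beta> + 1) * poly (pderiv p) x)) = (A * X) * (c * ((1 + z) powr \<beta> * poly p z))"
      by (simp add: algebra_simps)
    then have "(\<alpha> + 1) * ((1 + x) powr (\<beta> + 1) * poly (pderiv p) x) = c * ((1 + z) powr \<beta> * poly p z)"
      using pos by simp
    then have "\<bar>(\<alpha> + 1) * ((1 + x) powr (\<beta> + 1) * poly (pderiv p) x)\<bar> = \<bar>c * ((1 + z) powr \<beta> * poly p z)\<bar>" by simp
    then have eq: "(\<alpha> + 1) * ((1 + x) powr (\<beta> + 1) * \<bar>poly (pderiv p) x\<bar>) = c * ((1 + z) powr \<beta> * \<bar>poly p z\<bar>)"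
      using ab c by (simp add: abs_mult)
    have "1 * \<bar>poly (pderiv p) x\<bar> \<le> (1 + x) powr (\<beta> + 1) * \<bar>poly (pderiv p) x\<bar>"
      using x ab by (intro mult_right_mono ge_one_powr_ge_zero) auto
    then have "(\<alpha> + 1) * \<bar>poly (pderiv p) x\<bar> \<le> c * ((1 + z) powr \<beta> * \<bar>poly p z\<bar>)"
      unfolding eq[symmetric] using ab by simp
    also have "\<dots> \<le> c * (2 powr \<bar>\<beta>\<bar> * M)"
    proof -
      have "(1 + z) powr \<beta> \<le> (1 + z) powr \<bar>\<beta>\<bar>" using z x by (intro powr_mono) auto
      also have "\<dots> \<le> 2 powr \<bar>\<beta>\<bar>" using z x by (intro powr_mono2) auto
      finally show ?thesis using M[of z] z c by (intro mult_left_mono mult_mono) auto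
    qed
    finally show ?thesis using ab by (simp add: endpoint_const_def c_def field_simps)
  qed
qed

text \<open>With M the maximum of |p| on [x0, 1], the derivative bound shows that p differs from
  p(1) by at most M / 4 there. Applied at the maximizer this gives M \<le> 4/3 |p(1)|.\<close>

lemma jacobi_sol_near_1:
  assumes sol: "jacobi_sol \<alpha> \<beta> s p" and ab: "\<alpha> > -1" "\<beta> > -1" and s: "s > 0"
    and x0: "0 \<le> x0" "x0 \<le> 1" and small: "(1 - x0) * (s\<^sup>2 * endpoint_const \<alpha> \<beta>) \<le> 1 / 4"
    and x: "x0 \<le> x" "x \<le> 1"
  shows "\<bar>poly p x - poly p 1\<bar> \<le> \<bar>poly p 1\<bar> / 3"
    and "\<bar>poly (pderiv p) x\<bar> \<le> s\<^sup>2 * endpoint_const \<alpha> \<beta> * (4 / 3 * \<bar>poly p 1\<bar>)"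
proof -
  define k where "k = s\<^sup>2 * endpoint_const \<alpha> \<beta>"
  have k: "k > 0" using s ab by (simp add: k_def endpoint_const_def)
  have "\<exists>z\<in>{x0..1}. \<forall>y\<in>{x0..1}. \<bar>poly p y\<bar> \<le> \<bar>poly p z\<bar>"
    using x0 by (intro continuous_attains_sup) (auto intro!: continuous_intros)
  then obtain z where z: "z \<in> {x0..1}" "\<And>y. y \<in> {x0..1} \<Longrightarrow> \<bar>poly p y\<bar> \<le> \<bar>poly p z\<bar>" by blast
  define M where "M = \<bar>poly p z\<bar>"
  have dM: "\<bar>poly (pderiv p) y\<bar> \<le> k * M" if "y \<in> {x0..1}" for y
    unfolding k_def using that x0 z
    by (intro jacobi_sol_deriv_near_1[OF sol ab s]) (auto simp: M_def)
  have diff: "\<bar>poly p y - poly p 1\<bar> \<le> M / 4" if y: "y \<in> {x0..1}" for y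
  proof -
    have "norm (poly p y - poly p 1) \<le> (k * M) * norm (y - 1)"
      by (rule field_differentiable_bound[of "{x0..1}"])
        (use y x0 dM in \<open>auto intro: has_field_derivative_at_within[OF poly_DERIV]\<close>)
    also have "\<dots> \<le> (k * M) * (1 - x0)" using y k by (intro mult_left_mono) (auto simp: M_def)
    also have "\<dots> = M * ((1 - x0) * k)" by simp
    also have "\<dots> \<le> M * (1 / 4)" using small by (intro mult_left_mono) (auto simp: M_def k_def)
    finally show ?thesis by simp
  qed
  have M: "M \<le> 4 / 3 * \<bar>poly p 1\<bar>" using diff[OF z(1)] unfolding M_def by linarith
  show "\<bar>poly p x - poly p 1\<bar> \<le> \<bar>poly p 1\<bar> / 3" using diff[of x] x M by auto
  have "\<bar>poly (pderiv p) x\<bar> \<le> k * M" using dM x by auto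
  also have "\<dots> \<le> k * (4 / 3 * \<bar>poly p 1\<bar>)" using M k by (intro mult_left_mono) auto
  finally show "\<bar>poly (pderiv p) x\<bar> \<le> s\<^sup>2 * endpoint_const \<alpha> \<beta> * (4 / 3 * \<bar>poly p 1\<bar>)" by (simp add: k_def)
qed

lemma one_minus_cos_le: "1 - cos x \<le> x\<^sup>2 / (2::real)"
proof -
  have "1 - cos x = 2 * (sin (x / 2))\<^sup>2" using cos_double_sin[of "x / 2"] by simp
  also have "\<dots> \<le> 2 * (x / 2)\<^sup>2"
    using abs_sin_x_le_abs_x[of "x / 2"] by (simp add: abs_le_square_iff[symmetric] del: power_divide)
  finally show ?thesis by (simp add: power_divide)
qed

lemma trig_weight_pi_half [simp]: "trig_weight \<alpha> \<beta> (pi / 2) = 1"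
  by (simp add: trig_weight_def)

text \<open>The constant \<open>energy s p (pi / 2)\<close> cancels in the ratios that occur in the Lagrange basis
  polynomials, so no normalisation of \<open>p\<close> matters.\<close>

definition half_bounds :: "real \<Rightarrow> real \<Rightarrow> real \<Rightarrow> real \<Rightarrow> real \<Rightarrow> real poly \<Rightarrow> bool" where
  "half_bounds \<alpha> \<beta> d K s p \<longleftrightarrow>
    (\<forall>t. d / s \<le> t \<and> t \<le> pi / 2 \<longrightarrow>
       trig_weight \<alpha> \<beta> t * energy s p t \<le> K * energy s p (pi / 2) \<and>
       energy s p (pi / 2) \<le> K * (trig_weight \<alpha> \<beta> t * energy s p t)) \<and>
    (\<forall>t. 0 \<le> t \<and> t \<le> d / s \<longrightarrow> trig_weight \<alpha> \<beta> (d / s) * energy s p t \<le> K * energy s p (pi / 2)) \<and>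
    (p \<noteq> 0 \<longrightarrow> (\<forall>t. 0 \<le> t \<and> t < 2 * d / s \<longrightarrow> poly p (cos t) \<noteq> 0))"

text \<open>The range [d / s, pi / 2] is split where s sin t equals the drift bound, into a part for
  the refined and a part for the crude energy estimate; below d / s the comparison of p with p(1)
  takes over. The condition on d makes that comparison valid up to 2 d / s, since 1 - cos (2 d / s)
  \<le> 2 d^2 / s^2.\<close>

lemma jacobi_sol_right_half:
  assumes ab: "\<alpha> > -1" "\<beta> > -1" and d: "d > 0" "8 * d\<^sup>2 * endpoint_const \<alpha> \<beta> \<le> 1"
  obtains K where "K \<ge> 1" "\<And>s p. jacobi_sol \<alpha> \<beta> s p \<Longrightarrow> drift_bound \<alpha> \<beta> \<le> s \<Longrightarrow>
    4 * d \<le> s * pi \<Longrightarrow> half_bounds \<alpha> \<beta> d K s p"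
proof -
  define B where "B = drift_bound \<alpha> \<beta>"
  define k where "k = endpoint_const \<alpha> \<beta>"
  have B: "B \<ge> 1" unfolding B_def by (rule drift_bound_ge_1)
  have k: "k > 0" using ab by (simp add: k_def endpoint_const_def)
  \<comment> \<open>On the crude part sin b = B / s and sin t \<ge> d / (2 s), so 2 sin b / sin t is
    at most 4 B / d.\<close>
  define L where "L = max 1 (4 * B / d) powr (3 * B)"
  have L: "L \<ge> 1" unfolding L_def using B by (intro ge_one_powr_ge_zero) auto
  define K1 where "K1 = L * (3 * exp 2)"
  have e: "3 * exp 2 \<ge> (1::real)" using exp_ge_add_one_self[of 2] by linarith
  have K1: "K1 \<ge> 1" unfolding K1_def using L e mult_mono[of 1 L 1 "3 * exp 2"] by simp
  \<comment> \<open>The 4 is (4/3)^2 / (2/3)^2, from |p| \<le> 4/3 |p(1)| at t and |p| \<ge> 2/3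
    |p(1)| at d / s; the second summand accounts for the derivative part of the energy.\<close>
  define K2 where "K2 = 4 * (1 + d\<^sup>2 * k\<^sup>2)"
  have K2: "K2 \<ge> 1" by (simp add: K2_def)
  have both: "trig_weight \<alpha> \<beta> t * energy s p t \<le> K1 * energy s p (pi / 2)"
     "energy s p (pi / 2) \<le> K1 * (trig_weight \<alpha> \<beta> t * energy s p t)"
    if sol: "jacobi_sol \<alpha> \<beta> s p" and s: "B \<le> s" "4 * d \<le> s * pi"
      and t: "d / s \<le> t" "t \<le> pi / 2" for s p t
  proof -
    define h where "h = (\<lambda>t. trig_weight \<alpha> \<beta> t * energy s p t)"
    have s0: "s > 0" using s B by simp
    have t0: "t > 0" using t d s0 by (meson divide_pos_pos less_le_trans)
    have tpi: "t < pi" using t pi_gt_zero by linarith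
    have hp: "h x \<ge> 0" if "0 < x" "x < pi" for x
      using trig_weight_pos[OF that, of \<alpha> \<beta>] energy_nonneg[of s p x] by (simp add: h_def)
    have mid: "h x \<le> 3 * exp 2 * h (pi / 2)" "h (pi / 2) \<le> 3 * exp 2 * h x"
      if "0 < x" "x \<le> pi / 2" "B \<le> s * sin x" for x
      using weighted_energy_middle[OF sol s0 that(1,2) order.refl] that(3) by (simp_all add: h_def B_def)
    have "h t \<le> K1 * h (pi / 2) \<and> h (pi / 2) \<le> K1 * h t"
    proof (cases "B \<le> s * sin t")
      case True
      have "h t \<le> 3 * exp 2 * h (pi / 2)" "h (pi / 2) \<le> 3 * exp 2 * h t"
        using mid[OF t0 t(2) True] by auto
      moreover have "3 * exp 2 * h x \<le> K1 * h x" if "0 < x" "x < pi" for x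
        unfolding K1_def using L hp[OF that] mult_right_mono[of 1 L "3 * exp 2"] by (intro mult_right_mono) auto
      from this[of t] this[of "pi / 2"] have "3 * exp 2 * h t \<le> K1 * h t" "3 * exp 2 * h (pi / 2) \<le> K1 * h (pi / 2)"
        using t0 tpi by auto
      ultimately show ?thesis by linarith
    next
      case False
      define b where "b = arcsin (B / s)"
      have Bs: "0 < B / s" "B / s \<le> 1" using s s0 B by auto
      have sb: "sin b = B / s" "b \<le> pi / 2" "b > 0"
        using Bs arcsin_bounded[of "B / s"] arcsin_less_arcsin[of 0 "B / s"] by (auto simp: b_def)
      have "s * sin t < s * sin b" using False sb s0 by simp
      then have st: "sin t < sin b" using s0 mult_less_cancel_left_pos by blast
      have tb: "t \<le> b"
      proof (rule ccontr)
        assume "\<not> t \<le> b"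
        then have "sin b \<le> sin t" using t sb pi_gt_zero by (intro sin_monotone_2pi_le) auto
        then show False using st by simp
      qed
      have stp: "sin t > 0" by (rule sin_gt_zero[OF t0 tpi])
      have "(2 * sin b / sin t) powr (3 * B) \<le> L"
      proof -
        have "t / 2 \<le> sin t" using t t0 by (intro sin_ge_half) auto
        moreover have "d / s / 2 \<le> t / 2" using t(1) by (rule divide_right_mono) simp
        ultimately have "sin t \<ge> d / s / 2" by (rule order.trans[rotated])
        then have "2 * sin b / sin t \<le> 2 * sin b / (d / s / 2)"
          using d s0 sb Bs stp by (intro divide_left_mono mult_pos_pos divide_pos_pos) auto
        also have "\<dots> = 4 * B / d" using sb s0 d by (simp add: field_simps)
        also have "\<dots> \<le> max 1 (4 * B / d)" by simp
        finally show ?thesis unfolding L_def using B stp sb Bs s0 by (intro powr_mono2) auto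
      qed
      moreover have "h b \<le> (2 * sin b / sin t) powr (3 * B) * h t"
        "h t \<le> (2 * sin b / sin t) powr (3 * B) * h b"
        using weighted_energy_crude[OF sol t0 tb sb(2)] by (simp_all add: h_def B_def)
      moreover have "h t \<ge> 0" "h b \<ge> 0" using hp t0 tpi sb by auto
      ultimately have 1: "h b \<le> L * h t" "h t \<le> L * h b"
        by (meson mult_right_mono order.trans)+
      have "s * sin b = B" using sb s0 by simp
      then have 2: "h b \<le> 3 * exp 2 * h (pi / 2)" "h (pi / 2) \<le> 3 * exp 2 * h b"
        using mid[OF sb(3,2)] by auto
      have "h t \<le> L * (3 * exp 2 * h (pi / 2))" by (rule order.trans[OF 1(2) mult_left_mono[OF 2(1)]]) (use L in simp)
      moreover have "h (pi / 2) \<le> 3 * exp 2 * (L * h t)"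
        by (rule order.trans[OF 2(2) mult_left_mono[OF 1(1)]]) simp
      ultimately show ?thesis by (simp add: K1_def mult_ac)
    qed
    then show "trig_weight \<alpha> \<beta> t * energy s p t \<le> K1 * energy s p (pi / 2)"
     "energy s p (pi / 2) \<le> K1 * (trig_weight \<alpha> \<beta> t * energy s p t)" by (simp_all add: h_def)
  qed
  have near: "\<bar>poly p (cos t) - poly p 1\<bar> \<le> \<bar>poly p 1\<bar> / 3"
     "\<bar>poly (pderiv p) (cos t)\<bar> \<le> s\<^sup>2 * k * (4 / 3 * \<bar>poly p 1\<bar>)"
    if sol: "jacobi_sol \<alpha> \<beta> s p" and s0: "s > 0" and s: "4 * d \<le> s * pi"
      and t: "0 \<le> t" "t \<le> 2 * d / s" for s p t
  proof -
    define x0 where "x0 = cos (2 * d / s)"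
    have tb: "0 \<le> 2 * d / s" "2 * d / s \<le> pi / 2" using s s0 d by (simp_all add: field_simps)
    have x0: "0 \<le> x0" "x0 \<le> 1" unfolding x0_def using tb by (auto intro!: cos_ge_zero)
    have "(1 - x0) * (s\<^sup>2 * k) \<le> (2 * d / s)\<^sup>2 / 2 * (s\<^sup>2 * k)"
      unfolding x0_def using k by (intro mult_right_mono one_minus_cos_le) auto
    also have "\<dots> = 2 * d\<^sup>2 * k" using s0 by (simp add: power_divide field_simps)
    also have "\<dots> \<le> 1 / 4" using d by (simp add: k_def)
    finally have small: "(1 - x0) * (s\<^sup>2 * endpoint_const \<alpha> \<beta>) \<le> 1 / 4" by (simp add: k_def)
    have "x0 \<le> cos t" unfolding x0_def using t tb pi_gt_zero by (intro cos_monotone_0_pi_le) auto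
    then show "\<bar>poly p (cos t) - poly p 1\<bar> \<le> \<bar>poly p 1\<bar> / 3"
     "\<bar>poly (pderiv p) (cos t)\<bar> \<le> s\<^sup>2 * k * (4 / 3 * \<bar>poly p 1\<bar>)"
      using jacobi_sol_near_1[OF sol ab s0 x0 small, of "cos t"] by (auto simp: k_def)
  qed
  show ?thesis
  proof (rule that[of "K2 * K1"])
    show "K2 * K1 \<ge> 1" using K1 K2 mult_mono[of 1 K2 1 K1] by simp
  next
    fix s p
    assume sol: "jacobi_sol \<alpha> \<beta> s p" and sB: "drift_bound \<alpha> \<beta> \<le> s" and sd: "4 * d \<le> s * pi"
    have sB': "B \<le> s" using sB by (simp add: B_def)
    have s0: "s > 0" using sB' B by simp
    note both = both[OF sol sB' sd] and near = near[OF sol s0 sd]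
    have K: "K1 * x \<le> K2 * K1 * x" if "x \<ge> 0" for x
      using K1 K2 that mult_right_mono[of 1 K2 "K1 * x"] by simp
    show "half_bounds \<alpha> \<beta> d (K2 * K1) s p"
      unfolding half_bounds_def
    proof (intro conjI allI impI; (elim conjE)?)
      fix t assume a: "d / s \<le> t" "t \<le> pi / 2"
      have "0 < t" "t < pi" using a d s0 pi_gt_zero by (meson divide_pos_pos less_le_trans, linarith)
      then have nn: "energy s p (pi / 2) \<ge> 0" "trig_weight \<alpha> \<beta> t * energy s p t \<ge> 0"
        using trig_weight_pos[of t \<alpha> \<beta>] energy_nonneg[of s p] by auto
      show "trig_weight \<alpha> \<beta> t * energy s p t \<le> K2 * K1 * energy s p (pi / 2)"
        by (rule order.trans[OF both(1)[OF a] K[OF nn(1)]])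
      show "energy s p (pi / 2) \<le> K2 * K1 * (trig_weight \<alpha> \<beta> t * energy s p t)"
        by (rule order.trans[OF both(2)[OF a] K[OF nn(2)]])
    next
      fix t assume a: "0 \<le> t" "t \<le> d / s"
      define b where "b = d / s"
      have b: "0 < b" "b \<le> pi / 2" "b \<le> 2 * d / s" "b < pi"
        using s0 d sd pi_gt_zero by (auto simp: b_def field_simps)
      define P where "P = \<bar>poly p 1\<bar>"
      have n1: "\<bar>poly p (cos t) - poly p 1\<bar> \<le> P / 3" "\<bar>poly (pderiv p) (cos t)\<bar> \<le> s\<^sup>2 * k * (4 / 3 * P)"
        using near[of t] a b unfolding P_def b_def by auto
      have n2: "\<bar>poly p (cos b) - poly p 1\<bar> \<le> P / 3"
        using near[of b] b unfolding P_def by auto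
      have "energy s p t \<le> (s * (4 / 3 * P))\<^sup>2 + (d / s * (s\<^sup>2 * k * (4 / 3 * P)))\<^sup>2"
        unfolding energy_def
      proof (intro add_mono)
        have "\<bar>poly p (cos t)\<bar> \<le> 4 / 3 * P" using n1(1) unfolding P_def by linarith
        then have "\<bar>s * poly p (cos t)\<bar> \<le> s * (4 / 3 * P)" using s0 by (simp add: abs_mult)
        then show "(s * poly p (cos t))\<^sup>2 \<le> (s * (4 / 3 * P))\<^sup>2" by (metis abs_ge_zero power2_abs power_mono)
        have "\<bar>sin t\<bar> \<le> d / s" using abs_sin_x_le_abs_x[of t] a by linarith
        then have "\<bar>trig_deriv p t\<bar> \<le> d / s * (s\<^sup>2 * k * (4 / 3 * P))"
          unfolding trig_deriv_def abs_mult abs_minus_cancel using n1(2) d s0 by (intro mult_mono) auto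
        then show "(trig_deriv p t)\<^sup>2 \<le> (d / s * (s\<^sup>2 * k * (4 / 3 * P)))\<^sup>2"
          by (metis abs_ge_zero power2_abs power_mono)
      qed
      also have "\<dots> = K2 * (s * (2 / 3 * P))\<^sup>2"
        using s0 by (simp add: K2_def power2_eq_square field_simps)
      also have "\<dots> \<le> K2 * energy s p b"
      proof -
        have "2 / 3 * P \<le> \<bar>poly p (cos b)\<bar>" using n2 unfolding P_def by linarith
        then have "s * (2 / 3 * P) \<le> \<bar>s * poly p (cos b)\<bar>" using s0 by (simp add: abs_mult)
        then have "(s * (2 / 3 * P))\<^sup>2 \<le> \<bar>s * poly p (cos b)\<bar>\<^sup>2"
          using s0 by (intro power_mono) (auto simp: P_def)
        then have "(s * (2 / 3 * P))\<^sup>2 \<le> energy s p b" by (simp add: energy_def add_increasing2)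
        then show ?thesis using K2 by simp
      qed
      finally have "trig_weight \<alpha> \<beta> b * energy s p t \<le> trig_weight \<alpha> \<beta> b * (K2 * energy s p b)"
        using trig_weight_pos[OF b(1,4), of \<alpha> \<beta>] by (intro mult_left_mono) auto
      also have "\<dots> = K2 * (trig_weight \<alpha> \<beta> b * energy s p b)" by simp
      also have "\<dots> \<le> K2 * (K1 * energy s p (pi / 2))"
        using both(1)[of b] b K2 by (intro mult_left_mono) (auto simp: b_def)
      finally show "trig_weight \<alpha> \<beta> (d / s) * energy s p t \<le> K2 * K1 * energy s p (pi / 2)"
        by (simp add: b_def mult.assoc)
    next
      fix t assume nz: "p \<noteq> 0" and a: "0 \<le> t" "t < 2 * d / s"
      show "poly p (cos t) \<noteq> 0"
      proof
        assume "poly p (cos t) = 0"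
        then have P1: "poly p 1 = 0" using near(1)[of t] a by simp
        define b where "b = 2 * d / s"
        have b: "0 < b" "b \<le> pi / 2" using d s0 sd by (auto simp: b_def field_simps)
        \<comment> \<open>Because the comparison is relative to |p(1)|, the value p(1) = 0 makes p
          vanish on a whole interval.\<close>
        have "poly p x = 0" if "x \<in> {cos b..1}" for x
        proof -
          have "cos b \<ge> 0" using b by (intro cos_ge_zero) auto
          then have x: "-1 \<le> x" "x \<le> 1" using that by auto
          have "arccos x \<le> b" using that x b arccos_le_arccos[of "cos b" x] arccos_cos[of b] by auto
          moreover have "0 \<le> arccos x" using x by (rule arccos_lbound)
          ultimately show ?thesis using near(1)[of "arccos x"] P1 x by (simp add: b_def)
        qed
        then have "{cos b..1} \<subseteq> {x. poly p x = 0}" by auto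
        then have "finite {cos b..1}" using poly_roots_finite[OF nz] finite_subset by blast
        moreover have "cos b < 1" using cos_monotone_0_pi[of 0 b] b pi_gt_zero by simp
        ultimately show False using infinite_Icc by blast
      qed
    qed
  qed
qed

section \<open>Zeros and uniform bounds\<close>

text \<open>Pruefer angle: between zeros v = u' / (s u) satisfies the Riccati equation v' = - drift
  v - s - s v^2. With |drift| \<le> s, arctan v decreases at rate at least s / 2. Its range has
  length pi, so a zero-free interval is shorter than 2 pi / s.\<close>

lemma jacobi_sol_zero_in_interval:
  assumes sol: "jacobi_sol \<alpha> \<beta> s p" and s: "s > 0"
    and ab: "0 < a" "a \<le> b" "b < pi"
    and sin: "\<And>x. x \<in> {a..b} \<Longrightarrow> drift_bound \<alpha> \<beta> \<le> s * sin x"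
    and len: "b - a \<ge> 2 * pi / s"
  shows "\<exists>t\<in>{a..b}. poly p (cos t) = 0"
proof (rule ccontr)
  assume no: "\<not> ?thesis"
  define u where "u = (\<lambda>t. poly p (cos t))"
  define q where "q = trig_deriv p"
  define d where "d = drift \<alpha> \<beta>"
  define F where "F = (\<lambda>x. arctan (q x / (s * u x)) + s / 2 * x)"
  have "F b \<le> F a"
  proof (rule DERIV_nonpos_imp_nonincreasing[OF ab(2)])
    fix x assume "a \<le> x" "x \<le> b"
    then have xab: "x \<in> {a..b}" by simp
    then have x: "0 < x" "x < pi" using ab by auto
    have un: "u x \<noteq> 0" using no xab by (auto simp: u_def)
    have du: "(u has_real_derivative q x) (at x)"
      unfolding u_def q_def by (rule has_derivative_poly_cos)
    have dq: "(q has_real_derivative (- d x * q x - s\<^sup>2 * u x)) (at x)"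
      unfolding q_def d_def u_def by (rule has_derivative_trig_deriv[OF sol x])
    have sx: "sin x > 0" by (rule sin_gt_zero[OF x])
    have "\<bar>d x\<bar> \<le> drift_bound \<alpha> \<beta> / sin x" unfolding d_def by (rule abs_drift_le[OF x])
    also have "\<dots> \<le> s" using sin[OF xab] sx by (simp add: field_simps)
    finally have dx: "\<bar>d x\<bar> \<le> s" .
    define v where "v = q x / (s * u x)"
    have qv: "q x = v * s * u x" using un s by (simp add: v_def)
    have "((\<lambda>x. q x / (s * u x)) has_real_derivative
       ((- d x * q x - s\<^sup>2 * u x) * (s * u x) - q x * (s * q x)) / ((s * u x) * (s * u x))) (at x)"
      using un s by (auto intro!: derivative_eq_intros dq du)
    also have "((- d x * q x - s\<^sup>2 * u x) * (s * u x) - q x * (s * q x)) / ((s * u x) * (s * u x)) =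
       - d x * v - s - s * v\<^sup>2"
      using un s unfolding qv by (simp add: field_simps power2_eq_square)
    finally have dv: "((\<lambda>x. q x / (s * u x)) has_real_derivative (- d x * v - s - s * v\<^sup>2)) (at x)" .
    have "(F has_real_derivative (inverse (1 + v\<^sup>2) * (- d x * v - s - s * v\<^sup>2) + s / 2)) (at x)"
      unfolding F_def
      by (rule derivative_eq_intros DERIV_chain2[OF DERIV_arctan dv] refl)+ (simp add: v_def)
    moreover have "inverse (1 + v\<^sup>2) * (- d x * v - s - s * v\<^sup>2) + s / 2 \<le> 0"
    proof -
      have "0 \<le> (\<bar>v\<bar> - 1)\<^sup>2" by simp
      then have "2 * \<bar>v\<bar> \<le> 1 + v\<^sup>2" by (simp add: power2_diff)
      then have vv: "\<bar>v\<bar> \<le> (1 + v\<^sup>2) / 2" by simp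
      have "- d x * v \<le> \<bar>d x\<bar> * \<bar>v\<bar>" by (metis abs_ge_minus_self abs_mult minus_mult_left)
      also have "\<dots> \<le> s * ((1 + v\<^sup>2) / 2)" using dx vv s by (intro mult_mono) auto
      finally have "- d x * v - s - s * v\<^sup>2 \<le> (1 + v\<^sup>2) * (- s / 2)" by (simp add: algebra_simps)
      then have "inverse (1 + v\<^sup>2) * (- d x * v - s - s * v\<^sup>2) \<le> inverse (1 + v\<^sup>2) * ((1 + v\<^sup>2) * (- s / 2))"
        by (intro mult_left_mono) auto
      also have "\<dots> = - s / 2"
        using add_pos_nonneg[of 1 "v\<^sup>2"] by (simp add: mult.assoc[symmetric])
      finally show ?thesis by simp
    qed
    ultimately show "\<exists>y. (F has_real_derivative y) (at x) \<and> y \<le> 0" by blast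
  qed
  moreover have "F a < pi / 2 + s / 2 * a" "F b > - (pi / 2) + s / 2 * b"
    unfolding F_def using arctan_ubound arctan_lbound by auto
  ultimately have "s / 2 * b < pi + s / 2 * a" by linarith
  then have "s * (b - a) < 2 * pi" by (simp add: algebra_simps)
  moreover have "2 * pi \<le> s * (b - a)" using len s by (simp add: field_simps)
  ultimately show False by simp
qed

section \<open>Reflection, and bounds on the whole angular interval\<close>

definition poly_reflect :: "real poly \<Rightarrow> real poly" where
  "poly_reflect p = pcompose p [:0, -1:]"

lemma poly_reflect [simp]: "poly (poly_reflect p) x = poly p (- x)"
  by (simp add: poly_reflect_def poly_pcompose)

lemma pderiv_poly_reflect: "pderiv (poly_reflect p) = - poly_reflect (pderiv p)"
  by (simp add: poly_reflect_def pderiv_pcompose pderiv_pCons)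

lemma pderiv_pderiv_poly_reflect: "pderiv (pderiv (poly_reflect p)) = poly_reflect (pderiv (pderiv p))"
  by (simp add: pderiv_poly_reflect pderiv_minus)

lemma jacobi_sol_reflect: "jacobi_sol \<alpha> \<beta> s p \<Longrightarrow> jacobi_sol \<beta> \<alpha> s (poly_reflect p)"
  unfolding jacobi_sol_def
proof
  fix x assume *: "\<forall>x. (1 - x\<^sup>2) * poly (pderiv (pderiv p)) x +
     (\<beta> - \<alpha> - (\<alpha> + \<beta> + 2) * x) * poly (pderiv p) x + s\<^sup>2 * poly p x = 0"
  show "(1 - x\<^sup>2) * poly (pderiv (pderiv (poly_reflect p))) x +
     (\<alpha> - \<beta> - (\<beta> + \<alpha> + 2) * x) * poly (pderiv (poly_reflect p)) x + s\<^sup>2 * poly (poly_reflect p) x = 0"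
    unfolding pderiv_pderiv_poly_reflect unfolding pderiv_poly_reflect
    using *[rule_format, of "- x"] by (simp add: algebra_simps)
qed

lemma energy_reflect: "energy s (poly_reflect p) (pi - t) = energy s p t"
  by (simp add: energy_def trig_deriv_def pderiv_poly_reflect power_mult_distrib)

lemma trig_weight_reflect: "trig_weight \<beta> \<alpha> (pi - t) = trig_weight \<alpha> \<beta> t"
  by (simp add: trig_weight_def mult.commute)

lemma drift_bound_reflect: "drift_bound \<beta> \<alpha> = drift_bound \<alpha> \<beta>"
  by (simp add: drift_bound_def abs_minus_commute add.commute)

lemma poly_reflect_nonzero: "p \<noteq> 0 \<Longrightarrow> poly_reflect p \<noteq> 0"
  by (metis poly_reflect add.inverse_inverse poly_0 poly_all_0_iff_0)

text \<open>\<open>trig_weight\<close> degenerates at 0 and pi while the energy does not. Near the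
  end points the weight is therefore frozen at its value at distance e.\<close>

definition clip :: "real \<Rightarrow> real \<Rightarrow> real" where
  "clip e t = max e (min t (pi - e))"

definition full_bounds :: "real \<Rightarrow> real \<Rightarrow> real \<Rightarrow> real \<Rightarrow> real \<Rightarrow> real poly \<Rightarrow> bool" where
  "full_bounds \<alpha> \<beta> d K s p \<longleftrightarrow>
    (\<forall>t. d / s \<le> t \<and> t \<le> pi - d / s \<longrightarrow>
       energy s p (pi / 2) \<le> K * (trig_weight \<alpha> \<beta> t * energy s p t)) \<and>
    (\<forall>t. 0 \<le> t \<and> t \<le> pi \<longrightarrow>
       trig_weight \<alpha> \<beta> (clip (d / s) t) * energy s p t \<le> K * energy s p (pi / 2)) \<and>
    (p \<noteq> 0 \<longrightarrow> (\<forall>t. 0 \<le> t \<and> t \<le> pi \<and> poly p (cos t) = 0 \<longrightarrow>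
       2 * d / s \<le> t \<and> t \<le> pi - 2 * d / s)) \<and>
    (\<forall>a b. 0 \<le> a \<and> b \<le> pi \<and> b - a \<ge> K / s \<longrightarrow> (\<exists>t\<in>{a..b}. poly p (cos t) = 0))"

lemma jacobi_sol_bounds:
  assumes ab: "\<alpha> > -1" "\<beta> > -1"
  obtains d K s0 where "d > 0" "K \<ge> 1" "s0 \<ge> 1" "\<And>s. s0 \<le> s \<Longrightarrow> 4 * d / s \<le> pi"
    "\<And>s p. s0 \<le> s \<Longrightarrow> jacobi_sol \<alpha> \<beta> s p \<Longrightarrow> full_bounds \<alpha> \<beta> d K s p"
proof -
  define B where "B = drift_bound \<alpha> \<beta>"
  have B: "B \<ge> 1" unfolding B_def by (rule drift_bound_ge_1)
  define k where "k = max (endpoint_const \<alpha> \<beta>) (endpoint_const \<beta> \<alpha>)"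
  have k: "k > 0" using ab by (simp add: k_def endpoint_const_def less_max_iff_disj)
  \<comment> \<open>Chosen so that 8 d^2 k = 1, the smallness required at both end points with the
    larger of the two constants.\<close>
  define d where "d = 1 / sqrt (8 * k)"
  have d: "d > 0" using k by (simp add: d_def)
  have "8 * d\<^sup>2 * k = 1" using k by (simp add: d_def power_divide)
  moreover have "8 * d\<^sup>2 * endpoint_const \<alpha> \<beta> \<le> 8 * d\<^sup>2 * k" "8 * d\<^sup>2 * endpoint_const \<beta> \<alpha> \<le> 8 * d\<^sup>2 * k"
    by (intro mult_left_mono; simp add: k_def)+
  ultimately have dk: "8 * d\<^sup>2 * endpoint_const \<alpha> \<beta> \<le> 1" "8 * d\<^sup>2 * endpoint_const \<beta> \<alpha> \<le> 1" by auto
  obtain K1 where K1: "K1 \<ge> 1" and right: "\<And>s p. jacobi_sol \<alpha> \<beta> s p \<Longrightarrow> drift_bound \<alpha> \<beta> \<le> s \<Longrightarrow>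
      4 * d \<le> s * pi \<Longrightarrow> half_bounds \<alpha> \<beta> d K1 s p"
    by (rule jacobi_sol_right_half[OF ab d dk(1)]) blast
  obtain K2 where K2: "K2 \<ge> 1" and left: "\<And>s p. jacobi_sol \<beta> \<alpha> s p \<Longrightarrow> drift_bound \<beta> \<alpha> \<le> s \<Longrightarrow>
      4 * d \<le> s * pi \<Longrightarrow> half_bounds \<beta> \<alpha> d K2 s p"
    by (rule jacobi_sol_right_half[OF ab(2,1) d dk(2)]) blast
  define s0 where "s0 = max B (4 * d / pi)"
  \<comment> \<open>An interval of length K / s keeps length 2 pi / s after removal of 2 B / s at
    either end of [0, pi], and on the rest s sin x \<ge> B.\<close>
  define K where "K = max (max K1 K2) (2 * pi + 4 * B)"
  have K: "K1 \<le> K" "K2 \<le> K" "2 * pi + 4 * B \<le> K" by (auto simp: K_def)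
  have s0: "B \<le> s" "4 * d \<le> s * pi" if "s0 \<le> s" for s
    using that by (auto simp: s0_def field_simps)
  show ?thesis
  proof (rule that[of d K s0])
    show "d > 0" "K \<ge> 1" "s0 \<ge> 1" using d K1 K B by (auto simp: s0_def)
  next
    fix s assume "s0 \<le> s"
    then show "4 * d / s \<le> pi" using s0[of s] B by (simp add: field_simps)
  next
    fix s p assume "s0 \<le> s" and sol: "jacobi_sol \<alpha> \<beta> s p"
    note s = s0[OF this(1)]
    have sp: "s > 0" using s B by simp
    define A where "A = energy s p (pi / 2)"
    have R: "d / s \<le> t \<Longrightarrow> t \<le> pi / 2 \<Longrightarrow> trig_weight \<alpha> \<beta> t * energy s p t \<le> K1 * A"
      "d / s \<le> t \<Longrightarrow> t \<le> pi / 2 \<Longrightarrow> A \<le> K1 * (trig_weight \<alpha> \<beta> t * energy s p t)"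
      "0 \<le> t \<Longrightarrow> t \<le> d / s \<Longrightarrow> trig_weight \<alpha> \<beta> (d / s) * energy s p t \<le> K1 * A"
      "p \<noteq> 0 \<Longrightarrow> 0 \<le> t \<Longrightarrow> t < 2 * d / s \<Longrightarrow> poly p (cos t) \<noteq> 0" for t
      using right[OF sol] s unfolding half_bounds_def A_def B_def by blast+
    have "half_bounds \<beta> \<alpha> d K2 s (poly_reflect p)"
      by (rule left[OF jacobi_sol_reflect[OF sol]]) (use s in \<open>simp_all add: B_def drift_bound_reflect\<close>)
    moreover have "energy s (poly_reflect p) (pi / 2) = A" using energy_reflect[of s p "pi / 2"] by (simp add: A_def)
    moreover have "energy s (poly_reflect p) t = energy s p (pi - t)"
      "trig_weight \<beta> \<alpha> t = trig_weight \<alpha> \<beta> (pi - t)" for t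
      using energy_reflect[of s p "pi - t"] trig_weight_reflect[of \<beta> \<alpha> "pi - t"] by simp_all
    ultimately have L: "d / s \<le> t \<Longrightarrow> t \<le> pi / 2 \<Longrightarrow> trig_weight \<alpha> \<beta> (pi - t) * energy s p (pi - t) \<le> K2 * A"
      "d / s \<le> t \<Longrightarrow> t \<le> pi / 2 \<Longrightarrow> A \<le> K2 * (trig_weight \<alpha> \<beta> (pi - t) * energy s p (pi - t))"
      "0 \<le> t \<Longrightarrow> t \<le> d / s \<Longrightarrow> trig_weight \<alpha> \<beta> (pi - d / s) * energy s p (pi - t) \<le> K2 * A"
      "p \<noteq> 0 \<Longrightarrow> 0 \<le> t \<Longrightarrow> t < 2 * d / s \<Longrightarrow> poly p (- cos t) \<noteq> 0" for t
      unfolding half_bounds_def using poly_reflect_nonzero[of p] by simp_all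
    have mono: "x \<le> K * y" if "x \<le> K1 * y \<or> x \<le> K2 * y" "y \<ge> 0" for x y
      using that K(1,2) mult_right_mono[of K1 K y] mult_right_mono[of K2 K y] by linarith
    have A0: "A \<ge> 0" by (simp add: A_def energy_nonneg)
    have ds: "d / s \<le> pi / 2" "d / s > 0" using sp s d by (auto simp: field_simps)
    show "full_bounds \<alpha> \<beta> d K s p"
      unfolding full_bounds_def A_def[symmetric]
    proof (intro conjI allI impI; (elim conjE)?)
      fix t assume a: "d / s \<le> t" "t \<le> pi - d / s"
      have "trig_weight \<alpha> \<beta> t * energy s p t \<ge> 0"
        using energy_nonneg[of s p] by (simp add: trig_weight_def)
      then show "A \<le> K * (trig_weight \<alpha> \<beta> t * energy s p t)"
        using R(2)[of t] L(2)[of "pi - t"] a by (cases "t \<le> pi / 2"; intro mono) auto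
    next
      fix t assume a: "0 \<le> t" "t \<le> pi"
      consider "t \<le> d / s" | "d / s < t" "t \<le> pi / 2" | "pi / 2 < t" "t < pi - d / s" | "pi - d / s \<le> t" by linarith
      then show "trig_weight \<alpha> \<beta> (clip (d / s) t) * energy s p t \<le> K * A"
      proof cases
        case 1
        then have "clip (d / s) t = d / s" using ds unfolding clip_def by linarith
        then show ?thesis using R(3)[OF a(1) 1] A0 by (intro mono) auto
      next
        case 2
        then have "clip (d / s) t = t" using ds unfolding clip_def by linarith
        then show ?thesis using R(1)[of t] 2 A0 by (intro mono) auto
      next
        case 3
        then have "clip (d / s) t = t" using ds unfolding clip_def by linarith
        then show ?thesis using L(1)[of "pi - t"] 3 A0 by (intro mono) auto
      next
        case 4
        then have "clip (d / s) t = pi - d / s" using ds unfolding clip_def by linarith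
        then show ?thesis using L(3)[of "pi - t"] 4 a A0 by (intro mono) auto
      qed
    next
      fix t assume a: "p \<noteq> 0" "0 \<le> t" "t \<le> pi" "poly p (cos t) = 0"
      show "2 * d / s \<le> t" using R(4)[OF a(1,2)] a(4) by linarith
      have "\<not> pi - t < 2 * d / s" using L(4)[OF a(1), of "pi - t"] a by auto
      then show "t \<le> pi - 2 * d / s" by linarith
    next
      fix a b assume a: "0 \<le> a" "b \<le> pi" "b - a \<ge> K / s"
      define e where "e = 2 * B / s"
      have e: "e > 0" using sp B by (simp add: e_def)
      define a' where "a' = max a e"
      define b' where "b' = min b (pi - e)"
      have "(2 * pi + 4 * B) / s \<le> K / s" using K sp by (intro divide_right_mono) auto
      then have len: "b' - a' \<ge> 2 * pi / s"
        using a e unfolding a'_def b'_def e_def by (auto simp: add_divide_distrib max_def min_def)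
      moreover have "2 * pi / s > 0" using sp by simp
      ultimately have le: "a' \<le> b'" by linarith
      have "\<exists>t\<in>{a'..b'}. poly p (cos t) = 0"
      proof (rule jacobi_sol_zero_in_interval[OF sol sp _ le _ _ len])
        show "0 < a'" "b' < pi" using e by (auto simp: a'_def b'_def)
        fix x assume x: "x \<in> {a'..b'}"
        have "sin x \<ge> e / 2"
        proof (cases "x \<le> pi / 2")
          case True
          then show ?thesis using sin_ge_half[of x] x e by (auto simp: a'_def)
        next
          case False
          then have "sin (pi - x) \<ge> (pi - x) / 2" using x e by (intro sin_ge_half) (auto simp: b'_def)
          then show ?thesis using x by (auto simp: b'_def)
        qed
        then have "s * sin x \<ge> s * (e / 2)" using sp by (intro mult_left_mono) auto
        then show "drift_bound \<alpha> \<beta> \<le> s * sin x" using sp by (simp add: e_def B_def)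
      qed
      then show "\<exists>t\<in>{a..b}. poly p (cos t) = 0" by (auto simp: a'_def b'_def)
    qed
  qed
qed

section \<open>Lagrange basis polynomials\<close>

lemma jacobi_exponent_bounds:
  shows "jacobi_exponent \<alpha> \<beta> \<le> 0" "jacobi_exponent \<alpha> \<beta> \<le> 1/2 - \<alpha>" "jacobi_exponent \<alpha> \<beta> \<le> 5/2 - \<beta>"
    "\<beta> \<le> 1/2 \<Longrightarrow> jacobi_exponent \<alpha> \<beta> \<le> \<beta> - \<alpha>"
  by (auto simp: jacobi_exponent_def min_def)

text \<open>By the addition theorems the numerator exceeds the denominator by at most sin ((y - x) /
  2), and both denominators are at least d / (4 s). The distance of the angles thus controls the
  ratios of the weights.\<close>

lemma trig_half_ratio_le:
  assumes d: "d > 0" "s > 0" and xy: "x \<le> y" "d / s \<le> x" "y \<le> pi - d / s"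
  shows "sin (y / 2) / sin (x / 2) \<le> 1 + 4 * s * sin ((y - x) / 2) / d"
    and "cos (x / 2) / cos (y / 2) \<le> 1 + 4 * s * sin ((y - x) / 2) / d"
    and "sin (x / 2) > 0" "cos (y / 2) > 0" "sin (x / 2) \<le> sin (y / 2)" "cos (y / 2) \<le> cos (x / 2)"
proof -
  have e: "d / s > 0" using d by simp
  have x: "0 < x" "x \<le> pi" "0 < y" "y < pi" using xy e by linarith+
  define D where "D = sin ((y - x) / 2)"
  have D: "D \<ge> 0" unfolding D_def using x xy by (intro sin_ge_zero) auto
  have "(x / 2) / 2 \<le> sin (x / 2)" using x by (intro sin_ge_half) auto
  moreover have "d / s / 4 \<le> x / 4" using xy(2) by (rule divide_right_mono) simp
  ultimately have sx: "d / (4 * s) \<le> sin (x / 2)" by (simp add: mult.commute)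
  have "((pi - y) / 2) / 2 \<le> sin ((pi - y) / 2)" using x by (intro sin_ge_half) auto
  moreover have "sin ((pi - y) / 2) = cos (y / 2)" using sin_cos_eq[of "(pi - y) / 2"] by (simp add: field_simps)
  moreover have "d / s \<le> pi - y" using xy(3) by linarith
  then have "d / s / 4 \<le> (pi - y) / 4" by (rule divide_right_mono) simp
  ultimately have cy: "d / (4 * s) \<le> cos (y / 2)" by (simp add: mult.commute)
  have e4: "d / (4 * s) > 0" using d by simp
  show sp: "sin (x / 2) > 0" and cp: "cos (y / 2) > 0" using sx cy e4 by linarith+
  show "sin (x / 2) \<le> sin (y / 2)" using x xy by (intro sin_monotone_2pi_le) auto
  show "cos (y / 2) \<le> cos (x / 2)" using x xy by (intro cos_monotone_0_pi_le) auto
  have 1: "sin (y / 2) \<le> sin (x / 2) + D"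
  proof -
    have "sin (y / 2) = sin (x / 2 + (y - x) / 2)" by (simp add: field_simps)
    also have "\<dots> = sin (x / 2) * cos ((y - x) / 2) + cos (x / 2) * D" unfolding D_def by (rule sin_add)
    also have "\<dots> \<le> sin (x / 2) * 1 + 1 * D" using sp D by (intro add_mono mult_left_mono mult_right_mono) auto
    finally show ?thesis by simp
  qed
  have 2: "cos (x / 2) \<le> cos (y / 2) + D"
  proof -
    have "cos (x / 2) = cos (y / 2 - (y - x) / 2)" by (simp add: field_simps)
    also have "\<dots> = cos (y / 2) * cos ((y - x) / 2) + sin (y / 2) * D" unfolding D_def by (rule cos_diff)
    also have "\<dots> \<le> cos (y / 2) * 1 + 1 * D" using cp D by (intro add_mono mult_left_mono mult_right_mono) auto
    finally show ?thesis by simp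
  qed
  have 3: "D / z \<le> 4 * s * D / d" if "d / (4 * s) \<le> z" for z
  proof -
    have "D / z \<le> D / (d / (4 * s))" using that e4 D by (intro divide_left_mono mult_pos_pos) auto
    then show ?thesis using d by (simp add: field_simps)
  qed
  have "sin (y / 2) / sin (x / 2) \<le> (sin (x / 2) + D) / sin (x / 2)" using 1 sp by (intro divide_right_mono) auto
  also have "\<dots> = 1 + D / sin (x / 2)" using sp by (simp add: add_divide_distrib)
  finally show "sin (y / 2) / sin (x / 2) \<le> 1 + 4 * s * sin ((y - x) / 2) / d" using 3[OF sx] by (simp add: D_def)
  have "cos (x / 2) / cos (y / 2) \<le> (cos (y / 2) + D) / cos (y / 2)" using 2 cp by (intro divide_right_mono) auto
  also have "\<dots> = 1 + D / cos (y / 2)" using cp by (simp add: add_divide_distrib)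
  finally show "cos (x / 2) / cos (y / 2) \<le> 1 + 4 * s * sin ((y - x) / 2) / d" using 3[OF cy] by (simp add: D_def)
qed

text \<open>The square root of \<open>trig_weight \<alpha> \<beta> u / trig_weight \<alpha> \<beta>
  t\<close>: with equal weighted energies, the ratio of the amplitude at t to that at u.\<close>

definition amp_ratio :: "real \<Rightarrow> real \<Rightarrow> real \<Rightarrow> real \<Rightarrow> real" where
  "amp_ratio \<alpha> \<beta> u t = (sin (u / 2) / sin (t / 2)) powr (\<alpha> + 1/2) * (cos (u / 2) / cos (t / 2)) powr (\<beta> + 1/2)"

lemma one_minus_cos_half: "1 - cos x = 2 * (sin (x / 2))\<^sup>2" for x :: real
  using cos_double_sin[of "x / 2"] by simp

lemma one_plus_cos_half: "1 + cos x = 2 * (cos (x / 2))\<^sup>2" for x :: real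
  using cos_double_cos[of "x / 2"] by simp

lemma half_angle_pos:
  assumes "0 < x" "x < pi"
  shows "sin (x / 2) > 0" "cos (x / 2) > 0"
  using assms by (auto intro!: sin_gt_zero cos_gt_zero)

lemma trig_weight_eq_amp_ratio:
  assumes "0 < u" "u < pi" "0 < t" "t < pi"
  shows "trig_weight \<alpha> \<beta> u = (amp_ratio \<alpha> \<beta> u t)\<^sup>2 * trig_weight \<alpha> \<beta> t"
proof -
  have pw: "(2 * x\<^sup>2) powr a = 2 powr a * (x powr a)\<^sup>2" if "x > 0" for x a :: real
    using that by (simp add: powr_mult power2_eq_square)
  note p = half_angle_pos[OF assms(1,2)] half_angle_pos[OF assms(3,4)]
  show ?thesis
    unfolding trig_weight_def amp_ratio_def one_minus_cos_half one_plus_cos_half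
    using p by (simp add: pw powr_divide power_mult_distrib power_divide)
qed

lemma abs_sin_half_diff:
  assumes "0 \<le> t" "t \<le> pi" "0 \<le> u" "u \<le> (pi::real)"
  shows "\<bar>sin ((t - u) / 2)\<bar> = sin (\<bar>t - u\<bar> / 2)"
proof -
  have "sin (\<bar>t - u\<bar> / 2) \<ge> 0" using assms by (intro sin_ge_zero) auto
  moreover have "sin ((u - t) / 2) = - sin ((t - u) / 2)"
    by (metis minus_diff_eq minus_divide_left sin_minus)
  ultimately show ?thesis by (cases "t \<le> u") auto
qed

lemma abs_sin_half_diff_ge:
  assumes "0 \<le> t" "t \<le> pi" "0 \<le> u" "u \<le> (pi::real)"
  shows "\<bar>t - u\<bar> / 4 \<le> \<bar>sin ((t - u) / 2)\<bar>"
  using sin_ge_half[of "\<bar>t - u\<bar> / 2"] assms by (simp add: abs_sin_half_diff)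

lemma powr_le_powr_of_le:
  assumes "1 \<le> r" "r \<le> R" "a \<le> b" "0 \<le> b"
  shows "r powr a \<le> R powr (b::real)"
proof -
  have "r powr a \<le> r powr b" using assms by (intro powr_mono) auto
  also have "\<dots> \<le> R powr b" using assms by (intro powr_mono2) auto
  finally show ?thesis .
qed

text \<open>The trigonometric inequality in which the exponent arises. For t \<le> u the amplitude
  ratio grows at most like R to the power max 0 (\<alpha> + 1/2) + max 0 (-(\<beta> + 1/2)); for u <
  t the quadratic prefactor is traded for powers of the ratios, which leaves the power \<beta> -
  3/2. Both powers are at most 1 - e.\<close>

lemma amp_ratio_far:
  assumes ab: "\<alpha> > -1" "\<beta> > -1" and d: "d > 0" "s > 0"
    and t: "d / s \<le> t" "t \<le> pi - d / s" and u: "d / s \<le> u" "u \<le> pi - d / s"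
    and far: "\<bar>t - u\<bar> \<ge> d / s"
  defines "e \<equiv> jacobi_exponent \<alpha> \<beta>"
  shows "(cos (t / 2))\<^sup>2 * (sin (u / 2))\<^sup>2 * amp_ratio \<alpha> \<beta> u t \<le>
    (8 / d) powr (1 - e) * s powr (1 - e) * (sin ((t + u) / 2) * \<bar>sin ((t - u) / 2)\<bar>)"
proof -
  have ds: "d / s > 0" using d by simp
  have e: "e \<le> 0" "e \<le> 1/2 - \<alpha>" "e \<le> 5/2 - \<beta>" "\<beta> \<le> 1/2 \<Longrightarrow> e \<le> \<beta> - \<alpha>"
    unfolding e_def by (rule jacobi_exponent_bounds; assumption?)+
  have tp: "0 < t" "t < pi" "0 < u" "u < pi" using t u ds by linarith+
  define S where "S = sin ((t + u) / 2)"
  define D where "D = \<bar>sin ((t - u) / 2)\<bar>"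
  \<comment> \<open>For angles at distance at least d / s one has 4 s D / d \<ge> 1, so R dominates
    the bound 1 + 4 s D / d for the half-angle ratios. R itself grows linearly in D.\<close>
  define R where "R = 8 / d * s * D"
  note p = half_angle_pos[OF tp(1,2)] half_angle_pos[OF tp(3,4)]
  have Dge: "D \<ge> \<bar>t - u\<bar> / 4"
    unfolding D_def using tp by (intro abs_sin_half_diff_ge) auto
  have D1: "D \<le> 1" by (simp add: D_def)
  have "d / s / 4 \<le> D"
    by (rule order.trans[OF divide_right_mono[OF far] Dge]) simp
  then have Dr: "1 \<le> 4 * s * D / d" using d by (simp add: field_simps)
  define X where "X = 4 * s * D / d"
  have "R = 2 * X" by (simp add: R_def X_def)
  then have R: "1 \<le> R" "1 + 4 * s * D / d \<le> R" using Dr unfolding X_def[symmetric] by linarith+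
  have S: "S = sin (t / 2) * cos (u / 2) + cos (t / 2) * sin (u / 2)"
    unfolding S_def by (simp add: add_divide_distrib sin_add)
  have S1: "cos (t / 2) * sin (u / 2) \<le> S" "sin (t / 2) * cos (u / 2) \<le> S"
    using p by (auto simp: S)
  have S0: "S \<ge> 0" using S p by simp
  have sq: "x\<^sup>2 \<le> S" if "x \<le> S" "0 \<le> x" "x \<le> 1" for x
    using that mult_left_le[of x x] by (simp add: power2_eq_square)
  have main: "(cos (t / 2))\<^sup>2 * (sin (u / 2))\<^sup>2 * amp_ratio \<alpha> \<beta> u t \<le> S * R powr (1 - e)"
  proof (cases "t \<le> u")
    case True
    have Deq: "sin ((u - t) / 2) = D" using True tp by (simp add: D_def abs_sin_half_diff)
    note r = trig_half_ratio_le[OF d True t(1) u(2), unfolded Deq]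
    define r1 where "r1 = sin (u / 2) / sin (t / 2)"
    define r3 where "r3 = cos (t / 2) / cos (u / 2)"
    have r13: "1 \<le> r1" "r1 \<le> R" "1 \<le> r3" "r3 \<le> R"
      using r R p by (auto simp: r1_def r3_def)
    have "amp_ratio \<alpha> \<beta> u t = r1 powr (\<alpha> + 1/2) * r3 powr - (\<beta> + 1/2)"
    proof -
      have "(cos (u / 2) / cos (t / 2)) powr (\<beta> + 1/2) = r3 powr - (\<beta> + 1/2)"
        unfolding r3_def powr_minus using p by (simp add: powr_divide)
      then show ?thesis by (simp add: amp_ratio_def r1_def)
    qed
    also have "\<dots> \<le> R powr (max 0 (\<alpha> + 1/2)) * R powr (max 0 (- (\<beta> + 1/2)))"
      by (intro mult_mono powr_le_powr_of_le r13) auto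
    also have "\<dots> = R powr (max 0 (\<alpha> + 1/2) + max 0 (- (\<beta> + 1/2)))" by (simp add: powr_add)
    also have "\<dots> \<le> R powr (1 - e)" using R e ab by (intro powr_mono) (auto simp: max_def)
    finally have "amp_ratio \<alpha> \<beta> u t \<le> R powr (1 - e)" .
    moreover have "(cos (t / 2) * sin (u / 2))\<^sup>2 \<le> S"
      by (rule sq[OF S1(1)]) (use p in \<open>auto intro!: mult_le_one\<close>)
    ultimately show ?thesis unfolding power_mult_distrib[symmetric] using S0
      by (intro mult_mono) (auto simp: amp_ratio_def)
  next
    case False
    then have le: "u \<le> t" by simp
    have Deq: "sin ((t - u) / 2) = D" using le tp by (simp add: D_def abs_sin_half_diff)
    note r = trig_half_ratio_le[OF d le u(1) t(2), unfolded Deq]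
    define r1 where "r1 = sin (u / 2) / sin (t / 2)"
    define r2 where "r2 = cos (u / 2) / cos (t / 2)"
    have r12: "0 < r1" "r1 \<le> 1" "1 \<le> r2" "r2 \<le> R"
      using r R p by (auto simp: r1_def r2_def)
    \<comment> \<open>Exchanging the roles of t and u in the prefactor costs r1^2 / r2^2. This
      raises the exponent of r1 \<le> 1 above 0 and lowers that of r2 \<ge> 1 by 2.\<close>
    have "(cos (t / 2))\<^sup>2 * (sin (u / 2))\<^sup>2 * amp_ratio \<alpha> \<beta> u t =
        (sin (t / 2) * cos (u / 2))\<^sup>2 * (r1 powr (\<alpha> + 1/2 + 2) * r2 powr (\<beta> + 1/2 - 2))"
    proof -
      have "r1 powr (\<alpha> + 1/2 + 2) = r1 powr (\<alpha> + 1/2) * r1\<^sup>2"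
        unfolding powr_add using r12 by (simp add: powr_numeral)
      moreover have "r2 powr (\<beta> + 1/2 - 2) = r2 powr (\<beta> + 1/2) / r2\<^sup>2"
        unfolding powr_diff using r12 by (simp add: powr_numeral)
      moreover have "(cos (t / 2))\<^sup>2 * (sin (u / 2))\<^sup>2 = (sin (t / 2) * cos (u / 2))\<^sup>2 * (r1\<^sup>2 / r2\<^sup>2)"
        using p by (simp add: r1_def r2_def field_simps)
      ultimately show ?thesis by (simp add: amp_ratio_def r1_def r2_def)
    qed
    also have "\<dots> \<le> S * (1 * R powr (1 - e))"
    proof (intro mult_mono)
      show "(sin (t / 2) * cos (u / 2))\<^sup>2 \<le> S"
        by (rule sq[OF S1(2)]) (use p in \<open>auto intro!: mult_le_one\<close>)
      show "r1 powr (\<alpha> + 1/2 + 2) \<le> 1" using r12 ab by (intro powr_le1) auto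
      show "r2 powr (\<beta> + 1/2 - 2) \<le> R powr (1 - e)"
        using r12 e by (intro powr_le_powr_of_le) auto
    qed (use S0 in auto)
    finally show ?thesis by simp
  qed
  \<comment> \<open>Only -e of the powers are estimated with D \<le> 1; the remaining first power of
    D is needed to match |cos t - cos u|.\<close>
  have "R powr (1 - e) = R powr (- e) * R" using R by (simp add: powr_add[of R "- e" 1, simplified] add.commute)
  also have "\<dots> \<le> (8 / d * s) powr (- e) * R"
  proof (intro mult_right_mono powr_mono2)
    show "R \<le> 8 / d * s" unfolding R_def using mult_left_mono[OF D1, of "8 / d * s"] d by simp
  qed (use R e in auto)
  also have "\<dots> = (8 / d * s) powr (- e) * (8 / d * s) powr 1 * D" using d by (simp add: R_def)
  also have "\<dots> = (8 / d * s) powr (1 - e) * D" unfolding powr_add[symmetric] by (simp add: add.commute)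
  also have "\<dots> = (8 / d) powr (1 - e) * s powr (1 - e) * D" using d by (subst powr_mult) auto
  finally have "S * R powr (1 - e) \<le> S * ((8 / d) powr (1 - e) * s powr (1 - e) * D)"
    using S0 by (rule mult_left_mono)
  with main show ?thesis unfolding S_def D_def by (simp add: mult_ac)
qed

lemma powr_le_3_powr_abs:
  assumes "1 / 3 \<le> r" "r \<le> (3::real)"
  shows "r powr a \<le> 3 powr \<bar>a\<bar>"
proof (cases "a \<ge> 0")
  case True
  then show ?thesis using assms by (auto intro: powr_mono2)
next
  case False
  have "r powr a = (1 / r) powr (- a)" using assms by (simp add: powr_minus powr_divide)
  also have "\<dots> \<le> 3 powr (- a)" using assms False by (intro powr_mono2) (auto simp: field_simps)
  finally show ?thesis using False by simp
qed

text \<open>For angles within d / s of each other the ratio bound 1 + 4 s sin ((y - x) / 2) / d is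
  at most 3.\<close>

lemma amp_ratio_near:
  assumes d: "d > 0" "s > 0"
    and t: "d / s \<le> t" "t \<le> pi - d / s" and u: "d / s \<le> u" "u \<le> pi - d / s"
    and near: "\<bar>t - u\<bar> \<le> d / s"
  shows "amp_ratio \<alpha> \<beta> u t \<le> 3 powr \<bar>\<alpha> + 1/2\<bar> * 3 powr \<bar>\<beta> + 1/2\<bar>"
proof -
  have *: "sin (y / 2) / sin (x / 2) \<le> 3 \<and> cos (x / 2) / cos (y / 2) \<le> 3 \<and>
     0 < sin (x / 2) \<and> 0 < cos (y / 2) \<and> sin (x / 2) \<le> sin (y / 2) \<and> cos (y / 2) \<le> cos (x / 2)"
    if "x \<le> y" "d / s \<le> x" "y \<le> pi - d / s" "y - x \<le> d / s" for x y
  proof -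
    have "sin ((y - x) / 2) \<le> (y - x) / 2" using that by (intro sin_x_le_x) auto
    also have "\<dots> \<le> d / s / 2" using that by simp
    finally have "4 * s * sin ((y - x) / 2) / d \<le> 4 * s * (d / s / 2) / d"
      using d by (intro divide_right_mono mult_left_mono) auto
    also have "\<dots> = 2" using d by simp
    finally show ?thesis using trig_half_ratio_le[OF d that(1-3)] by auto
  qed
  have "1 / 3 \<le> sin (u / 2) / sin (t / 2) \<and> sin (u / 2) / sin (t / 2) \<le> 3 \<and>
     1 / 3 \<le> cos (u / 2) / cos (t / 2) \<and> cos (u / 2) / cos (t / 2) \<le> 3"
  proof (cases "t \<le> u")
    case True
    from *[OF True t(1) u(2)] near True show ?thesis by (auto simp: field_simps)
  next
    case False
    from *[of u t] False t u near show ?thesis by (auto simp: field_simps)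
  qed
  then show ?thesis unfolding amp_ratio_def by (intro mult_mono powr_le_3_powr_abs) auto
qed

lemma abs_cos_diff:
  assumes "0 \<le> t" "t \<le> pi" "0 \<le> u" "u \<le> pi"
  shows "\<bar>cos t - cos u\<bar> = 2 * (sin ((t + u) / 2) * \<bar>sin ((t - u) / 2)\<bar>)"
proof -
  have "cos t - cos u = 2 * sin ((t + u) / 2) * sin ((u - t) / 2)" by (rule cos_diff_cos)
  moreover have "sin ((t + u) / 2) \<ge> 0" using assms by (intro sin_ge_zero) auto
  moreover have "\<bar>sin ((u - t) / 2)\<bar> = \<bar>sin ((t - u) / 2)\<bar>"
    using sin_minus[of "(t - u) / 2"] by (simp add: minus_divide_left del: sin_minus)
  ultimately show ?thesis by (simp add: abs_mult)
qed

text \<open>The last inequality bounds sin u times the basis polynomial of the node cos u of (1 + x)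
  p(x), evaluated at cos t and cleared of denominators: (1 + cos u) |p'(cos u)| (1 - cos u) equals
  sin u times \<open>\<bar>trig_deriv p u\<bar>\<close>.\<close>

definition lagrange_bounds :: "real \<Rightarrow> real \<Rightarrow> real \<Rightarrow> real \<Rightarrow> real \<Rightarrow> real \<Rightarrow> real poly \<Rightarrow> bool" where
  "lagrange_bounds \<alpha> \<beta> d K C s p \<longleftrightarrow>
    (\<forall>a b. 0 \<le> a \<and> b \<le> pi \<and> b - a \<ge> K / s \<longrightarrow> (\<exists>t\<in>{a..b}. poly p (cos t) = 0)) \<and>
    (\<forall>u. 0 \<le> u \<and> u \<le> pi \<and> poly p (cos u) = 0 \<longrightarrow> d / s \<le> sin u \<and>
      (\<forall>t. 0 \<le> t \<and> t \<le> pi \<longrightarrow> (1 + cos t) * \<bar>poly p (cos t)\<bar> * (1 - cos u) \<le>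
         C * s powr (- jacobi_exponent \<alpha> \<beta>) * \<bar>trig_deriv p u\<bar> * \<bar>cos t - cos u\<bar>))"

text \<open>At a zero the energy is the square of the angular derivative, so the energy bounds
  compare p elsewhere with that derivative. Close to u the mean value theorem supplies the factor |t
  - u|; farther away the factor s in the energy does, since s |sin ((t - u) / 2)| is bounded
  below.\<close>

lemma jacobi_sol_lagrange_bounds:
  assumes ab: "\<alpha> > -1" "\<beta> > -1"
  obtains d K C s0 where "d > 0" "K > 0" "C > 0" "s0 \<ge> 1"
    "\<And>s p. s0 \<le> s \<Longrightarrow> jacobi_sol \<alpha> \<beta> s p \<Longrightarrow> p \<noteq> 0 \<Longrightarrow> lagrange_bounds \<alpha> \<beta> d K C s p"
proof -
  define e where "e = jacobi_exponent \<alpha> \<beta>"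
  obtain d K s0 where b: "d > 0" "K \<ge> 1" "s0 \<ge> 1" and small: "\<And>s. s0 \<le> s \<Longrightarrow> 4 * d / s \<le> pi"
    and full: "\<And>s p. s0 \<le> s \<Longrightarrow> jacobi_sol \<alpha> \<beta> s p \<Longrightarrow> full_bounds \<alpha> \<beta> d K s p"
    by (rule jacobi_sol_bounds[OF ab]) blast
  define C1 where "C1 = 8 * K * (3 powr \<bar>\<alpha> + 1/2\<bar> * 3 powr \<bar>\<beta> + 1/2\<bar>)"
  define C2 where "C2 = 4 * K * (8 / d) powr (1 - e)"
  define C where "C = max C1 C2"
  have C12: "C1 > 0" "C1 \<le> C" "C2 \<le> C" using b by (auto simp: C1_def C_def)
  show ?thesis
  proof (rule that[of d K C s0])
    show "d > 0" "K > 0" "C > 0" "s0 \<ge> 1" using b C12 by auto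
  next
    fix s p assume s0: "s0 \<le> s" and sol: "jacobi_sol \<alpha> \<beta> s p" and nz: "p \<noteq> 0"
    have s: "s \<ge> 1" "s > 0" using s0 b by auto
    have low: "energy s p (pi / 2) \<le> K * (trig_weight \<alpha> \<beta> t * energy s p t)"
      if "d / s \<le> t" "t \<le> pi - d / s" for t
      using full[OF s0 sol] that unfolding full_bounds_def by blast
    have up: "trig_weight \<alpha> \<beta> (clip (d / s) t) * energy s p t \<le> K * energy s p (pi / 2)"
      if "0 \<le> t" "t \<le> pi" for t
      using full[OF s0 sol] that unfolding full_bounds_def by blast
    have loc: "2 * d / s \<le> t" "t \<le> pi - 2 * d / s"
      if "0 \<le> t" "t \<le> pi" "poly p (cos t) = 0" for t
      using full[OF s0 sol] nz that unfolding full_bounds_def by blast+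
    show "lagrange_bounds \<alpha> \<beta> d K C s p"
      unfolding lagrange_bounds_def
    proof (intro conjI allI impI; (elim conjE)?)
      fix a' b' assume "0 \<le> a'" "b' \<le> pi" "b' - a' \<ge> K / s"
      then show "\<exists>t\<in>{a'..b'}. poly p (cos t) = 0"
        using full[OF s0 sol] unfolding full_bounds_def by blast
    next
      fix u assume a: "0 \<le> u" "u \<le> pi" "poly p (cos u) = 0"
      note l = loc[OF a]
      have e2: "2 * d / s / 2 = d / s" by simp
      show "d / s \<le> sin u"
      proof (cases "u \<le> pi / 2")
        case True
        then have "u / 2 \<le> sin u" using a by (intro sin_ge_half) auto
        then show ?thesis using divide_right_mono[OF l(1), of 2] unfolding e2 by linarith
      next
        case False
        then have "(pi - u) / 2 \<le> sin (pi - u)" using a by (intro sin_ge_half) auto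
        moreover have "2 * d / s \<le> pi - u" using l by linarith
        ultimately show ?thesis using divide_right_mono[of "2 * d / s" "pi - u" 2] unfolding e2 by simp
      qed
    next
      fix u t assume a: "0 \<le> u" "u \<le> pi" "poly p (cos u) = 0" "0 \<le> t" "t \<le> pi"
      have ds: "d / s > 0" using b s by simp
      define h where "h = d / s"
      have eps: "h > 0" "4 * h \<le> pi" using ds small[OF s0] by (auto simp: h_def)
      have l: "2 * h \<le> u" "u \<le> pi - 2 * h" using loc[OF a(1-3)] by (auto simp: h_def)
      have ph: "d / s \<le> u" "u \<le> pi - d / s" using l eps unfolding h_def[symmetric] by auto
      define q where "q = \<bar>trig_deriv p u\<bar>"
      have enu: "energy s p u = q\<^sup>2" using a(3) by (simp add: energy_def q_def)
      \<comment> \<open>The upper bound at x and the lower bound at u are both relative to the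
        energy at pi / 2, which drops out.\<close>
      have enb: "energy s p x \<le> (K * q * amp_ratio \<alpha> \<beta> u (clip (d / s) x))\<^sup>2" if "0 \<le> x" "x \<le> pi" for x
      proof -
        define y where "y = clip (d / s) x"
        have y: "0 < y" "y < pi" using eps unfolding y_def h_def[symmetric] clip_def by auto
        have wy: "trig_weight \<alpha> \<beta> y > 0" by (rule trig_weight_pos[OF y])
        have "trig_weight \<alpha> \<beta> y * energy s p x \<le> K * energy s p (pi / 2)"
          unfolding y_def by (rule up[OF that])
        also have "\<dots> \<le> K * (K * (trig_weight \<alpha> \<beta> u * q\<^sup>2))"
          using low[OF ph] b unfolding enu by (intro mult_left_mono) auto
        also have "trig_weight \<alpha> \<beta> u = (amp_ratio \<alpha> \<beta> u y)\<^sup>2 * trig_weight \<alpha> \<beta> y"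
          by (rule trig_weight_eq_amp_ratio) (use y l eps in auto)
        finally have "trig_weight \<alpha> \<beta> y * energy s p x \<le> trig_weight \<alpha> \<beta> y * (K * q * amp_ratio \<alpha> \<beta> u y)\<^sup>2"
          by (simp add: power_mult_distrib power2_eq_square mult_ac)
        then show ?thesis using wy by (simp add: y_def)
      qed
      have ratio_nn: "amp_ratio \<alpha> \<beta> u x \<ge> 0" for x by (simp add: amp_ratio_def)
      have s1: "s powr (- e) \<ge> 1" using s jacobi_exponent_bounds(1)[of \<alpha> \<beta>] by (intro ge_one_powr_ge_zero) (auto simp: e_def)
      have D0: "\<bar>cos t - cos u\<bar> \<ge> 0" "q \<ge> 0" by (auto simp: q_def)
      have S: "sin ((t + u) / 2) = sin (t / 2) * cos (u / 2) + cos (t / 2) * sin (u / 2)"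
        by (simp add: add_divide_distrib sin_add)
      have hp: "0 \<le> sin (t / 2)" "0 \<le> cos (t / 2)" "0 \<le> sin (u / 2)" "0 \<le> cos (u / 2)"
        using a by (auto intro!: sin_ge_zero cos_ge_zero)
      have "\<exists>C'. C' \<le> C \<and> (1 + cos t) * \<bar>poly p (cos t)\<bar> * (1 - cos u) \<le> C' * s powr (- e) * q * \<bar>cos t - cos u\<bar>"
      proof (cases "\<bar>t - u\<bar> \<le> h")
        case True
        define M where "M = K * q * (3 powr \<bar>\<alpha> + 1/2\<bar> * 3 powr \<bar>\<beta> + 1/2\<bar>)"
        have "\<bar>poly p (cos t)\<bar> \<le> M * \<bar>t - u\<bar>"
        proof -
          have "norm (poly p (cos t) - poly p (cos u)) \<le> M * norm (t - u)"
          proof (rule field_differentiable_bound[of "{min t u..max t u}"])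
            fix x assume "x \<in> {min t u..max t u}"
            then have x: "h \<le> x" "x \<le> pi - h" "\<bar>x - u\<bar> \<le> h" using True l by (auto simp: min_def max_def split: if_splits)
            show "((\<lambda>t. poly p (cos t)) has_real_derivative trig_deriv p x) (at x within {min t u..max t u})"
              by (rule has_field_derivative_at_within[OF has_derivative_poly_cos])
            have clip: "clip (d / s) x = x" using x unfolding clip_def h_def[symmetric] by auto
            have "(trig_deriv p x)\<^sup>2 \<le> energy s p x" by (simp add: energy_def)
            also have "\<dots> \<le> (K * q * amp_ratio \<alpha> \<beta> u x)\<^sup>2" using enb[of x] x eps unfolding clip by auto
            finally have "\<bar>trig_deriv p x\<bar> \<le> K * q * amp_ratio \<alpha> \<beta> u x"
              using b D0 ratio_nn[of x] by (simp add: abs_le_square_iff[symmetric])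
            also have "\<dots> \<le> M" unfolding M_def
              by (intro mult_left_mono amp_ratio_near[OF b(1) s(2) _ _ ph])
                (use x b D0 in \<open>auto simp: h_def\<close>)
            finally show "norm (trig_deriv p x) \<le> M" by simp
          qed auto
          then show ?thesis using a(3) by simp
        qed
        moreover have "(1 + cos t) * (1 - cos u) \<le> 4 * sin ((t + u) / 2)"
        proof -
          have "(1 + cos t) * (1 - cos u) = 4 * ((cos (t / 2) * sin (u / 2)) * (cos (t / 2) * sin (u / 2)))"
            unfolding one_plus_cos_half[of t] one_minus_cos_half[of u] by (simp add: power2_eq_square)
          also have "(cos (t / 2) * sin (u / 2)) * (cos (t / 2) * sin (u / 2)) \<le> cos (t / 2) * sin (u / 2)"
            using hp by (intro mult_left_le mult_le_one mult_nonneg_nonneg) auto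
          also have "\<dots> \<le> sin ((t + u) / 2)" unfolding S using hp by simp
          finally show ?thesis by simp
        qed
        moreover have "\<bar>t - u\<bar> \<le> 4 * \<bar>sin ((t - u) / 2)\<bar>"
          using abs_sin_half_diff_ge[OF a(4,5,1,2)] by simp
        moreover have M0: "M \<ge> 0" using b D0 by (simp add: M_def)
        moreover have S0: "sin ((t + u) / 2) \<ge> 0" unfolding S using hp by simp
        moreover have "\<bar>poly p (cos t)\<bar> \<le> M * (4 * \<bar>sin ((t - u) / 2)\<bar>)"
          by (rule order.trans[OF calculation(1) mult_left_mono[OF calculation(3) M0]])
        ultimately have "((1 + cos t) * (1 - cos u)) * \<bar>poly p (cos t)\<bar> \<le>
            (4 * sin ((t + u) / 2)) * (M * (4 * \<bar>sin ((t - u) / 2)\<bar>))"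
          by (intro mult_mono[of "(1 + cos t) * (1 - cos u)"]) auto
        also have "\<dots> = 8 * M * \<bar>cos t - cos u\<bar>" using abs_cos_diff[OF a(4,5,1,2)] by simp
        also have "\<dots> = C1 * 1 * q * \<bar>cos t - cos u\<bar>" by (simp add: M_def C1_def)
        also have "\<dots> \<le> C1 * s powr (- e) * q * \<bar>cos t - cos u\<bar>"
          using s1 C12 D0 by (intro mult_right_mono mult_left_mono) auto
        finally show ?thesis using C12 by (intro exI[of _ C1]) (simp add: mult_ac)
      next
        case False
        define y where "y = clip (d / s) t"
        have y: "h \<le> y" "y \<le> pi - h" using eps unfolding y_def h_def[symmetric] clip_def by auto
        \<comment> \<open>Zeros keep distance 2 h from 0 and pi while clipping moves t to distance
          h, so the separation from u survives.\<close>
        have yf: "\<bar>y - u\<bar> \<ge> h" using False l eps unfolding y_def h_def[symmetric] clip_def by (auto simp: max_def min_def)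
        define A where "A = amp_ratio \<alpha> \<beta> u y"
        have "(s * poly p (cos t))\<^sup>2 \<le> energy s p t" by (simp add: energy_def power_mult_distrib)
        also have "\<dots> \<le> (K * q * A)\<^sup>2" unfolding A_def y_def by (rule enb[OF a(4,5)])
        finally have "\<bar>s * poly p (cos t)\<bar> \<le> K * q * A"
          using b D0 ratio_nn[of y] by (simp add: abs_le_square_iff[symmetric] A_def)
        then have pb: "s * \<bar>poly p (cos t)\<bar> \<le> K * q * A" using s by (simp add: abs_mult)
        have c1: "1 + cos t \<le> 2 * (1 + cos y)"
        proof (cases "t \<le> pi / 2")
          case True
          then have "y \<le> pi / 2" using eps unfolding y_def h_def[symmetric] clip_def by auto
          then have "cos y \<ge> 0" using y eps by (intro cos_ge_zero) auto
          moreover have "1 + u \<le> 2 * (1 + v)" if "u \<le> 1" "0 \<le> v" for u v :: real using that by simp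
          ultimately show ?thesis using cos_le_one[of t] by blast
        next
          case False
          then have "y \<le> t" using eps unfolding y_def h_def[symmetric] clip_def by auto
          then have "cos t \<le> cos y" using y eps a by (intro cos_monotone_0_pi_le) auto
          moreover have "1 + u \<le> 2 * (1 + v)" if "u \<le> v" "-1 \<le> v" for u v :: real using that by simp
          ultimately show ?thesis using cos_ge_minus_one[of y] by blast
        qed
        have c2: "\<bar>cos y - cos u\<bar> \<le> \<bar>cos t - cos u\<bar>"
        proof -
          have "y = t \<or> (t \<le> y \<and> y \<le> u) \<or> (y \<le> t \<and> u \<le> y)"
            using l eps unfolding y_def h_def[symmetric] clip_def by (auto simp: max_def min_def)
          then consider "y = t" | "t \<le> y" "y \<le> u" | "y \<le> t" "u \<le> y" by blast
          then show ?thesis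
          proof cases
            case 2
            then have "cos y \<le> cos t" "cos u \<le> cos y" using a y eps by (auto intro!: cos_monotone_0_pi_le)
            then show ?thesis by simp
          next
            case 3
            then have "cos t \<le> cos y" "cos y \<le> cos u" using a y eps by (auto intro!: cos_monotone_0_pi_le)
            then show ?thesis by simp
          qed simp
        qed
        have "s * ((1 + cos t) * \<bar>poly p (cos t)\<bar> * (1 - cos u)) =
            (1 + cos t) * (s * \<bar>poly p (cos t)\<bar>) * (1 - cos u)" by simp
        also have "\<dots> \<le> (2 * (1 + cos y)) * (K * q * A) * (1 - cos u)"
        proof (rule mult_right_mono[OF mult_mono[OF c1 pb]])
          have "-1 \<le> v \<Longrightarrow> 0 \<le> 2 * (1 + v)" for v :: real by simp
          then show "0 \<le> 2 * (1 + cos y)" using cos_ge_minus_one by blast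
        qed (use s in auto)
        also have "\<dots> = 8 * K * q * ((cos (y / 2))\<^sup>2 * (sin (u / 2))\<^sup>2 * A)"
          unfolding one_plus_cos_half[of y] one_minus_cos_half[of u] by simp
        also have "\<dots> \<le> 8 * K * q * ((8 / d) powr (1 - e) * s powr (1 - e) *
            (sin ((y + u) / 2) * \<bar>sin ((y - u) / 2)\<bar>))"
          unfolding A_def e_def using y yf b D0
          by (intro mult_left_mono amp_ratio_far[OF ab b(1) s(2) _ _ ph]) (auto simp: h_def)
        also have "\<dots> = C2 * q * s powr (1 - e) * \<bar>cos y - cos u\<bar>"
          using abs_cos_diff[of y u] y eps a by (simp add: C2_def)
        also have "\<dots> \<le> C2 * q * s powr (1 - e) * \<bar>cos t - cos u\<bar>"
          using c2 b D0 by (intro mult_left_mono) (auto simp: C2_def)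
        also have "s powr (1 - e) = s * s powr (- e)" using s by (simp add: powr_add[of s 1 "- e", simplified])
        finally have "s * ((1 + cos t) * \<bar>poly p (cos t)\<bar> * (1 - cos u)) \<le>
            s * (C2 * s powr (- e) * q * \<bar>cos t - cos u\<bar>)" by (simp add: mult_ac)
        then show ?thesis using s C12 by (intro exI[of _ C2]) simp
      qed
      then obtain C' where C': "C' \<le> C" "(1 + cos t) * \<bar>poly p (cos t)\<bar> * (1 - cos u) \<le> C' * s powr (- e) * q * \<bar>cos t - cos u\<bar>" by blast
      have "C' * s powr (- e) * q * \<bar>cos t - cos u\<bar> \<le> C * s powr (- e) * q * \<bar>cos t - cos u\<bar>"
        using C' D0 by (intro mult_right_mono) auto
      with C'(2) show "(1 + cos t) * \<bar>poly p (cos t)\<bar> * (1 - cos u) \<le>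
           C * s powr (- jacobi_exponent \<alpha> \<beta>) * \<bar>trig_deriv p u\<bar> * \<bar>cos t - cos u\<bar>"
        unfolding e_def q_def by linarith
    qed
  qed
qed

section \<open>The interpolation error\<close>

lemma card_gt_degree_imp_poly_0:
  fixes p :: "real poly"
  assumes "finite A" "\<And>x. x \<in> A \<Longrightarrow> poly p x = 0" "degree p < card A"
  shows "p = 0"
proof (rule ccontr)
  assume nz: "p \<noteq> 0"
  have "card A \<le> card {x. poly p x = 0}"
    using assms(2) by (intro card_mono poly_roots_finite[OF nz]) auto
  then show False using card_poly_roots_bound[OF nz] assms(3) by linarith
qed

lemma poly_eq_lead_coeff_prod_roots:
  fixes p :: "real poly"
  assumes "card {x. poly p x = 0} = degree p" "p \<noteq> 0"
  shows "p = smult (lead_coeff p) (\<Prod>x\<in>{x. poly p x = 0}. [:-x, 1:])"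
proof -
  define A where "A = {x. poly p x = 0}"
  define q where "q = (\<Prod>x\<in>A. [:-x, 1:])"
  have fA: "finite A" unfolding A_def by (rule poly_roots_finite[OF assms(2)])
  have dq: "degree q = degree p"
    unfolding q_def using assms(1) by (subst degree_prod_eq_sum_degree) (auto simp: A_def)
  have lq: "lead_coeff q = 1" unfolding q_def by (simp add: lead_coeff_prod)
  define R where "R = p - smult (lead_coeff p) q"
  have "degree R \<le> degree p"
    unfolding R_def using dq by (intro degree_diff_le order.trans[OF degree_smult_le]) auto
  moreover have "coeff R (degree p) = 0" unfolding R_def using lq dq by simp
  ultimately have *: "R = 0 \<or> degree R < degree p" by (metis le_neq_implies_less leading_coeff_0_iff)
  have "poly R x = 0" if "x \<in> A" for x
    using that fA by (auto simp: R_def q_def poly_prod A_def)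
  then have "R = 0" using card_gt_degree_imp_poly_0[OF fA, of R] * assms(1) by (auto simp: A_def)
  then show ?thesis by (simp add: R_def q_def A_def)
qed

lemma jacobi_sol_jacobi_poly:
  assumes "\<alpha> > -1" "\<beta> > -1"
  and s: "s\<^sup>2 = real n * (real n + \<alpha> + \<beta> + 1)"
  shows "jacobi_sol \<alpha> \<beta> s (jacobi_poly \<alpha> \<beta> n)"
  unfolding jacobi_sol_def s
proof
  fix x
  have "poly (jacobi_op \<alpha> \<beta> (jacobi_poly \<alpha> \<beta> n) +
      smult (real n * (real n + \<alpha> + \<beta> + 1)) (jacobi_poly \<alpha> \<beta> n)) x = 0"
    by (simp only: jacobi_poly_ode[OF assms(1,2)] poly_0)
  then show "(1 - x\<^sup>2) * poly (pderiv (pderiv (jacobi_poly \<alpha> \<beta> n))) x +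
     (\<beta> - \<alpha> - (\<alpha> + \<beta> + 2) * x) * poly (pderiv (jacobi_poly \<alpha> \<beta> n)) x +
     real n * (real n + \<alpha> + \<beta> + 1) * poly (jacobi_poly \<alpha> \<beta> n) x = 0"
    unfolding poly_add poly_jacobi_op poly_smult .
qed

lemma jacobi_poly_props:
  assumes ab: "\<alpha> > -1" "\<beta> > -1"
  shows "degree (jacobi_poly \<alpha> \<beta> n) = n" "jacobi_poly \<alpha> \<beta> n \<noteq> 0"
proof -
  have "is_jacobi_poly \<alpha> \<beta> n (jacobi_poly \<alpha> \<beta> n)" by (rule jacobi_poly_correct[OF ab])
  moreover have "(real n + \<alpha>) gchoose n > 0" using ab by (simp add: gbinomial_pochhammer' pochhammer_pos)
  ultimately show "degree (jacobi_poly \<alpha> \<beta> n) = n" "jacobi_poly \<alpha> \<beta> n \<noteq> 0"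
    by (auto simp: is_jacobi_poly_def)
qed

text \<open>Here c is the leading coefficient of the Jacobi polynomial. It occurs in both products
  and cancels from their quotient, so its value never matters.\<close>

lemma jacobi_node_weights:
  assumes ab: "\<alpha> > -1" "\<beta> > -1" and t: "t \<notin> jacobi_nodes \<alpha> \<beta> n"
  defines "P \<equiv> jacobi_poly \<alpha> \<beta> n" and "X \<equiv> jacobi_nodes \<alpha> \<beta> n"
  obtains c where "c \<noteq> 0" "c * (\<Prod>x\<in>X. t - x) = (1 + t) * poly P t"
    "\<And>x. poly P x = 0 \<Longrightarrow> c * node_weight (insert t X) x = (x - t) * (1 + x) * poly (pderiv P) x"
proof -
  define c where "c = lead_coeff P"
  define Y where "Y = {x. poly P x = 0}"
  have P: "degree P = n" "P \<noteq> 0" unfolding P_def by (rule jacobi_poly_props[OF ab])+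
  have cY: "card Y = n" "Y \<subseteq> {-1<..<1}" unfolding Y_def P_def by (rule jacobi_poly_roots[OF ab])+
  have fY: "finite Y" unfolding Y_def by (rule poly_roots_finite[OF P(2)])
  have X: "X = insert (-1) Y" unfolding X_def Y_def P_def by (rule jacobi_nodes_eq[OF ab])
  have m1: "-1 \<notin> Y" using cY(2) by auto
  have Peq: "P = smult c (\<Prod>x\<in>Y. [:-x, 1:])"
    unfolding c_def Y_def by (rule poly_eq_lead_coeff_prod_roots) (use cY P in \<open>auto simp: Y_def\<close>)
  show ?thesis
  proof (rule that[of c])
    show "c \<noteq> 0" unfolding c_def using P(2) by simp
    have "(\<Prod>x\<in>X. t - x) = (t + 1) * (\<Prod>x\<in>Y. t - x)" unfolding X using fY m1 by simp
    moreover have "poly P t = c * (\<Prod>x\<in>Y. t - x)" by (subst Peq) (simp add: poly_prod)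
    ultimately show "c * (\<Prod>x\<in>X. t - x) = (1 + t) * poly P t" by simp
    fix x assume "poly P x = 0"
    then have x: "x \<in> Y" by (simp add: Y_def)
    have "insert t X - {x} = insert t (insert (-1) (Y - {x}))" using x t m1 by (auto simp: X X_def[symmetric])
    then have "node_weight (insert t X) x = (x - t) * ((x + 1) * (\<Prod>u\<in>Y - {x}. x - u))"
      unfolding node_weight_def using fY m1 t by (auto simp: X X_def[symmetric])
    moreover have "poly (pderiv P) x = c * (\<Prod>u\<in>Y - {x}. x - u)"
    proof -
      have "P = smult c ([:-x, 1:] * (\<Prod>u\<in>Y - {x}. [:-u, 1:]))"
        using Peq prod.remove[OF fY x, of "\<lambda>x. [:-x, 1:]"] by simp
      moreover have "poly (pderiv (smult c ([:-x, 1:] * R))) x = c * poly R x" for R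
        by (simp add: pderiv_smult pderiv_mult pderiv_pCons del: mult_pCons_left)
      ultimately have "poly (pderiv P) x = c * poly (\<Prod>u\<in>Y - {x}. [:-u, 1:]) x" by (simp only:)
      then show ?thesis by (simp add: poly_prod)
    qed
    ultimately show "c * node_weight (insert t X) x = (x - t) * (1 + x) * poly (pderiv P) x" by (simp add: mult_ac)
  qed
qed

lemma abs_sin_diff_le: "\<bar>sin x - sin y\<bar> \<le> \<bar>x - y\<bar>" for x y :: real
proof -
  have "\<bar>sin x - sin y\<bar> = 2 * (\<bar>sin ((x - y) / 2)\<bar> * \<bar>cos ((x + y) / 2)\<bar>)"
    by (simp add: sin_diff_sin abs_mult)
  also have "\<dots> \<le> 2 * (\<bar>(x - y) / 2\<bar> * 1)"
    by (intro mult_left_mono mult_mono abs_sin_x_le_abs_x) auto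
  finally show ?thesis by simp
qed

text \<open>Measures the width in x of an angular window by the sine at any angle \<phi> inside it;
  the extra b - a covers windows near the end points.\<close>

lemma cos_diff_le:
  assumes "0 \<le> a" "a \<le> \<phi>" "\<phi> \<le> b" "b \<le> pi"
  shows "cos a - cos b \<le> (b - a) * (sin \<phi> + (b - a))"
proof -
  have "cos a - cos b = 2 * (sin ((a + b) / 2) * sin ((b - a) / 2))" by (simp add: cos_diff_cos)
  also have "\<dots> \<le> 2 * ((sin \<phi> + (b - a)) * ((b - a) / 2))"
  proof (intro mult_left_mono mult_mono)
    have "\<bar>(a + b) / 2 - \<phi>\<bar> \<le> b - a" unfolding abs_le_iff using assms by (auto simp: field_simps)
    then show "sin ((a + b) / 2) \<le> sin \<phi> + (b - a)" using abs_sin_diff_le[of "(a + b) / 2" \<phi>] by linarith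
    show "sin ((b - a) / 2) \<le> (b - a) / 2" using assms by (intro sin_x_le_x) auto
    show "0 \<le> sin \<phi> + (b - a)" using assms sin_ge_zero[of \<phi>] by auto
  qed (use assms in \<open>auto intro!: sin_ge_zero\<close>)
  finally show ?thesis by (simp add: mult.commute)
qed

text \<open>An angular window of length L / s containing arccos y holds enough zeros for the kernel
  estimate. The Lagrange bound divided by sin \<phi> controls the weights of its nodes, and the sine
  is converted into the width v - u of the window.\<close>

lemma jacobi_tker_bound:
  assumes ab: "\<alpha> > -1" "\<beta> > -1" and r: "r \<ge> 1"
  obtains C s1 where "C > 0" "s1 \<ge> 1"
    "\<And>n s t y. r + 1 \<le> n \<Longrightarrow> s = sqrt (real n * (real n + \<alpha> + \<beta> + 1)) \<Longrightarrow> s1 \<le> s \<Longrightarrow>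
       t \<in> {-1..1} \<Longrightarrow> t \<notin> jacobi_nodes \<alpha> \<beta> n \<Longrightarrow> y \<in> {-1..1} \<Longrightarrow>
       \<bar>\<Prod>x\<in>jacobi_nodes \<alpha> \<beta> n. t - x\<bar> * \<bar>tker (insert t (jacobi_nodes \<alpha> \<beta> n)) r y\<bar> \<le>
         C * (s powr (- real r) * s powr (- jacobi_exponent \<alpha> \<beta>))"
proof -
  define e where "e = jacobi_exponent \<alpha> \<beta>"
  obtain \<delta> K C0 s0 where b: "\<delta> > 0" "K > 0" "C0 > 0" "s0 \<ge> 1" and lagrange:
    "\<And>s p. s0 \<le> s \<Longrightarrow> jacobi_sol \<alpha> \<beta> s p \<Longrightarrow> p \<noteq> 0 \<Longrightarrow> lagrange_bounds \<alpha> \<beta> \<delta> K C0 s p"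
    by (rule jacobi_sol_lagrange_bounds[OF ab]) blast
  \<comment> \<open>Room for r + 2 blocks of length K / s, each containing a zero and separated by
    gaps of the same length, which makes the zeros distinct.\<close>
  define L where "L = 2 * K * real (r + 2)"
  have L: "L > 0" using b by (simp add: L_def)
  define C1 where "C1 = max L (C0 * (L * (1 + L / \<delta>)))"
  have C1: "C1 \<ge> L" "C0 * (L * (1 + L / \<delta>)) \<le> C1" "C1 > 0" using L by (auto simp: C1_def)
  define C where "C = fact r * (C1 * L ^ (r - 1))"
  define s1 where "s1 = max s0 (L / pi)"
  show ?thesis
  proof (rule that[of C s1])
    show "C > 0" "s1 \<ge> 1" using b L C1 by (auto simp: C_def s1_def)
  next
    fix n s t y
    assume n: "r + 1 \<le> n" and s_def: "s = sqrt (real n * (real n + \<alpha> + \<beta> + 1))" and s1: "s1 \<le> s"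
      and t: "t \<in> {-1..1}" "t \<notin> jacobi_nodes \<alpha> \<beta> n" and y: "y \<in> {-1..1::real}"
    define P where "P = jacobi_poly \<alpha> \<beta> n"
    define X where "X = jacobi_nodes \<alpha> \<beta> n"
    define Z where "Z = insert t X"
    define \<omega> where "\<omega> = (\<Prod>x\<in>X. t - x)"
    have s: "s0 \<le> s" "L / pi \<le> s" "s \<ge> 1" "s > 0" using s1 b by (auto simp: s1_def)
    have lam: "real n * (real n + \<alpha> + \<beta> + 1) \<ge> 0" using n r ab by (intro mult_nonneg_nonneg) auto
    have P: "degree P = n" "P \<noteq> 0" unfolding P_def by (rule jacobi_poly_props[OF ab])+
    have "jacobi_sol \<alpha> \<beta> s P"
      unfolding P_def by (rule jacobi_sol_jacobi_poly[OF ab]) (use lam in \<open>simp add: s_def\<close>)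
    note lagrange = lagrange[OF s(1) this P(2), unfolded lagrange_bounds_def]
    have zero: "\<exists>\<theta>\<in>{a..b}. poly P (cos \<theta>) = 0" if "0 \<le> a" "b \<le> pi" "b - a \<ge> K / s" for a b
      using lagrange that by blast
    have roots: "-1 < x \<and> x < 1" if "poly P x = 0" for x
      using jacobi_poly_roots(2)[OF ab, of n] that by (auto simp: P_def)
    have X: "X = insert (-1) {x. poly P x = 0}" unfolding X_def P_def by (rule jacobi_nodes_eq[OF ab])
    have fX: "finite X" "card X = n + 1"
      unfolding X_def by (rule finite_jacobi_nodes[OF ab], rule card_jacobi_nodes[OF ab])
    have Z: "finite Z" "card Z = n + 2" using fX t by (auto simp: Z_def X_def)
    have ZI: "Z \<subseteq> {-1..1}" using roots t by (fastforce simp: Z_def X)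
    have minZ: "Min Z = -1" using Z ZI by (intro Min_eqI) (auto simp: Z_def X)
    obtain c where c: "c \<noteq> 0" "c * \<omega> = (1 + t) * poly P t"
      "\<And>x. poly P x = 0 \<Longrightarrow> c * node_weight Z x = (x - t) * (1 + x) * poly (pderiv P) x"
      using jacobi_node_weights[OF ab t(2)] unfolding P_def X_def Z_def \<omega>_def by blast
    have \<omega>: "\<omega> \<noteq> 0" using t fX by (auto simp: \<omega>_def X_def[symmetric])
    define l where "l = L / s"
    have l: "l > 0" "l \<le> pi" using L s by (simp_all add: l_def field_simps)
    \<comment> \<open>The window starts at arccos y unless it would leave [0, pi], in which case it
      is pushed back to end at pi.\<close>
    define a where "a = min (arccos y) (pi - l)"
    have ay: "0 \<le> arccos y" "arccos y \<le> pi" using y by (auto intro: arccos_lbound arccos_ubound)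
    have a: "0 \<le> a" "a + l \<le> pi" "a \<le> arccos y" "arccos y \<le> a + l" using ay l by (auto simp: a_def)
    define u where "u = cos (a + l)"
    define v where "v = cos a"
    have uv: "u < v" unfolding u_def v_def using a l by (intro cos_monotone_0_pi) auto
    have uy: "u \<le> y" "y \<le> v"
    proof -
      have "cos (a + l) \<le> cos (arccos y)" "cos (arccos y) \<le> cos a"
        using a l ay by (intro cos_monotone_0_pi_le; simp)+
      then show "u \<le> y" "y \<le> v" using y by (auto simp: u_def v_def)
    qed
    define k where "k = K / s"
    have k: "k > 0" "l = 2 * k * real (r + 2)" using b s by (auto simp: k_def l_def L_def)
    have "\<forall>i. \<exists>\<zeta>. i < r + 2 \<longrightarrow> a + 2 * k * real i \<le> \<zeta> \<and> \<zeta> \<le> a + 2 * k * real i + k \<and> poly P (cos \<zeta>) = 0"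
    proof
      fix i
      show "\<exists>\<zeta>. i < r + 2 \<longrightarrow> a + 2 * k * real i \<le> \<zeta> \<and> \<zeta> \<le> a + 2 * k * real i + k \<and> poly P (cos \<zeta>) = 0"
      proof (cases "i < r + 2")
        case True
        then have "real i + 1 \<le> real (r + 2)" by simp
        then have "2 * k * (real i + 1) \<le> l" unfolding k(2) using k(1) by (intro mult_left_mono) auto
        then have "a + 2 * k * real i + k \<le> pi" using a k by (simp add: algebra_simps)
        moreover have "0 \<le> a + 2 * k * real i" using a k by simp
        ultimately have "\<exists>\<theta>\<in>{a + 2 * k * real i..a + 2 * k * real i + k}. poly P (cos \<theta>) = 0"
          by (intro zero) (auto simp: k_def)
        then show ?thesis by auto
      qed auto
    qed
    then obtain \<zeta> where \<zeta>: "\<And>i. i < r + 2 \<Longrightarrow> a + 2 * k * real i \<le> \<zeta> i \<and> \<zeta> i \<le> a + 2 * k * real i + k \<and> poly P (cos (\<zeta> i)) = 0"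
      by metis
    have \<zeta>l: "a \<le> \<zeta> i" "\<zeta> i \<le> a + l" if "i < r + 2" for i
    proof -
      have "real i + 1 \<le> real (r + 2)" using that by simp
      then have "2 * k * (real i + 1) \<le> l" unfolding k(2) using k(1) by (intro mult_left_mono) auto
      moreover have "0 \<le> 2 * k * real i" using k by simp
      ultimately show "a \<le> \<zeta> i" "\<zeta> i \<le> a + l"
        using \<zeta>[OF that] k(1) unfolding distrib_left mult_1_right by linarith+
    qed
    have \<zeta>less: "\<zeta> i < \<zeta> j" if "i < j" "j < r + 2" for i j
    proof -
      have "real i + 1 \<le> real j" using that by simp
      then have "2 * k * (real i + 1) \<le> 2 * k * real j" using k(1) by (intro mult_left_mono) auto
      then show ?thesis using \<zeta>[of i] \<zeta>[of j] that k by (auto simp: algebra_simps)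
    qed
    define N where "N = (\<lambda>i. cos (\<zeta> i)) ` {..<r + 2}"
    have "inj_on (\<lambda>i. cos (\<zeta> i)) {..<r + 2}"
    proof (rule linorder_inj_onI')
      fix i j assume ij: "i \<in> {..<r + 2}" "j \<in> {..<r + 2}" "i < j"
      have "cos (\<zeta> j) < cos (\<zeta> i)"
        using \<zeta>less[of i j] \<zeta>l[of i] \<zeta>l[of j] ij a by (intro cos_monotone_0_pi) auto
      then show "cos (\<zeta> i) \<noteq> cos (\<zeta> j)" by simp
    qed
    then have cN: "card N = r + 2" by (simp add: N_def card_image)
    have J: "card (inner_nodes Z u v) > r"
    proof -
      \<comment> \<open>One of the r + 2 zeros may be the largest point of Z and thus not interior;
        more than r remain.\<close>
      have "N - {Max Z} \<subseteq> inner_nodes Z u v"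
      proof
        fix z assume z: "z \<in> N - {Max Z}"
        then obtain i where i: "i < r + 2" "z = cos (\<zeta> i)" by (auto simp: N_def)
        have zr: "poly P z = 0" using \<zeta>[OF i(1)] i by simp
        then have zZ: "z \<in> Z" by (simp add: Z_def X)
        then have "z \<le> Max Z" using Z by simp
        moreover have "u \<le> z" "z \<le> v"
          unfolding u_def v_def i(2) using \<zeta>l[OF i(1)] a by (auto intro!: cos_monotone_0_pi_le)
        ultimately show "z \<in> inner_nodes Z u v"
          using z zZ roots[OF zr] minZ by (auto simp: inner_nodes_def)
      qed
      then have "card (N - {Max Z}) \<le> card (inner_nodes Z u v)"
        using Z by (intro card_mono) (auto simp: inner_nodes_def)
      moreover have "card N - 1 \<le> card (N - {Max Z})" by (simp add: card_Diff_singleton_if)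
      ultimately show ?thesis using cN by linarith
    qed
    have se: "s powr (- e) \<ge> 1" using s jacobi_exponent_bounds(1)[of \<alpha> \<beta>] by (intro ge_one_powr_ge_zero) (auto simp: e_def)
    have uvl: "v - u \<le> l"
    proof -
      have "\<bar>cos a - cos (a + l)\<bar> = 2 * (\<bar>sin ((a + (a + l)) / 2)\<bar> * \<bar>sin (l / 2)\<bar>)" by (simp add: cos_diff_cos abs_mult)
      also have "\<dots> \<le> 2 * (1 * \<bar>l / 2\<bar>)" by (intro mult_left_mono mult_mono abs_sin_x_le_abs_x) auto
      finally show ?thesis using l unfolding u_def v_def by linarith
    qed
    \<comment> \<open>A bound for |\<omega> / \<open>node_weight Z z\<close>| common to all nodes of
      the window, with the sine replaced by s (v - u). It also covers z = t, where the quotient is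
      1, because s (v - u) \<le> L.\<close>
    define M where "M = C1 * s powr (- e) / (s * (v - u))"
    have suv: "s * (v - u) > 0" using s uv by simp
    have bound: "1 / \<bar>node_weight Z z\<bar> \<le> M / \<bar>\<omega>\<bar>"
      if "z \<in> inner_nodes Z u v" for z
    proof (cases "z = t")
      case True
      have "node_weight Z t = \<omega>"
        unfolding node_weight_def \<omega>_def Z_def using t by (intro prod.cong) (auto simp: X_def)
      moreover have "s * (v - u) \<le> C1 * s powr (- e)"
      proof -
        have "s * (v - u) \<le> s * l" using uvl s by (intro mult_left_mono) auto
        also have "\<dots> = L * 1" using s by (simp add: l_def)
        also have "\<dots> \<le> C1 * s powr (- e)" using C1 se L by (intro mult_mono) auto
        finally show ?thesis .
      qed
      then have "1 \<le> M" unfolding M_def using suv by simp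
      ultimately show ?thesis using True by (simp add: divide_right_mono)
    next
      case False
      have z: "z \<in> Z" "Min Z < z" "u \<le> z" "z \<le> v" using that by (auto simp: inner_nodes_def)
      with False have z0: "poly P z = 0" using minZ by (auto simp: Z_def X)
      have z1: "-1 < z" "z < 1" using roots[OF z0] by auto
      define \<phi> where "\<phi> = arccos z"
      have \<phi>: "0 \<le> \<phi>" "\<phi> \<le> pi" "cos \<phi> = z" using z1 by (auto simp: \<phi>_def arccos_lbound arccos_ubound)
      have tt: "0 \<le> arccos t" "arccos t \<le> pi" "cos (arccos t) = t" using t by (auto simp: arccos_lbound arccos_ubound)
      define w where "w = sin \<phi>"
      have ds: "\<delta> / s > 0" using b s by simp
      have w: "\<delta> / s \<le> w" unfolding w_def
        using lagrange z0 \<phi> by blast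
      have wpos: "w > 0" using less_le_trans[OF ds w] .
      have ww: "w * w = (1 - z) * (1 + z)"
        using sin_cos_squared_add2[of \<phi>] \<phi>(3) unfolding w_def by (simp add: power2_eq_square algebra_simps)
      have \<phi>ab: "a \<le> \<phi>" "\<phi> \<le> a + l"
      proof -
        show "a \<le> \<phi>"
        proof (rule ccontr)
          assume "\<not> a \<le> \<phi>"
          then have "cos a < cos \<phi>" using \<phi> a l by (intro cos_monotone_0_pi) auto
          then show False using z \<phi> by (simp add: v_def)
        qed
        show "\<phi> \<le> a + l"
        proof (rule ccontr)
          assume "\<not> \<phi> \<le> a + l"
          then have "cos \<phi> < cos (a + l)" using \<phi> a l by (intro cos_monotone_0_pi) auto
          then show False using z \<phi> by (simp add: u_def)
        qed
      qed
      \<comment> \<open>The zero keeps distance from the end points, w \<ge> \<delta> / s, so the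
        window length l is at most a constant times w.\<close>
      have svw: "s * (v - u) \<le> L * (1 + L / \<delta>) * w"
      proof -
        have "v - u \<le> l * (w + l)"
          unfolding v_def u_def w_def using cos_diff_le[OF a(1) \<phi>ab a(2)] by simp
        moreover have "l \<le> L / \<delta> * w"
        proof -
          have "L / \<delta> * (\<delta> / s) \<le> L / \<delta> * w" using w L b by (intro mult_left_mono) auto
          then show ?thesis using b by (simp add: l_def)
        qed
        ultimately have "v - u \<le> l * (w + L / \<delta> * w)"
          by (elim order.trans) (use l in \<open>intro mult_left_mono add_left_mono; simp\<close>)
        then have "s * (v - u) \<le> s * (l * (w + L / \<delta> * w))" using s by (intro mult_left_mono) auto
        also have "\<dots> = L * (1 + L / \<delta>) * w" using s by (simp add: l_def algebra_simps)
        finally show ?thesis .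
      qed
      define d where "d = \<bar>poly (pderiv P) z\<bar>"
      have nw: "\<bar>c\<bar> * \<bar>node_weight Z z\<bar> = \<bar>z - t\<bar> * (1 + z) * d"
        using c(3)[OF z0] z1 unfolding d_def by (simp add: abs_mult[symmetric]) (simp add: abs_mult)
      have nwn: "\<bar>node_weight Z z\<bar> > 0" using node_weight_nonzero[OF Z(1)] by simp
      have om: "\<bar>c\<bar> * \<bar>\<omega>\<bar> = (1 + t) * \<bar>poly P t\<bar>"
        using c(2) t by (simp add: abs_mult[symmetric]) (simp add: abs_mult)
      have "(1 + t) * \<bar>poly P t\<bar> * (1 - z) \<le> C0 * s powr (- e) * (w * d) * \<bar>t - z\<bar>"
      proof -
        have "(1 + cos (arccos t)) * \<bar>poly P (cos (arccos t))\<bar> * (1 - cos \<phi>) \<le>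
            C0 * s powr (- e) * \<bar>trig_deriv P \<phi>\<bar> * \<bar>cos (arccos t) - cos \<phi>\<bar>"
          using lagrange z0 \<phi> tt(1,2) unfolding e_def by blast
        then show ?thesis using wpos unfolding tt(3) \<phi>(3)
          by (simp add: trig_deriv_def abs_mult \<phi>(3) d_def w_def)
      qed
      then have "\<bar>c\<bar> * \<bar>\<omega>\<bar> * (1 - z) * (1 + z) \<le> C0 * s powr (- e) * (w * d) * \<bar>t - z\<bar> * (1 + z)"
        unfolding om[symmetric] using z1 by (intro mult_right_mono) auto
      also have "\<dots> = \<bar>c\<bar> * (C0 * s powr (- e) * w * \<bar>node_weight Z z\<bar>)"
        using nw by (simp add: abs_minus_commute mult_ac)
      finally have "\<bar>c\<bar> * (\<bar>\<omega>\<bar> * (w * w)) \<le> \<bar>c\<bar> * (C0 * s powr (- e) * w * \<bar>node_weight Z z\<bar>)"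
        unfolding ww by (simp add: mult_ac)
      then have "\<bar>\<omega>\<bar> * (w * w) \<le> C0 * s powr (- e) * w * \<bar>node_weight Z z\<bar>"
        by (rule mult_left_le_imp_le) (use c(1) in simp)
      then have "w * (\<bar>\<omega>\<bar> * w) \<le> w * (C0 * s powr (- e) * \<bar>node_weight Z z\<bar>)"
        by (simp add: mult_ac)
      then have omw: "\<bar>\<omega>\<bar> * w \<le> C0 * s powr (- e) * \<bar>node_weight Z z\<bar>" using wpos by simp
      have "\<bar>\<omega>\<bar> * (s * (v - u)) \<le> \<bar>\<omega>\<bar> * (L * (1 + L / \<delta>) * w)" using svw by (intro mult_left_mono) auto
      also have "\<dots> = L * (1 + L / \<delta>) * (\<bar>\<omega>\<bar> * w)" by (simp add: mult_ac)
      also have "\<dots> \<le> L * (1 + L / \<delta>) * (C0 * s powr (- e) * \<bar>node_weight Z z\<bar>)"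
        using omw L b by (intro mult_left_mono) auto
      also have "\<dots> = C0 * (L * (1 + L / \<delta>)) * (s powr (- e) * \<bar>node_weight Z z\<bar>)" by (simp add: mult_ac)
      also have "\<dots> \<le> C1 * (s powr (- e) * \<bar>node_weight Z z\<bar>)" using C1(2) by (intro mult_right_mono) auto
      finally have "\<bar>\<omega>\<bar> * (s * (v - u)) \<le> C1 * s powr (- e) * \<bar>node_weight Z z\<bar>" by (simp add: mult.assoc)
      then have "\<bar>\<omega>\<bar> \<le> M * \<bar>node_weight Z z\<bar>" unfolding M_def using suv by (simp add: field_simps)
      then show ?thesis using nwn \<omega> by (simp add: field_simps)
    qed
    have "\<bar>tker Z r y\<bar> \<le> fact r * (v - u) ^ r * (M / \<bar>\<omega>\<bar>)"
      using n r uy uv minZ bound unfolding u_def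
      by (intro abs_tker_le[OF Z _ _ _ J[unfolded u_def]]) auto
    then have "\<bar>\<omega>\<bar> * \<bar>tker Z r y\<bar> \<le> \<bar>\<omega>\<bar> * (fact r * (v - u) ^ r * (M / \<bar>\<omega>\<bar>))" by (rule mult_left_mono) simp
    also have "\<dots> = fact r * ((v - u) ^ r * M)" using \<omega> by simp
    \<comment> \<open>One width cancels the denominator of M and leaves 1 / s; each other width is
      at most L / s, giving s^(-r) in total.\<close>
    also have "(v - u) ^ r * M = (v - u) ^ (r - 1) * (C1 * s powr (- e) / s)"
    proof -
      have "x ^ Suc m * (c / (s * x)) = x ^ m * (c / s)" if "x > 0" for x c :: real and m
        using that by (simp add: field_simps)
      from this[of "v - u" "r - 1" "C1 * s powr (- e)"] show ?thesis using r uv by (simp add: M_def)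
    qed
    also have "\<dots> \<le> l ^ (r - 1) * (C1 * s powr (- e) / s)"
      using uvl uv C1 s by (intro mult_right_mono power_mono) auto
    also have "\<dots> = C1 * L ^ (r - 1) * (s powr (- real r) * s powr (- e))"
    proof -
      have "s powr (- real r) = 1 / s ^ r" using s by (simp add: powr_minus powr_realpow divide_inverse)
      also have "\<dots> = 1 / s ^ (r - 1) / s" using r by (cases r) auto
      finally show ?thesis by (simp add: l_def power_divide)
    qed
    finally show "\<bar>\<Prod>x\<in>jacobi_nodes \<alpha> \<beta> n. t - x\<bar> * \<bar>tker (insert t (jacobi_nodes \<alpha> \<beta> n)) r y\<bar> \<le>
         C * (s powr (- real r) * s powr (- jacobi_exponent \<alpha> \<beta>))"
      by (simp add: C_def e_def Z_def X_def \<omega>_def mult.assoc)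
  qed
qed

text \<open>Finitely many indices are absorbed into the constant by adding all their quotients |F n|
  / w n.\<close>

lemma eventually_bound_imp_bound:
  fixes F w :: "nat \<Rightarrow> real"
  assumes "\<And>n. n \<ge> N0 \<Longrightarrow> F n \<le> C * w n" and "\<And>n. n \<ge> m \<Longrightarrow> w n > 0"
  shows "\<exists>C. \<forall>n\<ge>m. F n \<le> C * w n"
proof (intro exI allI impI)
  define B where "B = (\<Sum>n\<in>{m..<N0}. \<bar>F n\<bar> / w n)"
  have B: "B \<ge> 0" unfolding B_def using assms(2) by (intro sum_nonneg divide_nonneg_pos) auto
  fix n assume n: "m \<le> n"
  have w: "w n > 0" by (rule assms(2)[OF n])
  show "F n \<le> (\<bar>C\<bar> + B) * w n"
  proof (cases "n \<ge> N0")
    case True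
    then have "F n \<le> C * w n" by (rule assms(1))
    also have "\<dots> \<le> (\<bar>C\<bar> + B) * w n" using w B by (intro mult_right_mono) auto
    finally show ?thesis .
  next
    case False
    have "\<bar>F n\<bar> / w n \<le> B"
      unfolding B_def using False n assms(2) by (intro member_le_sum divide_nonneg_pos) auto
    then have "\<bar>F n\<bar> \<le> B * w n" using w by (simp add: field_simps)
    also have "\<dots> \<le> (\<bar>C\<bar> + B) * w n" using w by (intro mult_right_mono) auto
    finally show ?thesis by simp
  qed
qed

text \<open>Translates powers of s into powers of n; n \<ge> 2 makes n + \<alpha> + \<beta> + 1 at
  least n / 4, since \<alpha> + \<beta> > -2.\<close>

lemma sqrt_eigenvalue_bounds:
  assumes "\<alpha> > -1" "\<beta> > -1" "n \<ge> 2"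
  shows "real n / 2 \<le> sqrt (real n * (real n + \<alpha> + \<beta> + 1))"
    and "sqrt (real n * (real n + \<alpha> + \<beta> + 1)) \<le> (2 + \<bar>\<alpha> + \<beta>\<bar>) * real n"
proof -
  have n: "real n \<ge> 2" using assms by simp
  have "(real n / 2)\<^sup>2 = real n * (real n / 4)" by (simp add: power2_eq_square)
  also have "\<dots> \<le> real n * (real n + \<alpha> + \<beta> + 1)" using n assms by (intro mult_left_mono) auto
  finally show "real n / 2 \<le> sqrt (real n * (real n + \<alpha> + \<beta> + 1))" by (rule real_le_rsqrt)
  let ?k = "2 + \<bar>\<alpha> + \<beta>\<bar>"
  have "real n + \<alpha> + \<beta> + 1 \<le> ?k * real n"
  proof -
    have "\<alpha> + \<beta> \<le> \<bar>\<alpha> + \<beta>\<bar> * 1" by simp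
    also have "\<dots> \<le> \<bar>\<alpha> + \<beta>\<bar> * real n" using n by (intro mult_left_mono) auto
    finally show ?thesis using n by (simp add: algebra_simps)
  qed
  also have "\<dots> \<le> ?k * (?k * real n)" using n mult_right_mono[of 1 ?k "?k * real n"] by simp
  finally have "real n * (real n + \<alpha> + \<beta> + 1) \<le> real n * (?k * (?k * real n))"
    using n by (intro mult_left_mono) auto
  also have "\<dots> = (?k * real n)\<^sup>2" by (simp add: power2_eq_square mult_ac)
  finally show "sqrt (real n * (real n + \<alpha> + \<beta> + 1)) \<le> ?k * real n"
    using n by (intro real_le_lsqrt) auto
qed

lemma S_hat_exponent: "(\<alpha>, \<beta>) \<in> S_hat \<Longrightarrow> jacobi_exponent \<alpha> \<beta> = 0"
  by (auto simp: S_hat_def jacobi_exponent_def min_def)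

theorem theorem4p7:
  fixes \<alpha> \<beta> :: real and r :: nat
    and f g :: "real \<Rightarrow> real" and D :: "nat \<Rightarrow> real \<Rightarrow> real"
  assumes "\<alpha> > -1" and "\<beta> > -1" and "r \<ge> 1"
    and "\<forall>t\<in>{-1..1}. D 0 t = f t"
    and "\<forall>k<r-1. \<forall>t\<in>{-1..1}. (D k has_real_derivative D (Suc k) t) (at t within {-1..1})"
    and "abs_continuous_on {-1..1} (D (r-1))"
    and "g absolutely_integrable_on {-1..1}"
    and "bounded_variation_on {-1..1} g"
    and "\<forall>t\<in>{-1..1}. D (r-1) t = D (r-1) (-1) + integral {-1..t} g"
  shows "(\<exists>C. \<forall>n\<ge>r+1. sup_norm (jacobi_interp_error \<alpha> \<beta> n f)
             \<le> real n powr (- real r) * (C * real n powr (- jacobi_exponent \<alpha> \<beta>))) \<and>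
         ((\<alpha>, \<beta>) \<in> S_hat \<longrightarrow>
           (\<exists>C. \<forall>n\<ge>r+1. sup_norm (jacobi_interp_error \<alpha> \<beta> n f) \<le> C * real n powr (- real r)))"
proof -
  note ab = assms(1,2)
  define e where "e = jacobi_exponent \<alpha> \<beta>"
  define w where "w = (\<lambda>n::nat. real n powr (- real r) * real n powr (- e))"
  obtain V where V: "\<And>(m::nat) x. x ` {..m} \<subseteq> {-1..1} \<Longrightarrow> mono_on {..m} x \<Longrightarrow>
        (\<Sum>i<m. \<bar>g (x (Suc i)) - g (x i)\<bar>) \<le> V"
    using assms(8) unfolding bounded_variation_on_def by blast
  have V0: "V \<ge> 0" using V[of "\<lambda>_. 0" 0] by (simp add: mono_on_def)
  have gint: "g integrable_on {-1..1}" using assms(7) by (rule set_lebesgue_integral_eq_integral(1))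
  have G: "\<And>t. t \<in> {-1..1} \<Longrightarrow> D (r - 1) t = D (r - 1) (-1) + integral {-1..t} g" using assms(9) by blast
  have cont: "continuous_on {-1..1} (D (r - 1))"
  proof -
    have "continuous_on {-1..1} (\<lambda>t. D (r - 1) (-1) + integral {-1..t} g)"
      by (intro continuous_intros indefinite_integral_continuous_1 gint)
    moreover have "continuous_on {-1..1} (D (r - 1)) \<longleftrightarrow>
        continuous_on {-1..1} (\<lambda>t. D (r - 1) (-1) + integral {-1..t} g)"
      by (rule continuous_on_cong[OF refl]) (rule G)
    ultimately show ?thesis by simp
  qed
  obtain C s1 where C: "C > 0" "s1 \<ge> 1" and K:
    "\<And>n s t y. r + 1 \<le> n \<Longrightarrow> s = sqrt (real n * (real n + \<alpha> + \<beta> + 1)) \<Longrightarrow> s1 \<le> s \<Longrightarrow>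
       t \<in> {-1..1} \<Longrightarrow> t \<notin> jacobi_nodes \<alpha> \<beta> n \<Longrightarrow> y \<in> {-1..1} \<Longrightarrow>
       \<bar>\<Prod>x\<in>jacobi_nodes \<alpha> \<beta> n. t - x\<bar> * \<bar>tker (insert t (jacobi_nodes \<alpha> \<beta> n)) r y\<bar> \<le>
         C * (s powr (- real r) * s powr (- jacobi_exponent \<alpha> \<beta>))"
    by (rule jacobi_tker_bound[OF ab assms(3)]) blast
  define \<Gamma> where "\<Gamma> = 2 + \<bar>\<alpha> + \<beta>\<bar>"
  define C' where "C' = V / fact r * (C * (2 powr real r * \<Gamma> powr (- e)))"
  define N0 where "N0 = max (r + 1) (nat \<lceil>2 * s1\<rceil>)"
  have e0: "e \<le> 0" unfolding e_def by (rule jacobi_exponent_bounds)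
  have large: "sup_norm (jacobi_interp_error \<alpha> \<beta> n f) \<le> C' * w n" if n: "n \<ge> N0" for n
  proof -
    define X where "X = jacobi_nodes \<alpha> \<beta> n"
    define p where "p = jacobi_interpolant \<alpha> \<beta> n f"
    define s where "s = sqrt (real n * (real n + \<alpha> + \<beta> + 1))"
    have n1: "r + 1 \<le> n" "2 * s1 \<le> real n" "n \<ge> 2" using n assms(3) by (auto simp: N0_def)
    have s: "real n / 2 \<le> s" "s \<le> \<Gamma> * real n" "s1 \<le> s"
      using sqrt_eigenvalue_bounds[OF ab n1(3)] n1 by (auto simp: s_def \<Gamma>_def)
    have fX: "finite X" "card X = n + 1"
      unfolding X_def by (rule finite_jacobi_nodes[OF ab], rule card_jacobi_nodes[OF ab])
    have XI: "X \<subseteq> {-1..1}" unfolding X_def using jacobi_nodes_subset[OF ab, of n] by auto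
    have p: "degree p \<le> n" "\<And>t. t \<in> X \<Longrightarrow> poly p t = f t"
      using theI'[OF ex1_jacobi_interpolant[OF ab, of n f]]
      unfolding p_def jacobi_interpolant_def X_def by auto
    have sw: "s powr (- real r) * s powr (- e) \<le> 2 powr real r * \<Gamma> powr (- e) * w n"
    proof -
      have "s powr (- real r) \<le> (real n / 2) powr (- real r)"
        using s n1 by (intro powr_mono2') auto
      also have "\<dots> = 2 powr real r * real n powr (- real r)"
        using n1 by (simp add: powr_divide powr_minus field_simps)
      finally have "s powr (- real r) \<le> 2 powr real r * real n powr (- real r)" .
      moreover have "s powr (- e) \<le> (\<Gamma> * real n) powr (- e)"
        using s n1 e0 C by (intro powr_mono2) auto
      then have "s powr (- e) \<le> \<Gamma> powr (- e) * real n powr (- e)" by (simp add: powr_mult \<Gamma>_def)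
      ultimately have "s powr (- real r) * s powr (- e) \<le>
         (2 powr real r * real n powr (- real r)) * (\<Gamma> powr (- e) * real n powr (- e))"
        by (intro mult_mono) auto
      then show ?thesis by (simp add: w_def mult_ac)
    qed
    have pt: "\<bar>f t - poly p t\<bar> \<le> C' * w n" if t: "t \<in> {-1..1}" for t
    proof (cases "t \<in> X")
      case True
      then show ?thesis using p V0 C by (simp add: C'_def w_def)
    next
      case False
      define Z where "Z = insert t X"
      define \<omega> where "\<omega> = (\<Prod>x\<in>X. t - x)"
      have \<omega>: "\<bar>\<omega>\<bar> > 0" using False fX by (auto simp: \<omega>_def)
      have Z: "finite Z" "Z \<subseteq> {-1..1}" "r + 2 \<le> card Z"
        using fX XI t False n1 by (auto simp: Z_def)
      define B where "B = C * (2 powr real r * \<Gamma> powr (- e) * w n) / \<bar>\<omega>\<bar>"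
      have B: "\<bar>tker Z r y\<bar> \<le> B" if "y \<in> {-1..1}" for y
      proof -
        have "\<bar>\<omega>\<bar> * \<bar>tker Z r y\<bar> \<le> C * (s powr (- real r) * s powr (- e))"
          unfolding \<omega>_def Z_def X_def e_def
          by (rule K[OF n1(1) s_def s(3) t _ that]) (use False in \<open>simp add: X_def\<close>)
        also have "\<dots> \<le> C * (2 powr real r * \<Gamma> powr (- e) * w n)"
          using sw C by (intro mult_left_mono) auto
        finally show ?thesis using \<omega> by (simp add: B_def field_simps)
      qed
      \<comment> \<open>\<open>D 0\<close> and f are only known to agree on [-1, 1], which contains
        Z.\<close>
      have "divdiff Z f = divdiff Z (D 0)"
        unfolding divdiff_def using Z(2) assms(4) by (intro sum.cong) auto
      moreover have "\<bar>divdiff Z (D 0)\<bar> \<le> V * B / fact r"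
        by (rule abs_divdiff_le[where D = D and g = g, OF Z assms(3) _ cont gint G V B]) (use assms(5) in auto)
      ultimately have "\<bar>\<omega>\<bar> * \<bar>divdiff Z f\<bar> \<le> \<bar>\<omega>\<bar> * (V * B / fact r)"
        by (intro mult_left_mono) auto
      also have "\<dots> = C' * w n" using \<omega> by (simp add: B_def C'_def)
      also have "\<bar>\<omega>\<bar> * \<bar>divdiff Z f\<bar> = \<bar>f t - poly p t\<bar>"
        using interpolation_error_divdiff[OF fX(1) False _ p(2)] p(1) fX(2)
        by (simp add: abs_mult \<omega>_def Z_def)
      finally show ?thesis .
    qed
    show ?thesis
      unfolding sup_norm_def jacobi_interp_error_def p_def[symmetric]
      by (rule cSUP_least) (use pt in auto)
  qed
  \<comment> \<open>The energy estimates require s \<ge> s1 and hence large n; the finitely many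
    remaining n only enlarge the constant.\<close>
  have "\<exists>C. \<forall>n\<ge>r+1. sup_norm (jacobi_interp_error \<alpha> \<beta> n f) \<le> C * w n"
    by (rule eventually_bound_imp_bound[OF large]) (auto simp: w_def)
  then obtain C2 where C2: "\<And>n. n \<ge> r + 1 \<Longrightarrow> sup_norm (jacobi_interp_error \<alpha> \<beta> n f) \<le> C2 * w n" by blast
  show ?thesis
  proof (intro conjI impI exI[of _ C2] allI)
    fix n assume "r + 1 \<le> n"
    from C2[OF this] show "sup_norm (jacobi_interp_error \<alpha> \<beta> n f)
        \<le> real n powr (- real r) * (C2 * real n powr (- jacobi_exponent \<alpha> \<beta>))"
      by (simp add: w_def e_def mult_ac)
  next
    fix n assume "(\<alpha>, \<beta>) \<in> S_hat" and n: "r + 1 \<le> n"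
    then have "e = 0" unfolding e_def by (intro S_hat_exponent)
    then show "sup_norm (jacobi_interp_error \<alpha> \<beta> n f) \<le> C2 * real n powr (- real r)"
      using C2[OF n] n by (simp add: w_def)
  qed
qed

end
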